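(* Let $Y$ be a compact nonpositively curved cube complex and let $\mathcal{O}$ be the set of all injective partial local isometries $\varphi: Y'\to Y$ of $Y$ whose domain $Y'\subset Y$ is connected. Then there is a compact nonpositively curved cube complex $R$ in which $Y$ embeds (as a subcomplex) such that each $\varphi\in\mathcal{O}$ extends to an automorphism $\Phi\in\operatorname{Aut}(R)$; that is, regarding $Y$ as a subcomplex of $R$, $\Phi|_{Y'}=\varphi$.
   Context: An $n$-cube is a copy of $[-1,1]^n$; its faces are obtained by restricting some coordinates to $\pm1$. A cube complex is a cell complex built from cubes glued together along their faces. The link $\operatorname{link}_X(x)$ of a $0$-cube $x$ is the complex of simplices with one $(m-1)$-simplex for each corner at $x$ of an $m$-cube ($m\ge1$). A simplicial complex is flag if any $n+1$ pairwise adjacent vertices span an $n$-simplex. A cube complex is nonpositively curved if the link of each $0$-cube is a flag simplicial complex. A subcomplex $K$ of a simplicial complex $L$ is full if any simplex of $L$ whose vertices lie in $K$ is itself in $K$. A subcomplex $A$ of a cube complex $B$ is locally convex if $\operatorname{link}_A(x)\subset\operatorname{link}_B(x)$ is a full subcomplex for every $0$-cube $x\in A$. A map of cube complexes is combinatorial if it maps open cells homeomorphically and isometrically onto open cells. A combinatorial map $\Phi:X\to Z$ of nonpositively curved cube complexes is a local isometry if for each $0$-cube $x$ of $X$ the induced map $\operatorname{link}_X(x)\to\operatorname{link}_Z(\Phi(x))$ is an embedding onto a full subcomplex. $\operatorname{Aut}(R)$ is the group of combinatorial automorphisms of $R$. For a compact nonpositively curved cube complex $Y$ and a subcomplex $Y'\subset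 Y$, a map $\varphi:Y'\to Y$ is a partial local isometry of $Y$ if $\varphi$ is a local isometry and both $Y'$ and $\varphi(Y')$ are locally convex subcomplexes of $Y$. *)

theory Defs
  imports "HOL-Analysis.Analysis"
begin

section \<open>Cubes\<close>

text \<open>Points of the \<open>n\<close>-cube are functions on \<open>nat\<close> that are \<open>undefined\<close> from index \<open>n\<close> on
  (so that all dimensions live in one type); in particular the \<open>0\<close>-cube has exactly one point.\<close>

definition cube :: "nat \<Rightarrow> (nat \<Rightarrow> real) set" where
  "cube n = {..<n} \<rightarrow>\<^sub>E {-1..1}"

definition open_cube :: "nat \<Rightarrow> (nat \<Rightarrow> real) set" where
  "open_cube n = {..<n} \<rightarrow>\<^sub>E {-1<..<1}"

definition cube_vertices :: "nat \<Rightarrow> (nat \<Rightarrow> real) set" where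
  "cube_vertices n = {..<n} \<rightarrow>\<^sub>E {-1, 1}"

definition cube_faces :: "nat \<Rightarrow> (nat \<Rightarrow> real) set set" where
  "cube_faces n = {{v \<in> cube n. \<forall>i\<in>J. v i = s i} | J s. J \<subseteq> {..<n} \<and> s \<in> J \<rightarrow> {-1, 1}}"

definition cube_dist :: "nat \<Rightarrow> (nat \<Rightarrow> real) \<Rightarrow> (nat \<Rightarrow> real) \<Rightarrow> real" where
  "cube_dist n u v = L2_set (\<lambda>i. u i - v i) {..<n}"

text \<open>\<open>g\<close> is a Euclidean isometry of \<open>A\<close> (inside the \<open>m\<close>-cube) onto \<open>B\<close> (inside the \<open>n\<close>-cube).\<close>

definition cube_isometry ::
  "nat \<Rightarrow> (nat \<Rightarrow> real) set \<Rightarrow> nat \<Rightarrow> (nat \<Rightarrow> real) set \<Rightarrow> ((nat \<Rightarrow> real) \<Rightarrow> nat \<Rightarrow> real) \<Rightarrow> bool" where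
  "cube_isometry m A n B g \<longleftrightarrow>
     bij_betw g A B \<and> (\<forall>u\<in>A. \<forall>v\<in>A. cube_dist n (g u) (g v) = cube_dist m u v)"


section \<open>Cube complexes\<close>

record ('c, 'p) cube_complex =
  cells :: "'c set"
  cdim :: "'c \<Rightarrow> nat"
  chart :: "'c \<Rightarrow> (nat \<Rightarrow> real) \<Rightarrow> 'p"

definition open_cell :: "('c, 'p) cube_complex \<Rightarrow> 'c \<Rightarrow> 'p set" where
  "open_cell X c = chart X c ` open_cube (cdim X c)"

definition points :: "('c, 'p) cube_complex \<Rightarrow> 'p set" where
  "points X = (\<Union>c\<in>cells X. chart X c ` cube (cdim X c))"

text \<open>\<open>chart X c\<close> is the characteristic map of the cell \<open>c\<close>. Open cells are embedded and pairwise
  disjoint, and on every face of a cube the characteristic map is, up to an isometry of cubes, the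
  characteristic map of another cell: this is the gluing along faces. Two faces of the same cube
  may be glued to each other.\<close>

definition cube_complex :: "('c, 'p) cube_complex \<Rightarrow> bool" where
  "cube_complex X \<longleftrightarrow>
     (\<forall>c\<in>cells X. inj_on (chart X c) (open_cube (cdim X c))) \<and>
     (\<forall>c\<in>cells X. \<forall>d\<in>cells X. c \<noteq> d \<longrightarrow> open_cell X c \<inter> open_cell X d = {}) \<and>
     (\<forall>c\<in>cells X. \<forall>F\<in>cube_faces (cdim X c).
        \<exists>d\<in>cells X. \<exists>g. cube_isometry (cdim X d) (cube (cdim X d)) (cdim X c) F g \<and>
          (\<forall>u\<in>cube (cdim X d). chart X c (g u) = chart X d u))"

text \<open>The quotient topology induced by all characteristic maps.\<close>

definition cc_topology :: "('c, 'p) cube_complex \<Rightarrow> 'p topology" where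
  "cc_topology X = topology (\<lambda>U. U \<subseteq> points X \<and>
     (\<forall>c\<in>cells X. openin (top_of_set (cube (cdim X c))) {u \<in> cube (cdim X c). chart X c u \<in> U}))"

lemma openin_cc_topology:
  "openin (cc_topology X) U \<longleftrightarrow> U \<subseteq> points X \<and>
     (\<forall>c\<in>cells X. openin (top_of_set (cube (cdim X c))) {u \<in> cube (cdim X c). chart X c u \<in> U})"
proof -
  let ?P = "\<lambda>U. U \<subseteq> points X \<and>
     (\<forall>c\<in>cells X. openin (top_of_set (cube (cdim X c))) {u \<in> cube (cdim X c). chart X c u \<in> U})"
  have Int: "?P (S \<inter> T)" if S: "?P S" and T: "?P T" for S T
  proof -
    have eq: "{u \<in> cube (cdim X c). chart X c u \<in> S \<inter> T} =
          {u \<in> cube (cdim X c). chart X c u \<in> S} \<inter> {u \<in> cube (cdim X c). chart X c u \<in> T}" for c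
      by auto
    show ?thesis
      unfolding eq using S T by (blast intro: openin_Int)
  qed
  have Un: "?P (\<Union>\<K>)" if "\<forall>K\<in>\<K>. ?P K" for \<K>
  proof -
    have eq: "{u \<in> cube (cdim X c). chart X c u \<in> \<Union>\<K>} =
          (\<Union>K\<in>\<K>. {u \<in> cube (cdim X c). chart X c u \<in> K})" for c
      by auto
    show ?thesis
      unfolding eq using that by (blast intro: openin_Union)
  qed
  have "istopology ?P"
    unfolding istopology_def using Int Un by blast
  then show ?thesis
    unfolding cc_topology_def by (simp only: topology_inverse')
qed

lemma topspace_cc_topology [simp]: "topspace (cc_topology X) = points X"
proof -
  have eq: "{u \<in> cube (cdim X c). chart X c u \<in> points X} = cube (cdim X c)" if "c \<in> cells X" for c
    using that by (auto simp: points_def)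
  have "openin (cc_topology X) (points X)"
    unfolding openin_cc_topology by (simp add: eq)
  then show ?thesis
    by (metis openin_cc_topology openin_subset openin_topspace subset_antisym)
qed

definition subcomplex_on :: "('c, 'p) cube_complex \<Rightarrow> 'c set \<Rightarrow> ('c, 'p) cube_complex" where
  "subcomplex_on X S = X\<lparr>cells := S\<rparr>"

definition is_subcomplex :: "('c, 'p) cube_complex \<Rightarrow> 'c set \<Rightarrow> bool" where
  "is_subcomplex X S \<longleftrightarrow> S \<subseteq> cells X \<and> cube_complex (subcomplex_on X S)"


section \<open>Links and nonpositive curvature\<close>

text \<open>The \<open>0\<close>-cubes, regarded as points of the complex.\<close>

definition zero_cubes :: "('c, 'p) cube_complex \<Rightarrow> 'p set" where
  "zero_cubes X = (\<Union>c\<in>{c \<in> cells X. cdim X c = 0}. chart X c ` cube 0)"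

text \<open>A corner of a cube is a cell together with a vertex of its model cube. The link at \<open>x\<close> is the
  set of all corners at \<open>x\<close>, a corner of an \<open>m\<close>-cube being an \<open>(m-1)\<close>-simplex.\<close>

type_synonym 'c corner = "'c \<times> (nat \<Rightarrow> real)"

definition link :: "('c, 'p) cube_complex \<Rightarrow> 'p \<Rightarrow> 'c corner set" where
  "link X x = {(c, v). c \<in> cells X \<and> 1 \<le> cdim X c \<and> v \<in> cube_vertices (cdim X c) \<and> chart X c v = x}"

text \<open>\<open>(d, w)\<close> is a face of \<open>(c, v)\<close> if \<open>d\<close> is glued to a face of the cube \<open>c\<close> through \<open>v\<close>, with \<open>w\<close>
  placed at \<open>v\<close>.\<close>

definition corner_face :: "('c, 'p) cube_complex \<Rightarrow> 'c corner \<Rightarrow> 'c corner \<Rightarrow> bool" where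
  "corner_face X \<tau> \<sigma> \<longleftrightarrow>
     (\<exists>F\<in>cube_faces (cdim X (fst \<sigma>)). \<exists>g.
        cube_isometry (cdim X (fst \<tau>)) (cube (cdim X (fst \<tau>))) (cdim X (fst \<sigma>)) F g \<and>
        (\<forall>u\<in>cube (cdim X (fst \<tau>)). chart X (fst \<sigma>) (g u) = chart X (fst \<tau>) u) \<and>
        g (snd \<tau>) = snd \<sigma>)"

definition link_vertices :: "('c, 'p) cube_complex \<Rightarrow> 'c corner set \<Rightarrow> 'c corner set" where
  "link_vertices X L = {\<tau> \<in> L. cdim X (fst \<tau>) = 1}"

definition simplex_vertices ::
  "('c, 'p) cube_complex \<Rightarrow> 'c corner set \<Rightarrow> 'c corner \<Rightarrow> 'c corner set" where
  "simplex_vertices X L \<sigma> = {\<tau> \<in> link_vertices X L. corner_face X \<tau> \<sigma>}"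

text \<open>A complex of simplices is simplicial if the vertices of each simplex are distinct and
  distinct simplices have distinct vertex sets.\<close>

definition simplicial_link :: "('c, 'p) cube_complex \<Rightarrow> 'c corner set \<Rightarrow> bool" where
  "simplicial_link X L \<longleftrightarrow>
     (\<forall>\<sigma>\<in>L. card (simplex_vertices X L \<sigma>) = cdim X (fst \<sigma>)) \<and> inj_on (simplex_vertices X L) L"

definition adjacent_in_link ::
  "('c, 'p) cube_complex \<Rightarrow> 'c corner set \<Rightarrow> 'c corner \<Rightarrow> 'c corner \<Rightarrow> bool" where
  "adjacent_in_link X L a b \<longleftrightarrow> a \<noteq> b \<and> (\<exists>\<sigma>\<in>L. simplex_vertices X L \<sigma> = {a, b})"

definition flag_link :: "('c, 'p) cube_complex \<Rightarrow> 'c corner set \<Rightarrow> bool" where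
  "flag_link X L \<longleftrightarrow>
     (\<forall>V. V \<subseteq> link_vertices X L \<and> finite V \<and> V \<noteq> {} \<and>
          (\<forall>a\<in>V. \<forall>b\<in>V. a \<noteq> b \<longrightarrow> adjacent_in_link X L a b) \<longrightarrow>
        (\<exists>\<sigma>\<in>L. simplex_vertices X L \<sigma> = V))"

definition npc :: "('c, 'p) cube_complex \<Rightarrow> bool" where
  "npc X \<longleftrightarrow> cube_complex X \<and>
     (\<forall>x\<in>zero_cubes X. simplicial_link X (link X x) \<and> flag_link X (link X x))"

text \<open>\<open>K\<close> is a full subcomplex of \<open>L\<close>, both being sets of corners of \<open>X\<close>.\<close>

definition full_subcomplex :: "('c, 'p) cube_complex \<Rightarrow> 'c corner set \<Rightarrow> 'c corner set \<Rightarrow> bool" where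
  "full_subcomplex X K L \<longleftrightarrow>
     K \<subseteq> L \<and> (\<forall>\<sigma>\<in>K. \<forall>\<tau>\<in>L. corner_face X \<tau> \<sigma> \<longrightarrow> \<tau> \<in> K) \<and>
     (\<forall>\<sigma>\<in>L. simplex_vertices X L \<sigma> \<subseteq> K \<longrightarrow> \<sigma> \<in> K)"

definition locally_convex :: "('c, 'p) cube_complex \<Rightarrow> 'c set \<Rightarrow> bool" where
  "locally_convex X S \<longleftrightarrow> is_subcomplex X S \<and>
     (\<forall>x\<in>zero_cubes (subcomplex_on X S). full_subcomplex X (link (subcomplex_on X S) x) (link X x))"


section \<open>Maps\<close>

text \<open>\<open>f\<close> carries the open cell \<open>c\<close> isometrically onto the open cell \<open>d\<close>, where \<open>g\<close> is \<open>f\<close> in the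
  coordinates of the two cubes. Isometries of open cubes are the restrictions of those of the closed
  cubes; the extension to the closed cube is used to see corners. Since characteristic maps are
  homeomorphisms from open cubes onto open cells, \<open>f\<close> is then also a homeomorphism between the open
  cells.\<close>

definition carries_cell ::
  "('p \<Rightarrow> 'q) \<Rightarrow> ('c, 'p) cube_complex \<Rightarrow> 'c \<Rightarrow> ('d, 'q) cube_complex \<Rightarrow> 'd \<Rightarrow>
     ((nat \<Rightarrow> real) \<Rightarrow> nat \<Rightarrow> real) \<Rightarrow> bool" where
  "carries_cell f X c Z d g \<longleftrightarrow>
     cube_isometry (cdim X c) (cube (cdim X c)) (cdim Z d) (cube (cdim Z d)) g \<and>
     (\<forall>u\<in>open_cube (cdim X c). f (chart X c u) = chart Z d (g u))"

definition combinatorial_map ::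
  "('p \<Rightarrow> 'q) \<Rightarrow> ('c, 'p) cube_complex \<Rightarrow> ('d, 'q) cube_complex \<Rightarrow> bool" where
  "combinatorial_map f X Z \<longleftrightarrow>
     continuous_map (cc_topology X) (cc_topology Z) f \<and>
     (\<forall>c\<in>cells X. \<exists>d\<in>cells Z. \<exists>g. carries_cell f X c Z d g)"

text \<open>The map induced on links by a combinatorial map. The corner described is unique because open
  cells are disjoint and their characteristic maps are injective.\<close>

definition link_map ::
  "('p \<Rightarrow> 'q) \<Rightarrow> ('c, 'p) cube_complex \<Rightarrow> ('d, 'q) cube_complex \<Rightarrow> 'c corner \<Rightarrow> 'd corner" where
  "link_map f X Z \<sigma> =
     (THE \<tau>. fst \<tau> \<in> cells Z \<and> (\<exists>g. carries_cell f X (fst \<sigma>) Z (fst \<tau>) g \<and> g (snd \<sigma>) = snd \<tau>))"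

definition local_isometry ::
  "('p \<Rightarrow> 'q) \<Rightarrow> ('c, 'p) cube_complex \<Rightarrow> ('d, 'q) cube_complex \<Rightarrow> bool" where
  "local_isometry f X Z \<longleftrightarrow> npc X \<and> npc Z \<and> combinatorial_map f X Z \<and>
     (\<forall>x\<in>zero_cubes X.
        inj_on (link_map f X Z) (link X x) \<and>
        full_subcomplex Z (link_map f X Z ` link X x) (link Z (f x)))"

definition cc_isomorphism ::
  "('p \<Rightarrow> 'q) \<Rightarrow> ('c, 'p) cube_complex \<Rightarrow> ('d, 'q) cube_complex \<Rightarrow> bool" where
  "cc_isomorphism f X Z \<longleftrightarrow>
     bij_betw f (points X) (points Z) \<and> combinatorial_map f X Z \<and>
     combinatorial_map (inv_into (points X) f) Z X"

text \<open>Only the values on \<open>points R\<close> matter.\<close>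

definition Aut :: "('c, 'p) cube_complex \<Rightarrow> ('p \<Rightarrow> 'p) set" where
  "Aut R = {\<Phi>. cc_isomorphism \<Phi> R R}"

definition embeds_as_subcomplex ::
  "('p \<Rightarrow> 'q) \<Rightarrow> ('c, 'p) cube_complex \<Rightarrow> ('d, 'q) cube_complex \<Rightarrow> bool" where
  "embeds_as_subcomplex e Y R \<longleftrightarrow>
     (\<exists>S. is_subcomplex R S \<and> cc_isomorphism e Y (subcomplex_on R S))"

text \<open>The domain of a partial local isometry of \<open>Y\<close> is given by its set \<open>S\<close> of cells.\<close>

definition partial_local_isometry :: "('c, 'p) cube_complex \<Rightarrow> 'c set \<Rightarrow> ('p \<Rightarrow> 'p) \<Rightarrow> bool" where
  "partial_local_isometry Y S \<phi> \<longleftrightarrow>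
     is_subcomplex Y S \<and> local_isometry \<phi> (subcomplex_on Y S) Y \<and> locally_convex Y S \<and>
     (\<exists>T. is_subcomplex Y T \<and> points (subcomplex_on Y T) = \<phi> ` points (subcomplex_on Y S) \<and>
        locally_convex Y T)"

definition injective_connected_partial_isometries ::
  "('c, 'p) cube_complex \<Rightarrow> ('c set \<times> ('p \<Rightarrow> 'p)) set" where
  "injective_connected_partial_isometries Y =
     {(S, \<phi>). partial_local_isometry Y S \<phi> \<and> inj_on \<phi> (points (subcomplex_on Y S)) \<and>
        connected_space (cc_topology (subcomplex_on Y S))}"

end

theory Submission
  imports Defs
begin

text \<open>
  An injective partial local isometry \<open>\<phi>\<close> of \<open>Y\<close> is a partial map \<open>j\<close> between points of \<open>Y\<close> that is
  an isometry on closed cubes and has a locally convex domain. There are only finitely many such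
  partial isometries, and they are closed under composition. The complex \<open>R\<close> is glued from
  finitely many copies of \<open>Y\<close>, or of parts of \<open>Y\<close>, which are permuted by a bijection \<open>T\<close> for each \<open>j\<close>.
  A point \<open>p\<close> of the base copy is identified with the point \<open>j p\<close> of the copy to which \<open>T\<close> moves the
  base copy. The automorphism induced by the inverse of \<open>T\<close> takes the latter point to the point \<open>j p\<close>
  of the base copy, so it extends \<open>j\<close>. What has to be achieved, with finitely many copies only, is
  that no two points of one copy are identified and that the links of \<open>R\<close> are simplicial and flag.
  This takes three stages.

  Separation. Let the labels be the partial isometries of \<open>Y\<close>, each repeated a suitable number of
  times. The multiplicities can be chosen such that each invertible \<open>j\<close> extends to a permutation \<open>\<gamma>\<close>
  of the labels: the label \<open>\<gamma> \<theta>\<close> has at \<open>j p\<close> the value of \<open>\<theta>\<close> at \<open>p\<close> (\<open>permutation_extension\<close>).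
  Take one copy for each permutation \<open>g\<close> of the labels and glue the point \<open>p\<close> of the copy \<open>g\<close> to the
  point \<open>j p\<close> of the copy \<open>\<gamma> \<circ> g\<close>. The values at \<open>p\<close> of all labels \<open>g \<theta>\<close> are invariant under this
  gluing, and the identity of \<open>Y\<close> is a label, so no two points of one copy are identified
  (\<open>glue_unique\<close>). Right multiplication by \<open>\<gamma>\<close> permutes the copies.

  Exactness. Two copies may share all edges at a corner of a cube without sharing the cube. This is
  repaired by passing to a finite covering of the graph whose edges are the pairs of a copy \<open>r\<close> and
  a partial isometry \<open>j\<close>: a copy is now a pair of a permutation \<open>g\<close> and a set \<open>A\<close> of edges whose
  boundary modulo two consists of the identity and \<open>g\<close>. Copies share a point only if their edge
  sets differ by edges marked at this point. The points at which a given edge is marked form a locally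
  convex set; hence if two copies share all edges at a corner, then the edges in which they differ are marked on the whole
  cube, and counting boundary points modulo two shows that the two ends of such a set of edges are
  linked by gluings of every point of the cube (\<open>exact_glue_exact\<close>).

  Flagness. In an exact system, edges at a vertex of \<open>R\<close> that pairwise span squares may do so in
  different copies. Decorate each copy \<open>v\<close> by arbitrary sets \<open>A\<close> of edges and let \<open>(A, v)\<close> and
  \<open>(A', v')\<close> share a point only if \<open>A\<close> and \<open>A'\<close> differ by edges crossing this point. Given pairwise
  compatible edges in the copies \<open>(A\<^sub>i, v\<^sub>i)\<close>, there is one set \<open>B\<close> that agrees with each \<open>A\<^sub>i\<close> near the
  \<open>i\<close>-th edge. A copy to be decorated by \<open>B\<close> has to contain all the given edges. To ensure that
  there is one, a point is kept in \<open>(A, v)\<close> only if it also lies in all copies from the set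
  \<open>anchor A\<close>, the boundary of \<open>A\<close> with the base copy added modulo two. This set is odd, hence nonempty;
  every element of \<open>anchor B\<close> contains all the given edges, by exactness it contains the squares too,
  and there flagness of \<open>Y\<close> yields the cube (\<open>same_flag\<close>).

  Both nonpositive curvature and local convexity are expressed through the set \<open>corner_edges\<close> of
  points, one on each edge at a corner, since the passage between copies is given by maps of points.
\<close>

section \<open>Isometries between cubes and faces\<close>

text \<open>Signed permutations of coordinates: the coordinate \<open>i\<close> goes to the coordinate \<open>\<pi> i\<close> with sign \<open>\<epsilon> i\<close>,
  and the remaining coordinates are the constants \<open>s\<close>. Nothing is required outside the cube, so that
  isometries of the closed cube onto a face are exactly the maps of this form.\<close>

definition face_map :: "nat \<Rightarrow> nat \<Rightarrow> ((nat \<Rightarrow> real) \<Rightarrow> nat \<Rightarrow> real) \<Rightarrow> bool" where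
  "face_map m n g \<longleftrightarrow> (\<exists>\<pi> \<epsilon> s. inj_on \<pi> {..<m} \<and> \<pi> ` {..<m} \<subseteq> {..<n} \<and>
     (\<forall>i<m. \<epsilon> i \<in> {-1, 1::real}) \<and> (\<forall>j<n. j \<notin> \<pi> ` {..<m} \<longrightarrow> s j \<in> {-1, 1}) \<and>
     (\<forall>u\<in>cube m. g u \<in> cube n \<and> (\<forall>i<m. g u (\<pi> i) = \<epsilon> i * u i) \<and>
        (\<forall>j<n. j \<notin> \<pi> ` {..<m} \<longrightarrow> g u j = s j)))"

lemma face_mapE:
  assumes "face_map m n g"
  obtains \<pi> \<epsilon> s where "inj_on \<pi> {..<m}" "\<pi> ` {..<m} \<subseteq> {..<n}" "\<And>i. i < m \<Longrightarrow> \<epsilon> i \<in> {-1, 1::real}"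
    "\<And>j. j < n \<Longrightarrow> j \<notin> \<pi> ` {..<m} \<Longrightarrow> s j \<in> {-1, 1}" "\<And>u. u \<in> cube m \<Longrightarrow> g u \<in> cube n"
    "\<And>u i. u \<in> cube m \<Longrightarrow> i < m \<Longrightarrow> g u (\<pi> i) = \<epsilon> i * u i"
    "\<And>u j. u \<in> cube m \<Longrightarrow> j < n \<Longrightarrow> j \<notin> \<pi> ` {..<m} \<Longrightarrow> g u j = s j"
proof -
  from assms obtain \<pi> \<epsilon> s where *: "inj_on \<pi> {..<m}" "\<pi> ` {..<m} \<subseteq> {..<n}"
     "\<forall>i<m. \<epsilon> i \<in> {-1, 1::real}" "\<forall>j<n. j \<notin> \<pi> ` {..<m} \<longrightarrow> s j \<in> {-1, 1}"
     "\<forall>u\<in>cube m. g u \<in> cube n \<and> (\<forall>i<m. g u (\<pi> i) = \<epsilon> i * u i) \<and>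
        (\<forall>j<n. j \<notin> \<pi> ` {..<m} \<longrightarrow> g u j = s j)"
    unfolding face_map_def by (elim exE conjE)
  show ?thesis by (rule that[of \<pi> \<epsilon> s]) (use * in blast)+
qed

lemma cube_iff: "u \<in> cube n \<longleftrightarrow> (\<forall>i<n. \<bar>u i\<bar> \<le> 1) \<and> (\<forall>i\<ge>n. u i = undefined)"
  unfolding cube_def PiE_iff by (auto simp: abs_le_iff extensional_def not_less)

lemma open_cube_iff: "u \<in> open_cube n \<longleftrightarrow> (\<forall>i<n. \<bar>u i\<bar> < 1) \<and> (\<forall>i\<ge>n. u i = undefined)"
  unfolding open_cube_def PiE_iff by (auto simp: abs_less_iff extensional_def not_less)

lemma cube_vertices_iff:
  "u \<in> cube_vertices n \<longleftrightarrow> (\<forall>i<n. u i = -1 \<or> u i = 1) \<and> (\<forall>i\<ge>n. u i = undefined)"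
  unfolding cube_vertices_def PiE_iff by (auto simp: extensional_def not_less)

lemma open_cube_sub: "u \<in> open_cube n \<Longrightarrow> u \<in> cube n"
  by (auto simp: cube_iff open_cube_iff less_imp_le)

lemma vertex_in_cube: "u \<in> cube_vertices n \<Longrightarrow> u \<in> cube n"
  by (force simp: cube_iff cube_vertices_iff)

lemma cube_eqI: "u \<in> cube n \<Longrightarrow> v \<in> cube n \<Longrightarrow> (\<And>i. i < n \<Longrightarrow> u i = v i) \<Longrightarrow> u = v"
  unfolding cube_iff by (metis ext not_less)

lemma cube_dist_eq_iff:
  "cube_dist n u v = cube_dist m u' v' \<longleftrightarrow> (\<Sum>i<n. (u i - v i)^2) = (\<Sum>i<m. (u' i - v' i)^2)"
  unfolding cube_dist_def L2_set_def by (simp add: real_sqrt_eq_iff)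

text \<open>Comparing the largest distance in the cube and in the face shows that the dimensions agree, and
  that antipodal vertices go to antipodal vertices. Polarization with a vertex and its antipode then
  shows that inner products with vertices are preserved. Flipping one coordinate of the vertex with
  all coordinates \<open>1\<close> flips exactly one coordinate of its image, which identifies the coordinate
  permutation.\<close>

lemma isometry_imp_face_map:
  assumes F: "F \<in> cube_faces n" and iso: "cube_isometry m (cube m) n F g"
  shows "face_map m n g"
proof -
  obtain J s where J: "J \<subseteq> {..<n}" and s: "s \<in> J \<rightarrow> {-1, 1}" and Fd: "F = {v \<in> cube n. \<forall>i\<in>J. v i = s i}"
    using F unfolding cube_faces_def by blast
  define N where "N = {..<n} - J"
  have finN: "finite N" unfolding N_def by simp
  have bij: "bij_betw g (cube m) F" using iso unfolding cube_isometry_def by blast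
  have gF: "g u \<in> F" if "u \<in> cube m" for u using bij that by (auto simp: bij_betw_def)
  have gc: "g u \<in> cube n" if "u \<in> cube m" for u using gF[OF that] Fd by blast
  have gJ: "g u j = s j" if "u \<in> cube m" "j \<in> J" for u j using gF[OF that(1)] Fd that(2) by blast
  have red: "(\<Sum>i<n. (v i - w i)^2) = (\<Sum>i\<in>N. (v i - w i)^2)" if "v \<in> F" "w \<in> F" for v w :: "nat \<Rightarrow> real"
  proof -
    have "(\<Sum>i<n. (v i - w i)^2) = (\<Sum>i\<in>N. (v i - w i)^2) + (\<Sum>i\<in>J. (v i - w i)^2)"
      unfolding N_def by (rule sum.subset_diff[OF J]) simp
    moreover have "(\<Sum>i\<in>J. (v i - w i)^2) = 0"
      using that Fd by (intro sum.neutral) auto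
    ultimately show ?thesis by simp
  qed
  have dist: "(\<Sum>i\<in>N. (g u i - g v i)^2) = (\<Sum>i<m. (u i - v i)^2)" if "u \<in> cube m" "v \<in> cube m" for u v
    using iso that red[OF gF gF, OF that] unfolding cube_isometry_def cube_dist_eq_iff by fastforce
  have le4: "(a - b)^2 \<le> 4" if "\<bar>a\<bar> \<le> 1" "\<bar>b\<bar> \<le> 1" for a b :: real
    using that abs_le_square_iff[of "a - b" 2] by auto
  have bound: "(\<Sum>i\<in>N. (v i - w i)^2) \<le> 4 * card N" if "v \<in> cube n" "w \<in> cube n" for v w :: "nat \<Rightarrow> real"
  proof -
    have "(\<Sum>i\<in>N. (v i - w i)^2) \<le> (\<Sum>i\<in>N. 4)"
      by (intro sum_mono le4) (use that in \<open>auto simp: cube_iff N_def\<close>)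
    then show ?thesis by simp
  qed
  define neg where "neg u = (\<lambda>i. if i < m then - u i else undefined)" for u :: "nat \<Rightarrow> real"
  have neg_cube: "neg u \<in> cube m" if "u \<in> cube m" for u
    using that by (auto simp: neg_def cube_iff)
  have vsq: "(u i - neg u i)^2 = 4" if "u \<in> cube_vertices m" "i < m" for u i
  proof -
    have "u i = -1 \<or> u i = 1" using that by (auto simp: cube_vertices_iff)
    then show ?thesis using that(2) by (auto simp: neg_def power2_eq_square)
  qed
  define one where "one = (\<lambda>i. if i < m then 1 else undefined :: real)"
  have one: "one \<in> cube_vertices m" by (auto simp: one_def cube_vertices_iff)
  \<comment> \<open>Antipodal vertices have the largest possible distance, and so do their images.\<close>
  have antip: "(\<Sum>i\<in>N. (g u i - g (neg u) i)^2) = 4 * real m" if "u \<in> cube_vertices m" for u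
  proof -
    have "(\<Sum>i<m. (u i - neg u i)^2) = (\<Sum>i<m. 4)" using that by (intro sum.cong) (auto simp: vsq)
    then show ?thesis using dist[of u "neg u"] vertex_in_cube[OF that] neg_cube[OF vertex_in_cube[OF that]] by simp
  qed
  have "4 * real m \<le> 4 * card N"
    using antip[OF one] bound[OF gc gc, of one "neg one"] vertex_in_cube[OF one] neg_cube by auto
  moreover have "4 * real (card N) \<le> 4 * m"
  proof -
    define v where "v = (\<lambda>i. if i \<in> J then s i else if i < n then 1 else undefined :: real)"
    define w where "w = (\<lambda>i. if i \<in> J then s i else if i < n then -1 else undefined :: real)"
    have "\<bar>s i\<bar> \<le> 1" if "i \<in> J" for i using Pi_mem[OF s that] by auto
    moreover have "i < n" if "i \<in> J" for i using that J by auto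
    ultimately have "v \<in> F" "w \<in> F" unfolding Fd v_def w_def by (fastforce simp: cube_iff)+
    then obtain v' w' where v': "v' \<in> cube m" "g v' = v" and w': "w' \<in> cube m" "g w' = w"
      using bij unfolding bij_betw_def by blast
    have "(\<Sum>i\<in>N. (v i - w i)^2) = (\<Sum>i\<in>N. 4)"
      by (intro sum.cong) (auto simp: v_def w_def N_def)
    then have "4 * real (card N) = (\<Sum>i<m. (v' i - w' i)^2)" using dist[OF v'(1) w'(1)] v' w' by simp
    also have "\<dots> \<le> (\<Sum>i<m. 4)" by (intro sum_mono le4) (use v' w' in \<open>auto simp: cube_iff\<close>)
    finally show ?thesis by simp
  qed
  ultimately have m: "m = card N" by simp
  have gv: "g (neg u) i = - g u i \<and> (g u i = 1 \<or> g u i = -1)" if u: "u \<in> cube_vertices m" and i: "i \<in> N" for u i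
  proof -
    have uc: "u \<in> cube m" "neg u \<in> cube m" using u vertex_in_cube neg_cube by auto
    have nonneg: "0 \<le> 4 - (g u j - g (neg u) j)^2" if "j \<in> N" for j
      using le4[of "g u j" "g (neg u) j"] gc[OF uc(1)] gc[OF uc(2)] that by (auto simp: cube_iff N_def)
    have "(\<Sum>j\<in>N. 4 - (g u j - g (neg u) j)^2) = 0"
      using antip[OF u] m by (simp add: sum_subtractf)
    then have "4 - (g u i - g (neg u) i)^2 = 0"
      using sum_nonneg_eq_0_iff[OF finN, of "\<lambda>j. 4 - (g u j - g (neg u) j)^2"] nonneg i by auto
    then have "(g u i - g (neg u) i)^2 = 2^2" by simp
    then have "g u i - g (neg u) i = 2 \<or> g u i - g (neg u) i = -2" by (simp only: power2_eq_iff)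
    moreover have "\<bar>g u i\<bar> \<le> 1" "\<bar>g (neg u) i\<bar> \<le> 1" using gc[OF uc(1)] gc[OF uc(2)] i by (auto simp: cube_iff N_def)
    ultimately show ?thesis by auto
  qed
  have ip: "(\<Sum>i\<in>N. g p i * g u i) = (\<Sum>i<m. p i * u i)" if p: "p \<in> cube m" and u: "u \<in> cube_vertices m" for p u
  proof -
    have uc: "u \<in> cube m" "neg u \<in> cube m" using u vertex_in_cube neg_cube by auto
    have "(\<Sum>i\<in>N. (g p i - g (neg u) i)^2) - (\<Sum>i\<in>N. (g p i - g u i)^2) = (\<Sum>i\<in>N. 4 * (g p i * g u i))"
      unfolding sum_subtractf[symmetric]
      by (intro sum.cong refl) (simp add: gv[OF u] power2_eq_square algebra_simps)
    moreover have "(\<Sum>i<m. (p i - neg u i)^2) - (\<Sum>i<m. (p i - u i)^2) = (\<Sum>i<m. 4 * (p i * u i))"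
      unfolding sum_subtractf[symmetric]
      by (intro sum.cong refl) (simp add: neg_def power2_eq_square algebra_simps)
    ultimately show ?thesis using dist[OF p uc(1)] dist[OF p uc(2)] by (simp add: sum_distrib_left[symmetric])
  qed
  \<comment> \<open>The image of the edge in direction \<open>k\<close> at the vertex \<open>one\<close> has some direction \<open>\<pi> k\<close>.\<close>
  define flip where "flip k = one(k := -1)" for k
  have flip: "flip k \<in> cube_vertices m" if "k < m" for k
    using that by (auto simp: flip_def one_def cube_vertices_iff)
  have ex1: "\<exists>j\<in>N. (\<forall>i\<in>N. i \<noteq> j \<longrightarrow> g one i = g (flip k) i) \<and> g one j = - g (flip k) j" if k: "k < m" for k
  proof -
    have uc: "one \<in> cube m" "flip k \<in> cube m" using one flip[OF k] vertex_in_cube by auto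
    have "(\<Sum>i<m. (one i - flip k i)^2) = (\<Sum>i<m. if i = k then 4 else 0)"
      by (intro sum.cong) (auto simp: one_def flip_def)
    then have four: "(\<Sum>i\<in>N. (g one i - g (flip k) i)^2) = 4" using dist[OF uc] k by simp
    have each: "(g one i - g (flip k) i)^2 = (if g one i = g (flip k) i then 0 else 4) \<and>
         (g one i \<noteq> g (flip k) i \<longrightarrow> g one i = - g (flip k) i)" if "i \<in> N" for i
      using gv[OF one that] gv[OF flip[OF k] that] by auto
    let ?D = "{i\<in>N. g one i \<noteq> g (flip k) i}"
    have "(\<Sum>i\<in>N. (g one i - g (flip k) i)^2) = (\<Sum>i\<in>N. if g one i \<noteq> g (flip k) i then 4 else 0)"
      by (intro sum.cong refl) (use each in auto)
    also have "\<dots> = (\<Sum>i\<in>?D. 4)" by (rule sum.inter_filter[symmetric, OF finN])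
    finally have "card ?D = 1" using four by simp
    then obtain j where "?D = {j}" by (auto simp: card_1_singleton_iff)
    then show ?thesis using each by blast
  qed
  then obtain \<pi> where \<pi>N: "\<And>k. k < m \<Longrightarrow> \<pi> k \<in> N"
    and \<pi>1: "\<And>k i. k < m \<Longrightarrow> i \<in> N \<Longrightarrow> i \<noteq> \<pi> k \<Longrightarrow> g one i = g (flip k) i"
    and \<pi>2: "\<And>k. k < m \<Longrightarrow> g one (\<pi> k) = - g (flip k) (\<pi> k)"
    by metis
  have main: "g p (\<pi> k) = g one (\<pi> k) * p k" if p: "p \<in> cube m" and k: "k < m" for p k
  proof -
    have "(\<Sum>i\<in>N. g p i * g one i) - (\<Sum>i\<in>N. g p i * g (flip k) i) = (\<Sum>i\<in>N. if i = \<pi> k then 2 * (g p i * g one i) else 0)"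
      unfolding sum_subtractf[symmetric]
    proof (intro sum.cong refl)
      fix i assume "i \<in> N"
      then show "g p i * g one i - g p i * g (flip k) i = (if i = \<pi> k then 2 * (g p i * g one i) else 0)"
        using \<pi>1[OF k, of i] \<pi>2[OF k] by auto
    qed
    also have "\<dots> = 2 * (g p (\<pi> k) * g one (\<pi> k))" using finN \<pi>N[OF k] by simp
    finally have "2 * (g p (\<pi> k) * g one (\<pi> k)) = (\<Sum>i<m. p i * one i) - (\<Sum>i<m. p i * flip k i)"
      using ip[OF p one] ip[OF p flip[OF k]] by simp
    also have "\<dots> = (\<Sum>i<m. if i = k then 2 * p i else 0)"
      unfolding sum_subtractf[symmetric] by (intro sum.cong) (auto simp: one_def flip_def)
    also have "\<dots> = 2 * p k" using k by simp
    finally have *: "g p (\<pi> k) * g one (\<pi> k) = p k" by simp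
    show ?thesis using gv[OF one \<pi>N[OF k]] * by auto
  qed
  have inj: "inj_on \<pi> {..<m}"
  proof (rule inj_onI)
    fix i j assume ij: "i \<in> {..<m}" "j \<in> {..<m}" "\<pi> i = \<pi> j"
    define p where "p = (\<lambda>l. if l < m then (if l = i then 1 else 0) else undefined :: real)"
    have p: "p \<in> cube m" by (auto simp: p_def cube_iff)
    have "g one (\<pi> i) * p i = g one (\<pi> i) * p j" 
      using main[OF p, of i] main[OF p, of j] ij by (metis lessThan_iff)
    moreover have "g one (\<pi> i) \<noteq> 0" using gv[OF one \<pi>N[of i]] ij by auto
    ultimately have "p i = p j" using ij(3) by simp
    then show "i = j" using ij by (auto simp: p_def split: if_splits)
  qed
  have "\<pi> ` {..<m} \<subseteq> N" using \<pi>N by auto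
  moreover have "card (\<pi> ` {..<m}) = card N" using inj m by (simp add: card_image)
  ultimately have surj: "\<pi> ` {..<m} = N" using finN by (simp add: card_subset_eq)
  show ?thesis
    unfolding face_map_def
  proof (intro exI conjI)
    show "inj_on \<pi> {..<m}" by fact
    show "\<pi> ` {..<m} \<subseteq> {..<n}" unfolding surj N_def by blast
    show "\<forall>i<m. g one (\<pi> i) \<in> {-1, 1}" using gv[OF one] \<pi>N by blast
    show "\<forall>j<n. j \<notin> \<pi> ` {..<m} \<longrightarrow> s j \<in> {-1, 1}"
      using Pi_mem[OF s] unfolding surj N_def by blast
    show "\<forall>u\<in>cube m. g u \<in> cube n \<and> (\<forall>i<m. g u (\<pi> i) = g one (\<pi> i) * u i) \<and>
        (\<forall>j<n. j \<notin> \<pi> ` {..<m} \<longrightarrow> g u j = s j)"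
    proof (intro ballI conjI allI impI)
      fix u j assume "u \<in> cube m" "j < n" "j \<notin> \<pi> ` {..<m}"
      then show "g u j = s j" using gJ[of u j] surj by (simp add: N_def)
    qed (simp_all add: gc main)
  qed
qed

lemma face_map_imp_isometry:
  assumes "face_map m n g"
  shows "g ` cube m \<in> cube_faces n" "cube_isometry m (cube m) n (g ` cube m) g"
proof -
  obtain \<pi> \<epsilon> s where inj: "inj_on \<pi> {..<m}" and \<pi>: "\<pi> ` {..<m} \<subseteq> {..<n}" and \<epsilon>: "\<And>i. i < m \<Longrightarrow> \<epsilon> i \<in> {-1, 1::real}"
    and s: "\<And>j. j < n \<Longrightarrow> j \<notin> \<pi> ` {..<m} \<Longrightarrow> s j \<in> {-1, 1}" and gc: "\<And>u. u \<in> cube m \<Longrightarrow> g u \<in> cube n"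
    and g1: "\<And>u i. u \<in> cube m \<Longrightarrow> i < m \<Longrightarrow> g u (\<pi> i) = \<epsilon> i * u i"
    and g2: "\<And>u j. u \<in> cube m \<Longrightarrow> j < n \<Longrightarrow> j \<notin> \<pi> ` {..<m} \<Longrightarrow> g u j = s j"
    by (rule face_mapE[OF assms]) blast
  define J where "J = {..<n} - \<pi> ` {..<m}"
  have im: "g ` cube m = {v \<in> cube n. \<forall>i\<in>J. v i = s i}"
  proof (intro equalityI subsetI)
    fix v assume "v \<in> g ` cube m" then show "v \<in> {v \<in> cube n. \<forall>i\<in>J. v i = s i}"
      using gc g2 by (auto simp: J_def)
  next
    fix v assume v: "v \<in> {v \<in> cube n. \<forall>i\<in>J. v i = s i}"
    define u where "u = (\<lambda>i. if i < m then \<epsilon> i * v (\<pi> i) else undefined)"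
    have u: "u \<in> cube m"
    proof -
      have "\<bar>\<epsilon> i * v (\<pi> i)\<bar> \<le> 1" if "i < m" for i
        using v \<epsilon>[OF that] \<pi> that by (auto simp: cube_iff abs_mult)
      then show ?thesis by (auto simp: u_def cube_iff)
    qed
    have "g u = v"
    proof (rule cube_eqI[OF gc[OF u]])
      show "v \<in> cube n" using v by simp
      fix j assume j: "j < n"
      show "g u j = v j"
      proof (cases "j \<in> \<pi> ` {..<m}")
        case True
        then obtain i where i: "i < m" "j = \<pi> i" by auto
        have "\<epsilon> i * \<epsilon> i = 1" using \<epsilon>[OF i(1)] by auto
        then show ?thesis using g1[OF u i(1)] i by (simp add: u_def mult.assoc[symmetric])
      next
        case False
        then show ?thesis using g2[OF u j False] v j by (auto simp: J_def)
      qed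
    qed
    then show "v \<in> g ` cube m" using u by blast
  qed
  show "g ` cube m \<in> cube_faces n"
    unfolding im cube_faces_def using s by (intro CollectI exI[of _ J] exI[of _ s]) (auto simp: J_def)
  have ds: "(\<Sum>i<n. (g u i - g v i)^2) = (\<Sum>i<m. (u i - v i)^2)" if u: "u \<in> cube m" and v: "v \<in> cube m" for u v
  proof -
    have "(\<Sum>i<n. (g u i - g v i)^2) = (\<Sum>i\<in>\<pi> ` {..<m}. (g u i - g v i)^2)"
      by (rule sum.mono_neutral_right) (use \<pi> g2 u v in auto)
    also have "\<dots> = (\<Sum>i<m. (g u (\<pi> i) - g v (\<pi> i))^2)" by (simp add: sum.reindex[OF inj])
    also have "\<dots> = (\<Sum>i<m. (u i - v i)^2)"
    proof (intro sum.cong refl)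
      fix i assume i: "i \<in> {..<m}"
      have "(g u (\<pi> i) - g v (\<pi> i)) = \<epsilon> i * (u i - v i)" using g1 u v i by (simp add: algebra_simps)
      then show "(g u (\<pi> i) - g v (\<pi> i))^2 = (u i - v i)^2" using \<epsilon>[of i] i by (auto simp: power_mult_distrib)
    qed
    finally show ?thesis .
  qed
  have "inj_on g (cube m)"
  proof (rule inj_onI)
    fix u v assume uv: "u \<in> cube m" "v \<in> cube m" "g u = g v"
    then have "(\<Sum>i<m. (u i - v i)^2) = 0" using ds[of u v] by simp
    then have "\<forall>i<m. u i = v i" by (simp add: sum_nonneg_eq_0_iff)
    then show "u = v" using uv cube_eqI by blast
  qed
  then show "cube_isometry m (cube m) n (g ` cube m) g"
    unfolding cube_isometry_def cube_dist_eq_iff using ds by (auto simp: bij_betw_def)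
qed

lemma face_map_iff: "(\<exists>F\<in>cube_faces n. cube_isometry m (cube m) n F g) \<longleftrightarrow> face_map m n g"
  using isometry_imp_face_map face_map_imp_isometry by blast

lemma cube_is_face: "cube n \<in> cube_faces n"
  unfolding cube_faces_def by (intro CollectI exI[of _ "{}"]) auto

lemma isometry_of_cubes_iff:
  "cube_isometry m (cube m) n (cube n) g \<longleftrightarrow> face_map m n g \<and> m = n"
proof
  assume L: "cube_isometry m (cube m) n (cube n) g"
  have fm: "face_map m n g" using isometry_imp_face_map[OF cube_is_face L] .
  obtain \<pi> \<epsilon> s where inj: "inj_on \<pi> {..<m}" and \<pi>: "\<pi> ` {..<m} \<subseteq> {..<n}"
    and g2: "\<And>u j. u \<in> cube m \<Longrightarrow> j < n \<Longrightarrow> j \<notin> \<pi> ` {..<m} \<Longrightarrow> g u j = s j"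
    and s: "\<And>j. j < n \<Longrightarrow> j \<notin> \<pi> ` {..<m} \<Longrightarrow> s j \<in> {-1, 1::real}"
    by (rule face_mapE[OF fm]) blast
  have "\<pi> ` {..<m} = {..<n}"
  proof (rule ccontr)
    assume "\<pi> ` {..<m} \<noteq> {..<n}"
    then obtain j where j: "j < n" "j \<notin> \<pi> ` {..<m}" using \<pi> by auto
    define z where "z = (\<lambda>i. if i < n then 0 else undefined :: real)"
    have "z \<in> cube n" by (auto simp: z_def cube_iff)
    moreover have "g ` cube m = cube n" using L unfolding cube_isometry_def bij_betw_def by blast
    ultimately obtain u where "u \<in> cube m" "g u = z" by (metis imageE)
    then have "z j = s j" using g2[of u j] j by simp
    then show False using s[OF j] j by (auto simp: z_def)
  qed
  then have "m = n" using inj by (metis card_image card_lessThan)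
  then show "face_map m n g \<and> m = n" using fm by simp
next
  assume R: "face_map m n g \<and> m = n"
  then have fm: "face_map n n g" by blast
  obtain \<pi> \<epsilon> s where inj: "inj_on \<pi> {..<n}" and \<pi>: "\<pi> ` {..<n} \<subseteq> {..<n}" and \<epsilon>: "\<And>i. i < n \<Longrightarrow> \<epsilon> i \<in> {-1, 1::real}"
    and gc: "\<And>u. u \<in> cube n \<Longrightarrow> g u \<in> cube n"
    and g1: "\<And>u i. u \<in> cube n \<Longrightarrow> i < n \<Longrightarrow> g u (\<pi> i) = \<epsilon> i * u i"
    by (rule face_mapE[OF fm]) blast
  have surj: "\<pi> ` {..<n} = {..<n}" using inj \<pi> by (simp add: endo_inj_surj)
  have "cube n \<subseteq> g ` cube n"
  proof
    fix v :: "nat \<Rightarrow> real" assume v: "v \<in> cube n"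
    define u where "u = (\<lambda>i. if i < n then \<epsilon> i * v (\<pi> i) else undefined)"
    have u: "u \<in> cube n"
    proof -
      have "\<bar>\<epsilon> i * v (\<pi> i)\<bar> \<le> 1" if "i < n" for i
        using v \<epsilon>[OF that] \<pi> that by (auto simp: cube_iff abs_mult)
      then show ?thesis by (auto simp: u_def cube_iff)
    qed
    have "g u = v"
    proof (rule cube_eqI[OF gc[OF u] v])
      fix j assume "j < n"
      then obtain i where i: "i < n" "j = \<pi> i" using surj by (metis imageE lessThan_iff)
      have "\<epsilon> i * \<epsilon> i = 1" using \<epsilon>[OF i(1)] by auto
      then show "g u j = v j" using g1[OF u i(1)] i by (simp add: u_def mult.assoc[symmetric])
    qed
    then show "v \<in> g ` cube n" using u by blast
  qed
  then have "g ` cube n = cube n" using gc by auto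
  then show "cube_isometry m (cube m) n (cube n) g" using face_map_imp_isometry(2)[OF fm] R by simp
qed

lemma cube_isometry_comp:
  "cube_isometry l A m B g \<Longrightarrow> cube_isometry m B n C h \<Longrightarrow> cube_isometry l A n C (h \<circ> g)"
  unfolding cube_isometry_def by (auto intro: bij_betw_trans dest: bij_betwE)

lemma cube_isometry_inv:
  assumes "cube_isometry m A n B g"
  shows "cube_isometry n B m A (inv_into A g)"
proof -
  have b: "bij_betw g A B" using assms unfolding cube_isometry_def by blast
  have *: "inv_into A g v \<in> A" "g (inv_into A g v) = v" if "v \<in> B" for v
    using b that by (metis bij_betw_def inv_into_into, metis bij_betw_inv_into_right)
  show ?thesis
    unfolding cube_isometry_def
  proof (intro conjI ballI)
    show "bij_betw (inv_into A g) B A" by (rule bij_betw_inv_into[OF b])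
    fix u v assume uv: "u \<in> B" "v \<in> B"
    have "cube_dist n (g (inv_into A g u)) (g (inv_into A g v)) = cube_dist m (inv_into A g u) (inv_into A g v)"
      using assms *(1)[OF uv(1)] *(1)[OF uv(2)] unfolding cube_isometry_def by blast
    then show "cube_dist m (inv_into A g u) (inv_into A g v) = cube_dist n u v"
      using *(2)[OF uv(1)] *(2)[OF uv(2)] by simp
  qed
qed

lemma face_map_cube: "face_map m n g \<Longrightarrow> u \<in> cube m \<Longrightarrow> g u \<in> cube n"
  unfolding face_map_def by blast

lemma face_map_inj: "face_map m n g \<Longrightarrow> inj_on g (cube m)"
  using face_map_imp_isometry(2) unfolding cube_isometry_def bij_betw_def by blast

lemma face_map_id: "face_map n n (\<lambda>u. u)"
  using isometry_of_cubes_iff[of n n "\<lambda>u. u"] unfolding cube_isometry_def by (auto simp: bij_betw_def)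

lemma face_map_image_self: "face_map n n g \<Longrightarrow> g ` cube n = cube n"
  using isometry_of_cubes_iff[of n n g] unfolding cube_isometry_def bij_betw_def by blast

text \<open>Two parametrizations of a face differ by a symmetry of the cube, so a face may be handled by any
  one of its parametrizations.\<close>

lemma face_map_same_image:
  assumes g: "face_map m n g" and g': "face_map m' n g'" and im: "g ` cube m = g' ` cube m'"
  shows "m' = m" "\<exists>h. face_map m m h \<and> (\<forall>u\<in>cube m. g' u = g (h u))"
proof -
  let ?h = "inv_into (cube m) g \<circ> g'"
  have "cube_isometry m' (cube m') m (cube m) ?h"
    using cube_isometry_comp face_map_imp_isometry(2)[OF g'] cube_isometry_inv[OF face_map_imp_isometry(2)[OF g]] im
    by metis
  then have h: "face_map m' m ?h" and m: "m' = m" by (auto simp: isometry_of_cubes_iff)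
  show "m' = m" by fact
  have "g' u = g (?h u)" if "u \<in> cube m" for u
    using im that m by (simp add: f_inv_into_f)
  then show "\<exists>h. face_map m m h \<and> (\<forall>u\<in>cube m. g' u = g (h u))" using h m by blast
qed

lemma face_map_inverse:
  assumes "face_map n n g"
  obtains h where "face_map n n h" "\<And>u. u \<in> cube n \<Longrightarrow> h (g u) = u" "\<And>u. u \<in> cube n \<Longrightarrow> g (h u) = u"
proof
  have iso: "cube_isometry n (cube n) n (cube n) g" using assms isometry_of_cubes_iff by blast
  show "face_map n n (inv_into (cube n) g)"
    using cube_isometry_inv[OF iso] isometry_of_cubes_iff by blast
  show "inv_into (cube n) g (g u) = u" if "u \<in> cube n" for u
    using face_map_inj[OF assms] that by (rule inv_into_f_f)
  show "g (inv_into (cube n) g u) = u" if "u \<in> cube n" for u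
    using face_map_image_self[OF assms] that by (simp add: f_inv_into_f)
qed

lemma face_map_comp:
  assumes g: "face_map l m g" and h: "face_map m n h"
  shows "face_map l n (\<lambda>u. h (g u))"
proof -
  obtain \<pi> \<epsilon> s where 1: "inj_on \<pi> {..<l}" "\<pi> ` {..<l} \<subseteq> {..<m}" "\<And>i. i < l \<Longrightarrow> \<epsilon> i \<in> {-1, 1::real}"
    "\<And>j. j < m \<Longrightarrow> j \<notin> \<pi> ` {..<l} \<Longrightarrow> s j \<in> {-1, 1}" "\<And>u. u \<in> cube l \<Longrightarrow> g u \<in> cube m"
    "\<And>u i. u \<in> cube l \<Longrightarrow> i < l \<Longrightarrow> g u (\<pi> i) = \<epsilon> i * u i"
    "\<And>u j. u \<in> cube l \<Longrightarrow> j < m \<Longrightarrow> j \<notin> \<pi> ` {..<l} \<Longrightarrow> g u j = s j"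
    by (rule face_mapE[OF g]) blast
  obtain \<pi>' \<epsilon>' s' where 2: "inj_on \<pi>' {..<m}" "\<pi>' ` {..<m} \<subseteq> {..<n}" "\<And>i. i < m \<Longrightarrow> \<epsilon>' i \<in> {-1, 1::real}"
    "\<And>j. j < n \<Longrightarrow> j \<notin> \<pi>' ` {..<m} \<Longrightarrow> s' j \<in> {-1, 1}" "\<And>u. u \<in> cube m \<Longrightarrow> h u \<in> cube n"
    "\<And>u i. u \<in> cube m \<Longrightarrow> i < m \<Longrightarrow> h u (\<pi>' i) = \<epsilon>' i * u i"
    "\<And>u j. u \<in> cube m \<Longrightarrow> j < n \<Longrightarrow> j \<notin> \<pi>' ` {..<m} \<Longrightarrow> h u j = s' j"
    by (rule face_mapE[OF h]) blast
  have \<pi>m: "\<pi> i < m" if "i < l" for i using 1(2) that by auto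
  define z where "z = (\<lambda>i. if i < l then 0 else undefined :: real)"
  have z: "z \<in> cube l" by (auto simp: z_def cube_iff)
  have const: "h (g u) j = h (g z) j \<and> h (g z) j \<in> {-1, 1}"
    if u: "u \<in> cube l" and j: "j < n" "j \<notin> (\<lambda>i. \<pi>' (\<pi> i)) ` {..<l}" for u j
  proof (cases "j \<in> \<pi>' ` {..<m}")
    case True
    then obtain k where k: "k < m" "j = \<pi>' k" by auto
    then have kn: "k \<notin> \<pi> ` {..<l}" using j by auto
    show ?thesis
      using 2(6)[OF 1(5)[OF u] k(1)] 2(6)[OF 1(5)[OF z] k(1)] 1(7)[OF u k(1) kn] 1(7)[OF z k(1) kn]
        1(4)[OF k(1) kn] 2(3)[OF k(1)] k by auto
  next
    case False
    show ?thesis using 2(7)[OF 1(5)[OF u] j(1) False] 2(7)[OF 1(5)[OF z] j(1) False] 2(4)[OF j(1) False] by simp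
  qed
  show ?thesis
    unfolding face_map_def
  proof (intro exI conjI)
    show "inj_on (\<lambda>i. \<pi>' (\<pi> i)) {..<l}"
      using comp_inj_on[OF 1(1), of \<pi>'] inj_on_subset[OF 2(1) 1(2)] by (simp add: o_def)
    show "(\<lambda>i. \<pi>' (\<pi> i)) ` {..<l} \<subseteq> {..<n}" using 2(2) \<pi>m by blast
    show "\<forall>i<l. \<epsilon>' (\<pi> i) * \<epsilon> i \<in> {-1, 1}" using 1(3) 2(3) \<pi>m by fastforce
    show "\<forall>j<n. j \<notin> (\<lambda>i. \<pi>' (\<pi> i)) ` {..<l} \<longrightarrow> h (g z) j \<in> {-1, 1}"
      using const[OF z] by blast
    show "\<forall>u\<in>cube l. h (g u) \<in> cube n \<and> (\<forall>i<l. h (g u) (\<pi>' (\<pi> i)) = \<epsilon>' (\<pi> i) * \<epsilon> i * u i) \<and>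
        (\<forall>j<n. j \<notin> (\<lambda>i. \<pi>' (\<pi> i)) ` {..<l} \<longrightarrow> h (g u) j = h (g z) j)"
    proof (intro ballI conjI allI impI)
      fix u i assume "u \<in> cube l" "i < l"
      then show "h (g u) (\<pi>' (\<pi> i)) = \<epsilon>' (\<pi> i) * \<epsilon> i * u i"
        using 2(6)[OF 1(5) \<pi>m] 1(6) by simp
    next
      fix u j assume "u \<in> cube l" "j < n" "j \<notin> (\<lambda>i. \<pi>' (\<pi> i)) ` {..<l}"
      then show "h (g u) j = h (g z) j" using const by blast
    qed (use 1(5) 2(5) in blast)
  qed
qed

definition bary :: "nat \<Rightarrow> nat \<Rightarrow> real" where
  "bary n = (\<lambda>i. if i < n then 0 else undefined)"

text \<open>The point half way between the centre and a vertex marks the corner at this vertex: as an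
  interior point it lies in one open cell only and has one preimage there.\<close>

definition half :: "nat \<Rightarrow> (nat \<Rightarrow> real) \<Rightarrow> nat \<Rightarrow> real" where
  "half n v = (\<lambda>i. if i < n then v i / 2 else undefined)"

lemma bary_open: "bary n \<in> open_cube n" by (auto simp: bary_def open_cube_iff)

lemma half_open: "v \<in> cube n \<Longrightarrow> half n v \<in> open_cube n"
  by (auto simp: half_def open_cube_iff cube_iff)

lemma half_vertex_inj:
  assumes "v \<in> cube n" "w \<in> cube n" "half n v = half n w" shows "v = w"
proof (rule cube_eqI[OF assms(1,2)])
  fix i assume "i < n" then show "v i = w i" using fun_cong[OF assms(3), of i] by (simp add: half_def)
qed

lemma self_face_map:
  assumes "face_map n n g"
  obtains \<pi> \<epsilon> where "inj_on \<pi> {..<n}" "\<pi> ` {..<n} = {..<n}" "\<And>i. i < n \<Longrightarrow> \<epsilon> i \<in> {-1, 1::real}"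
    "\<And>u i. u \<in> cube n \<Longrightarrow> i < n \<Longrightarrow> g u (\<pi> i) = \<epsilon> i * u i"
proof -
  obtain \<pi> \<epsilon> s where 1: "inj_on \<pi> {..<n}" "\<pi> ` {..<n} \<subseteq> {..<n}" "\<And>i. i < n \<Longrightarrow> \<epsilon> i \<in> {-1, 1::real}"
    "\<And>j. j < n \<Longrightarrow> j \<notin> \<pi> ` {..<n} \<Longrightarrow> s j \<in> {-1, 1}" "\<And>u. u \<in> cube n \<Longrightarrow> g u \<in> cube n"
    "\<And>u i. u \<in> cube n \<Longrightarrow> i < n \<Longrightarrow> g u (\<pi> i) = \<epsilon> i * u i"
    "\<And>u j. u \<in> cube n \<Longrightarrow> j < n \<Longrightarrow> j \<notin> \<pi> ` {..<n} \<Longrightarrow> g u j = s j"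
    by (rule face_mapE[OF assms]) blast
  have "\<pi> ` {..<n} = {..<n}" using 1(1,2) by (simp add: endo_inj_surj)
  then show ?thesis by (rule that[OF 1(1) _ 1(3) 1(6)])
qed

lemma face_map_self_eqI:
  assumes g: "face_map n n g" and u: "u \<in> cube n" and w: "w \<in> cube n"
    and eq: "\<And>\<pi> \<epsilon> i. i < n \<Longrightarrow> \<pi> i < n \<Longrightarrow> \<epsilon> i \<in> {-1, 1::real} \<Longrightarrow>
        (\<And>u. u \<in> cube n \<Longrightarrow> g u (\<pi> i) = \<epsilon> i * u i) \<Longrightarrow> w (\<pi> i) = \<epsilon> i * u i"
  shows "g u = w"
proof -
  obtain \<pi> \<epsilon> where 1: "inj_on \<pi> {..<n}" "\<pi> ` {..<n} = {..<n}" "\<And>i. i < n \<Longrightarrow> \<epsilon> i \<in> {-1, 1::real}"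
    "\<And>u i. u \<in> cube n \<Longrightarrow> i < n \<Longrightarrow> g u (\<pi> i) = \<epsilon> i * u i"
    by (rule self_face_map[OF g]) blast
  show ?thesis
  proof (rule cube_eqI[OF face_map_cube[OF g u] w])
    fix j assume "j < n"
    then obtain i where i: "i < n" "j = \<pi> i" using 1(2) by (metis imageE lessThan_iff)
    then show "g u j = w j" using 1(4)[OF u i(1)] eq[OF i(1), of \<pi> \<epsilon>] 1(3)[OF i(1)] 1(4) \<open>j < n\<close> by auto
  qed
qed

lemma face_map_self_bary: "face_map n n g \<Longrightarrow> g (bary n) = bary n"
  by (rule face_map_self_eqI[of n g]) (auto simp: bary_def cube_iff)

lemma face_map_self_half: "face_map n n g \<Longrightarrow> v \<in> cube n \<Longrightarrow> g (half n v) = half n (g v)"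
  by (rule face_map_self_eqI[of n g])
     (simp_all add: open_cube_sub[OF half_open] face_map_cube, simp add: half_def)

lemma face_map_self_open:
  assumes "face_map n n g" "u \<in> open_cube n" shows "g u \<in> open_cube n"
proof -
  obtain \<pi> \<epsilon> where 1: "inj_on \<pi> {..<n}" "\<pi> ` {..<n} = {..<n}" "\<And>i. i < n \<Longrightarrow> \<epsilon> i \<in> {-1, 1::real}"
    "\<And>u i. u \<in> cube n \<Longrightarrow> i < n \<Longrightarrow> g u (\<pi> i) = \<epsilon> i * u i"
    by (rule self_face_map[OF assms(1)]) blast
  have u: "u \<in> cube n" using assms open_cube_sub by blast
  have "\<bar>g u j\<bar> < 1" if j: "j < n" for j
  proof -
    obtain i where i: "i < n" "j = \<pi> i" using 1(2) j by (metis imageE lessThan_iff)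
    then show ?thesis using 1(4)[OF u i(1)] 1(3)[OF i(1)] assms(2) by (auto simp: open_cube_iff)
  qed
  moreover have "g u \<in> cube n" using face_map_cube[OF assms(1) u] .
  ultimately show ?thesis by (auto simp: open_cube_iff cube_iff)
qed

lemma face_map_vertex:
  assumes "face_map m n g" "v \<in> cube_vertices m" shows "g v \<in> cube_vertices n"
proof -
  obtain \<pi> \<epsilon> s where 1: "inj_on \<pi> {..<m}" "\<pi> ` {..<m} \<subseteq> {..<n}" "\<And>i. i < m \<Longrightarrow> \<epsilon> i \<in> {-1, 1::real}"
    "\<And>j. j < n \<Longrightarrow> j \<notin> \<pi> ` {..<m} \<Longrightarrow> s j \<in> {-1, 1}" "\<And>u. u \<in> cube m \<Longrightarrow> g u \<in> cube n"
    "\<And>u i. u \<in> cube m \<Longrightarrow> i < m \<Longrightarrow> g u (\<pi> i) = \<epsilon> i * u i"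
    "\<And>u j. u \<in> cube m \<Longrightarrow> j < n \<Longrightarrow> j \<notin> \<pi> ` {..<m} \<Longrightarrow> g u j = s j"
    by (rule face_mapE[OF assms(1)]) blast
  have v: "v \<in> cube m" using assms vertex_in_cube by blast
  have "g v j = -1 \<or> g v j = 1" if j: "j < n" for j
  proof (cases "j \<in> \<pi> ` {..<m}")
    case True
    then obtain i where i: "i < m" "j = \<pi> i" by auto
    then show ?thesis using 1(6)[OF v i(1)] 1(3)[OF i(1)] assms(2) by (auto simp: cube_vertices_iff)
  next
    case False then show ?thesis using 1(7)[OF v j] 1(4)[OF j] by auto
  qed
  then show ?thesis using 1(5)[OF v] by (auto simp: cube_vertices_iff cube_iff)
qed

text \<open>Fix the coordinates of absolute value \<open>1\<close>: in any parametrization of this face the point is interior.\<close>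

lemma carrier_face:
  assumes v: "v \<in> cube n"
  obtains F where "F \<in> cube_faces n"
    "\<And>m g. face_map m n g \<Longrightarrow> g ` cube m = F \<Longrightarrow> \<exists>u\<in>open_cube m. g u = v"
proof -
  define J where "J = {i. i < n \<and> \<bar>v i\<bar> = 1}"
  define F where "F = {w \<in> cube n. \<forall>i\<in>J. w i = v i}"
  have "F \<in> cube_faces n"
    unfolding cube_faces_def F_def
    by (intro CollectI exI[of _ J] exI[of _ v]) (auto simp: J_def abs_if split: if_splits)
  moreover have "\<exists>u\<in>open_cube m. g u = v" if g: "face_map m n g" and im: "g ` cube m = F" for m g
  proof -
    obtain \<pi> \<epsilon> s where 1: "inj_on \<pi> {..<m}" "\<pi> ` {..<m} \<subseteq> {..<n}" "\<And>i. i < m \<Longrightarrow> \<epsilon> i \<in> {-1, 1::real}"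
      "\<And>j. j < n \<Longrightarrow> j \<notin> \<pi> ` {..<m} \<Longrightarrow> s j \<in> {-1, 1}" "\<And>u. u \<in> cube m \<Longrightarrow> g u \<in> cube n"
      "\<And>u i. u \<in> cube m \<Longrightarrow> i < m \<Longrightarrow> g u (\<pi> i) = \<epsilon> i * u i"
      "\<And>u j. u \<in> cube m \<Longrightarrow> j < n \<Longrightarrow> j \<notin> \<pi> ` {..<m} \<Longrightarrow> g u j = s j"
      by (rule face_mapE[OF g]) blast
    have "v \<in> F" using v by (simp add: F_def)
    then obtain u where u: "u \<in> cube m" "g u = v" using im by blast
    have "\<bar>u i\<bar> < 1" if i: "i < m" for i
    proof (rule ccontr)
      assume "\<not> \<bar>u i\<bar> < 1"
      then have "\<bar>u i\<bar> = 1" using u i by (auto simp: cube_iff intro: antisym)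
      then have "\<bar>v (\<pi> i)\<bar> = 1" using 1(6)[OF u(1) i] 1(3)[OF i] u by (auto simp: abs_mult)
      then have J: "\<pi> i \<in> J" using 1(2) i by (auto simp: J_def)
      have z: "bary m \<in> cube m" using bary_open open_cube_sub by blast
      then have "g (bary m) \<in> F" using im by blast
      then have "g (bary m) (\<pi> i) = v (\<pi> i)" using J by (simp add: F_def)
      then show False using 1(6)[OF z i] i J by (auto simp: bary_def J_def)
    qed
    then have "u \<in> open_cube m" using u by (auto simp: open_cube_iff cube_iff)
    then show ?thesis using u by blast
  qed
  ultimately show ?thesis by (rule that)
qed

lemma face_map_edge:
  assumes v: "v \<in> cube_vertices n" and i: "i < n"
  shows "face_map 1 n (\<lambda>t. v(i := t 0))"
  unfolding face_map_def
proof (intro exI conjI)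
  show "inj_on (\<lambda>_. i) {..<1::nat}" by (simp add: lessThan_Suc)
  show "\<forall>k<1. (\<lambda>_. 1) k \<in> {-1, 1::real}" by simp
  have img: "(\<lambda>_. i) ` {..<1::nat} = {i}" by (simp add: lessThan_Suc)
  show "(\<lambda>_. i) ` {..<1::nat} \<subseteq> {..<n}" using i img by simp
  show "\<forall>j<n. j \<notin> (\<lambda>_. i) ` {..<1::nat} \<longrightarrow> v j \<in> {- 1, 1}"
    using v by (auto simp: cube_vertices_iff)
  show "\<forall>u\<in>cube 1. v(i := u 0) \<in> cube n \<and> (\<forall>k<1. (v(i := u 0)) i = 1 * u k) \<and>
      (\<forall>j<n. j \<notin> (\<lambda>_. i) ` {..<1::nat} \<longrightarrow> (v(i := u 0)) j = v j)"
    using i vertex_in_cube[OF v] unfolding img by (auto simp: cube_iff)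
qed

text \<open>A face that is an edge through the vertex \<open>v\<close> runs in a coordinate direction \<open>i\<close>; its half point is
  obtained from \<open>v\<close> by halving the coordinate \<open>i\<close>.\<close>

lemma face_map_dim1:
  assumes g: "face_map 1 n g" and u: "u \<in> cube_vertices 1" and v: "g u = v"
  obtains i where "i < n" "g (half 1 u) = v(i := v i / 2)"
proof -
  obtain \<pi> \<epsilon> s where 1: "inj_on \<pi> {..<1}" "\<pi> ` {..<1} \<subseteq> {..<n}" "\<And>i. i < 1 \<Longrightarrow> \<epsilon> i \<in> {-1, 1::real}"
    "\<And>j. j < n \<Longrightarrow> j \<notin> \<pi> ` {..<1} \<Longrightarrow> s j \<in> {-1, 1}" "\<And>u. u \<in> cube 1 \<Longrightarrow> g u \<in> cube n"
    "\<And>u i. u \<in> cube 1 \<Longrightarrow> i < 1 \<Longrightarrow> g u (\<pi> i) = \<epsilon> i * u i"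
    "\<And>u j. u \<in> cube 1 \<Longrightarrow> j < n \<Longrightarrow> j \<notin> \<pi> ` {..<1} \<Longrightarrow> g u j = s j"
    by (rule face_mapE[OF g]) blast
  have u1: "u \<in> cube 1" and h1: "half 1 u \<in> cube 1" using u vertex_in_cube half_open open_cube_sub by blast+
  have p: "\<pi> 0 < n" using 1(2) by auto
  have "g (half 1 u) = v(\<pi> 0 := v (\<pi> 0) / 2)"
  proof
    fix j
    show "g (half 1 u) j = (v(\<pi> 0 := v (\<pi> 0) / 2)) j"
    proof (cases "j < n")
      case False then show ?thesis using 1(5)[OF h1] 1(5)[OF u1] p v by (auto simp: cube_iff)
    next
      case True
      show ?thesis
      proof (cases "j = \<pi> 0")
        case True then show ?thesis using 1(6)[OF h1, of 0] 1(6)[OF u1, of 0] v by (simp add: half_def)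
      next
        case False
        then have "j \<notin> \<pi> ` {..<1}" by auto
        then show ?thesis using 1(7)[OF h1 \<open>j < n\<close>] 1(7)[OF u1 \<open>j < n\<close>] v False by simp
      qed
    qed
  qed
  then show ?thesis using that p by blast
qed

section \<open>Cells of cube complexes\<close>

lemma cube_complexI:
  assumes "\<And>c. c \<in> cells X \<Longrightarrow> inj_on (chart X c) (open_cube (cdim X c))"
    and "\<And>c d u w. c \<in> cells X \<Longrightarrow> d \<in> cells X \<Longrightarrow> u \<in> open_cube (cdim X c) \<Longrightarrow> w \<in> open_cube (cdim X d) \<Longrightarrow>
      chart X c u = chart X d w \<Longrightarrow> c = d"
    and "\<And>c F. c \<in> cells X \<Longrightarrow> F \<in> cube_faces (cdim X c) \<Longrightarrow> \<exists>d\<in>cells X. \<exists>g. face_map (cdim X d) (cdim X c) g \<and>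
      g ` cube (cdim X d) = F \<and> (\<forall>u\<in>cube (cdim X d). chart X c (g u) = chart X d u)"
  shows "cube_complex X"
  unfolding cube_complex_def
proof (intro conjI ballI impI)
  fix c d assume "c \<in> cells X" "d \<in> cells X" "c \<noteq> d"
  then show "open_cell X c \<inter> open_cell X d = {}"
    using assms(2)[of c d] unfolding open_cell_def by force
next
  fix c F assume cF: "c \<in> cells X" "F \<in> cube_faces (cdim X c)"
  obtain d g where "d \<in> cells X" "face_map (cdim X d) (cdim X c) g" "g ` cube (cdim X d) = F"
    "\<forall>u\<in>cube (cdim X d). chart X c (g u) = chart X d u"
    using assms(3)[OF cF] by blast
  then show "\<exists>d\<in>cells X. \<exists>g. cube_isometry (cdim X d) (cube (cdim X d)) (cdim X c) F g \<and>
          (\<forall>u\<in>cube (cdim X d). chart X c (g u) = chart X d u)"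
    using face_map_imp_isometry(2) by blast
qed (rule assms(1))

lemma open_inj:
  assumes "cube_complex X" "c \<in> cells X" "d \<in> cells X" "u \<in> open_cube (cdim X c)" "w \<in> open_cube (cdim X d)"
    "chart X c u = chart X d w"
  shows "c = d" "u = w"
proof -
  show c: "c = d"
  proof (rule ccontr)
    assume "c \<noteq> d"
    then have "open_cell X c \<inter> open_cell X d = {}" using assms(1,2,3) unfolding cube_complex_def by blast
    moreover have "chart X c u \<in> open_cell X c" "chart X d w \<in> open_cell X d"
      using assms(4,5) unfolding open_cell_def by auto
    ultimately show False using assms(6) by auto
  qed
  show "u = w" using assms c unfolding cube_complex_def by (auto dest: inj_onD)
qed

lemma bary_inj:
  "cube_complex X \<Longrightarrow> c \<in> cells X \<Longrightarrow> d \<in> cells X \<Longrightarrow> u \<in> open_cube (cdim X d) \<Longrightarrow>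
    chart X c (bary (cdim X c)) = chart X d u \<Longrightarrow> c = d"
  using open_inj(1) bary_open by metis

lemma face_cell:
  assumes "cube_complex X" "c \<in> cells X" "F \<in> cube_faces (cdim X c)"
  obtains d g where "d \<in> cells X" "face_map (cdim X d) (cdim X c) g" "g ` cube (cdim X d) = F"
    "\<And>u. u \<in> cube (cdim X d) \<Longrightarrow> chart X c (g u) = chart X d u"
proof -
  have "\<exists>d\<in>cells X. \<exists>g. cube_isometry (cdim X d) (cube (cdim X d)) (cdim X c) F g \<and>
          (\<forall>u\<in>cube (cdim X d). chart X c (g u) = chart X d u)"
    using assms unfolding cube_complex_def by blast
  then obtain d g where *: "d \<in> cells X" "cube_isometry (cdim X d) (cube (cdim X d)) (cdim X c) F g"
      "\<forall>u\<in>cube (cdim X d). chart X c (g u) = chart X d u" by blast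
  have "g ` cube (cdim X d) = F" using *(2) unfolding cube_isometry_def bij_betw_def by blast
  then show ?thesis using that isometry_imp_face_map[OF assms(3) *(2)] * by blast
qed

lemma carrier_cell:
  assumes X: "cube_complex X" "c \<in> cells X" and v: "v \<in> cube (cdim X c)"
  obtains d g u where "d \<in> cells X" "face_map (cdim X d) (cdim X c) g"
    "\<And>u. u \<in> cube (cdim X d) \<Longrightarrow> chart X c (g u) = chart X d u" "u \<in> open_cube (cdim X d)" "g u = v"
proof -
  obtain F where F: "F \<in> cube_faces (cdim X c)"
    "\<And>m g. face_map m (cdim X c) g \<Longrightarrow> g ` cube m = F \<Longrightarrow> \<exists>u\<in>open_cube m. g u = v"
    by (rule carrier_face[OF v]) blast
  obtain d g where d: "d \<in> cells X" "face_map (cdim X d) (cdim X c) g" "g ` cube (cdim X d) = F"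
    "\<And>u. u \<in> cube (cdim X d) \<Longrightarrow> chart X c (g u) = chart X d u"
    by (rule face_cell[OF X F(1)]) blast
  obtain u where "u \<in> open_cube (cdim X d)" "g u = v" using F(2)[OF d(2,3)] by blast
  then show ?thesis using that d by blast
qed

lemma points_open:
  assumes "cube_complex X" "p \<in> points X"
  obtains c u where "c \<in> cells X" "u \<in> open_cube (cdim X c)" "p = chart X c u"
proof -
  obtain c v where c: "c \<in> cells X" "v \<in> cube (cdim X c)" "p = chart X c v"
    using assms(2) unfolding points_def by blast
  obtain d g u where "d \<in> cells X" "u \<in> open_cube (cdim X d)" "chart X c (g u) = chart X d u" "g u = v"
    by (rule carrier_cell[OF assms(1) c(1,2)]) (use open_cube_sub in blast)
  then show ?thesis using that c by blast
qed

lemma chart_points: "c \<in> cells X \<Longrightarrow> u \<in> cube (cdim X c) \<Longrightarrow> chart X c u \<in> points X"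
  unfolding points_def by blast

text \<open>The face \<open>g ` cube m\<close> is some cell \<open>d\<close>, by a parametrization that differs from \<open>g\<close> by a symmetry \<open>h\<close>.\<close>

lemma face_cell_of_map:
  assumes X: "cube_complex X" "c \<in> cells X" and g: "face_map m (cdim X c) g"
  obtains d h where "d \<in> cells X" "cdim X d = m" "face_map m m h"
    "\<And>u. u \<in> cube m \<Longrightarrow> chart X c (g u) = chart X d (h u)"
proof -
  obtain d g' where d: "d \<in> cells X" "face_map (cdim X d) (cdim X c) g'" "g' ` cube (cdim X d) = g ` cube m"
    "\<And>u. u \<in> cube (cdim X d) \<Longrightarrow> chart X c (g' u) = chart X d u"
    by (rule face_cell[OF X face_map_imp_isometry(1)[OF g]]) blast
  obtain h where h: "m = cdim X d" "face_map (cdim X d) (cdim X d) h" "\<forall>u\<in>cube (cdim X d). g u = g' (h u)"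
    using face_map_same_image[OF d(2) g d(3)] by blast
  have "chart X c (g u) = chart X d (h u)" if "u \<in> cube m" for u
    using h d(4)[OF face_map_cube[OF h(2)]] that by simp
  then show ?thesis using that d h by metis
qed

section \<open>Links in terms of points\<close>

definition half_point :: "('c, 'p) cube_complex \<Rightarrow> 'c \<times> (nat \<Rightarrow> real) \<Rightarrow> 'p" where
  "half_point X \<sigma> = chart X (fst \<sigma>) (half (cdim X (fst \<sigma>)) (snd \<sigma>))"

definition corners :: "('c, 'p) cube_complex \<Rightarrow> ('c \<times> (nat \<Rightarrow> real)) set" where
  "corners X = {(c, v). c \<in> cells X \<and> 1 \<le> cdim X c \<and> v \<in> cube_vertices (cdim X c)}"

text \<open>The half points of the edges at the corner \<open>\<sigma>\<close>, see \<open>half_points_simplex_vertices\<close>: they stand for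
  the vertices of the simplex \<open>\<sigma>\<close> of the link. In contrast to the corners they can be followed under
  maps of points.\<close>

definition corner_edges :: "('c, 'p) cube_complex \<Rightarrow> 'c \<times> (nat \<Rightarrow> real) \<Rightarrow> 'p set" where
  "corner_edges X \<sigma> = {chart X (fst \<sigma>) ((snd \<sigma>)(i := snd \<sigma> i / 2)) | i. i < cdim X (fst \<sigma>)}"

lemma edge_point_cube:
  "v \<in> cube_vertices n \<Longrightarrow> v(i := v i / 2) \<in> cube n"  if "i < n"
  using that vertex_in_cube[of v n] by (auto simp: cube_iff)

lemma link_corners: "\<sigma> \<in> link X x \<longleftrightarrow> \<sigma> \<in> corners X \<and> chart X (fst \<sigma>) (snd \<sigma>) = x"
  unfolding link_def corners_def by auto

lemma half_point_inj:
  assumes "cube_complex X" "\<sigma> \<in> corners X" "\<tau> \<in> corners X" "half_point X \<sigma> = half_point X \<tau>"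
  shows "\<sigma> = \<tau>"
proof -
  obtain c v d w where [simp]: "\<sigma> = (c, v)" "\<tau> = (d, w)" by fastforce
  have *: "c \<in> cells X" "d \<in> cells X" "v \<in> cube (cdim X c)" "w \<in> cube (cdim X d)"
    using assms(2,3) vertex_in_cube unfolding corners_def by auto
  have "c = d" "half (cdim X c) v = half (cdim X d) w"
    using open_inj[OF assms(1) *(1,2) half_open[OF *(3)] half_open[OF *(4)]] assms(4) unfolding half_point_def by auto
  then show ?thesis using * half_vertex_inj by auto
qed

lemma corner_face_iff:
  "corner_face X \<tau> \<sigma> \<longleftrightarrow> (\<exists>g. face_map (cdim X (fst \<tau>)) (cdim X (fst \<sigma>)) g \<and>
     (\<forall>u\<in>cube (cdim X (fst \<tau>)). chart X (fst \<sigma>) (g u) = chart X (fst \<tau>) u) \<and> g (snd \<tau>) = snd \<sigma>)"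
  unfolding corner_face_def face_map_iff[symmetric] by blast

text \<open>A one-dimensional corner that is a face of \<open>(c, v)\<close> is glued to an edge of the cube at \<open>v\<close>, and
  each of these edges is glued to some cell.\<close>

lemma half_points_simplex_vertices:
  assumes X: "cube_complex X" and \<sigma>: "\<sigma> \<in> link X x"
  shows "half_point X ` simplex_vertices X (link X x) \<sigma> = corner_edges X \<sigma>"
proof -
  obtain c v where [simp]: "\<sigma> = (c, v)" by fastforce
  have c: "c \<in> cells X" and v: "v \<in> cube_vertices (cdim X c)" and x: "chart X c v = x"
    using \<sigma> unfolding link_def by auto
  show ?thesis
  proof (intro equalityI subsetI)
    fix p assume "p \<in> half_point X ` simplex_vertices X (link X x) \<sigma>"
    then obtain d w g where d: "p = half_point X (d, w)" "d \<in> cells X" "cdim X d = 1" "w \<in> cube_vertices 1"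
      and g: "face_map 1 (cdim X c) g" "\<And>u. u \<in> cube 1 \<Longrightarrow> chart X c (g u) = chart X d u" "g w = v"
      unfolding simplex_vertices_def link_vertices_def corner_face_iff link_def by auto
    obtain i where i: "i < cdim X c" "g (half 1 w) = v(i := v i / 2)"
      by (rule face_map_dim1[OF g(1) d(4) g(3)])
    have "p = chart X d (half 1 w)" using d by (simp add: half_point_def)
    also have "\<dots> = chart X c (g (half 1 w))"
      using g(2)[OF open_cube_sub[OF half_open[OF vertex_in_cube[OF d(4)]]]] by simp
    finally have "p = chart X c (v(i := v i / 2))" using i by simp
    then show "p \<in> corner_edges X \<sigma>" using i unfolding corner_edges_def by auto
  next
    fix p assume "p \<in> corner_edges X \<sigma>"
    then obtain i where i: "i < cdim X c" "p = chart X c (v(i := v i / 2))" unfolding corner_edges_def by auto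
    let ?g = "\<lambda>t. v(i := t 0)"
    have fm: "face_map 1 (cdim X c) ?g" by (rule face_map_edge[OF v i(1)])
    obtain d h where d: "d \<in> cells X" "cdim X d = 1" "face_map 1 1 h"
      "\<And>u. u \<in> cube 1 \<Longrightarrow> chart X c (?g u) = chart X d (h u)"
      by (rule face_cell_of_map[OF X c fm]) blast
    obtain h' where h': "face_map 1 1 h'" "\<And>u. u \<in> cube 1 \<Longrightarrow> h' (h u) = u" "\<And>u. u \<in> cube 1 \<Longrightarrow> h (h' u) = u"
      by (rule face_map_inverse[OF d(3)]) blast
    define t where "t = (\<lambda>j::nat. if j < 1 then v i else undefined :: real)"
    have t: "t \<in> cube_vertices 1" using v i by (auto simp: t_def cube_vertices_iff)
    have t0: "?g t = v" by (auto simp: t_def)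
    have w: "h t \<in> cube_vertices 1" by (rule face_map_vertex[OF d(3) t])
    have tc: "t \<in> cube 1" and ht: "half 1 t \<in> cube 1" using t vertex_in_cube half_open open_cube_sub by blast+
    have "chart X d (h t) = x" using d(4)[OF tc] t0 x by simp
    then have in_link: "(d, h t) \<in> link X x" using d w unfolding link_def by auto
    have "corner_face X (d, h t) \<sigma>"
      unfolding corner_face_iff
    proof (intro exI conjI ballI)
      show "face_map (cdim X (fst (d, h t))) (cdim X (fst \<sigma>)) (\<lambda>u. ?g (h' u))"
        using face_map_comp[OF h'(1) fm] d(2) by simp
      show "chart X (fst \<sigma>) (?g (h' u)) = chart X (fst (d, h t)) u" if "u \<in> cube (cdim X (fst (d, h t)))" for u
        using d(4)[of "h' u"] h'(3)[of u] face_map_cube[OF h'(1), of u] d(2) that by simp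
      show "?g (h' (snd (d, h t))) = snd \<sigma>" using h'(2)[OF tc] t0 by simp
    qed
    then have "(d, h t) \<in> simplex_vertices X (link X x) \<sigma>"
      using in_link d(2) unfolding simplex_vertices_def link_vertices_def by auto
    moreover have "half_point X (d, h t) = p"
    proof -
      have "half_point X (d, h t) = chart X d (h (half 1 t))"
        using face_map_self_half[OF d(3) tc] d(2) by (simp add: half_point_def)
      also have "\<dots> = chart X c (?g (half 1 t))" using d(4)[OF ht] by simp
      also have "?g (half 1 t) = v(i := v i / 2)" by (auto simp: half_def t_def)
      finally show ?thesis using i by (simp add: fun_upd_def)
    qed
    ultimately show "p \<in> half_point X ` simplex_vertices X (link X x) \<sigma>" by force
  qed
qed

lemma corner_vertex_zero_cube:
  assumes X: "cube_complex X" and \<sigma>: "\<sigma> \<in> corners X"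
  shows "chart X (fst \<sigma>) (snd \<sigma>) \<in> zero_cubes X"
proof -
  obtain c v where [simp]: "\<sigma> = (c, v)" by fastforce
  have c: "c \<in> cells X" and v: "v \<in> cube_vertices (cdim X c)" using \<sigma> unfolding corners_def by auto
  have "face_map 0 (cdim X c) (\<lambda>_. v)"
    unfolding face_map_def
    by (intro exI[of _ id] exI[of _ v]) (use v vertex_in_cube[OF v] in \<open>auto simp: cube_vertices_iff\<close>)
  then obtain d h where d: "d \<in> cells X" "cdim X d = 0" "face_map 0 0 h"
    "\<And>u. u \<in> cube 0 \<Longrightarrow> chart X c v = chart X d (h u)"
    by (rule face_cell_of_map[OF X c]) blast
  have "bary 0 \<in> cube 0" using bary_open open_cube_sub by blast
  then have "chart X c v = chart X d (h (bary 0))" "h (bary 0) \<in> cube 0" using d face_map_cube by blast+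
  then show ?thesis using d unfolding zero_cubes_def by auto
qed

lemma half_point_inj_on_link: "cube_complex X \<Longrightarrow> inj_on (half_point X) (link X x)"
  by (meson half_point_inj inj_onI link_corners)

lemma simplex_vertices_sub: "simplex_vertices X L \<sigma> \<subseteq> link_vertices X L" "link_vertices X L \<subseteq> L"
  unfolding simplex_vertices_def link_vertices_def by auto

text \<open>The conditions that links are simplicial and flag, with half points in place of the vertices of
  links.\<close>

definition edge_simplicial :: "('c, 'p) cube_complex \<Rightarrow> bool" where
  "edge_simplicial X \<longleftrightarrow>
     (\<forall>\<sigma>\<in>corners X. card (corner_edges X \<sigma>) = cdim X (fst \<sigma>)) \<and>
     (\<forall>\<sigma>\<in>corners X. \<forall>\<tau>\<in>corners X. chart X (fst \<sigma>) (snd \<sigma>) = chart X (fst \<tau>) (snd \<tau>) \<and>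
        corner_edges X \<sigma> = corner_edges X \<tau> \<longrightarrow> \<sigma> = \<tau>)"

text \<open>Here \<open>x\<close> ranges over all points, as a nonempty link belongs to a \<open>0\<close>-cube.\<close>

definition edge_flag :: "('c, 'p) cube_complex \<Rightarrow> bool" where
  "edge_flag X \<longleftrightarrow> (\<forall>x A. A \<noteq> {} \<and> finite A \<and>
     (\<forall>a\<in>A. \<exists>\<sigma>\<in>link X x. cdim X (fst \<sigma>) = 1 \<and> half_point X \<sigma> = a) \<and>
     (\<forall>a\<in>A. \<forall>b\<in>A. a \<noteq> b \<longrightarrow> (\<exists>\<sigma>\<in>link X x. corner_edges X \<sigma> = {a, b})) \<longrightarrow>
     (\<exists>\<sigma>\<in>link X x. corner_edges X \<sigma> = A))"

lemma simplicial_link_iff: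
  assumes X: "cube_complex X"
  shows "(\<forall>x\<in>zero_cubes X. simplicial_link X (link X x)) \<longleftrightarrow> edge_simplicial X"
proof -
  have sub: "simplex_vertices X (link X x) \<sigma> \<subseteq> link X x" for x \<sigma>
    using simplex_vertices_sub by (rule subset_trans)
  have card: "card (simplex_vertices X (link X x) \<sigma>) = card (corner_edges X \<sigma>)" if "\<sigma> \<in> link X x" for \<sigma> x
    using card_image[OF inj_on_subset[OF half_point_inj_on_link[OF X] sub], of x \<sigma>]
    unfolding half_points_simplex_vertices[OF X that] by simp
  have eq: "simplex_vertices X (link X x) \<sigma> = simplex_vertices X (link X x) \<tau> \<longleftrightarrow> corner_edges X \<sigma> = corner_edges X \<tau>"
    if "\<sigma> \<in> link X x" "\<tau> \<in> link X x" for \<sigma> \<tau> x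
    using inj_on_image_eq_iff[OF half_point_inj_on_link[OF X] sub sub, of x \<sigma> \<tau>]
    unfolding half_points_simplex_vertices[OF X that(1)] half_points_simplex_vertices[OF X that(2)] by blast
  show ?thesis
  proof
    assume L: "\<forall>x\<in>zero_cubes X. simplicial_link X (link X x)"
    show "edge_simplicial X"
      unfolding edge_simplicial_def
    proof (intro conjI ballI impI)
      fix \<sigma> assume s: "\<sigma> \<in> corners X"
      then have "\<sigma> \<in> link X (chart X (fst \<sigma>) (snd \<sigma>))" by (simp add: link_corners)
      then show "card (corner_edges X \<sigma>) = cdim X (fst \<sigma>)"
        using L corner_vertex_zero_cube[OF X s] card unfolding simplicial_link_def by fastforce
    next
      fix \<sigma> \<tau> assume s: "\<sigma> \<in> corners X" and t: "\<tau> \<in> corners X" and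
        e: "chart X (fst \<sigma>) (snd \<sigma>) = chart X (fst \<tau>) (snd \<tau>) \<and> corner_edges X \<sigma> = corner_edges X \<tau>"
      let ?x = "chart X (fst \<sigma>) (snd \<sigma>)"
      have st: "\<sigma> \<in> link X ?x" "\<tau> \<in> link X ?x" using s t e by (auto simp: link_corners)
      have "inj_on (simplex_vertices X (link X ?x)) (link X ?x)"
        using L corner_vertex_zero_cube[OF X s] unfolding simplicial_link_def by blast
      then show "\<sigma> = \<tau>" using eq[OF st] st e by (meson inj_onD)
    qed
  next
    assume R: "edge_simplicial X"
    show "\<forall>x\<in>zero_cubes X. simplicial_link X (link X x)"
      unfolding simplicial_link_def
    proof (intro ballI conjI inj_onI)
      fix x \<sigma> assume "\<sigma> \<in> link X x"
      then show "card (simplex_vertices X (link X x) \<sigma>) = cdim X (fst \<sigma>)"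
        using card R unfolding edge_simplicial_def link_corners by metis
    next
      fix x \<sigma> \<tau> assume "\<sigma> \<in> link X x" "\<tau> \<in> link X x"
        "simplex_vertices X (link X x) \<sigma> = simplex_vertices X (link X x) \<tau>"
      then show "\<sigma> = \<tau>" using eq R unfolding edge_simplicial_def link_corners by metis
    qed
  qed
qed

lemma flag_link_iff:
  assumes X: "cube_complex X"
  shows "(\<forall>x\<in>zero_cubes X. flag_link X (link X x)) \<longleftrightarrow> edge_flag X"
proof
  have sub: "simplex_vertices X (link X x) \<sigma> \<subseteq> link X x" for x \<sigma>
    using simplex_vertices_sub by (rule subset_trans)
  have eq: "simplex_vertices X (link X x) \<sigma> = A \<longleftrightarrow> corner_edges X \<sigma> = half_point X ` A"
    if "\<sigma> \<in> link X x" "A \<subseteq> link_vertices X (link X x)" for \<sigma> x A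
    using inj_on_image_eq_iff[OF half_point_inj_on_link[OF X] sub subset_trans[OF that(2) simplex_vertices_sub(2)], of \<sigma>]
    unfolding half_points_simplex_vertices[OF X that(1)] by blast
  {
    assume L: "\<forall>x\<in>zero_cubes X. flag_link X (link X x)"
    show "edge_flag X"
      unfolding edge_flag_def
    proof (intro allI impI)
      fix x A
      assume A: "A \<noteq> {} \<and> finite A \<and> (\<forall>a\<in>A. \<exists>\<sigma>\<in>link X x. cdim X (fst \<sigma>) = 1 \<and> half_point X \<sigma> = a) \<and>
        (\<forall>a\<in>A. \<forall>b\<in>A. a \<noteq> b \<longrightarrow> (\<exists>\<sigma>\<in>link X x. corner_edges X \<sigma> = {a, b}))"
      then obtain s where s: "\<And>a. a \<in> A \<Longrightarrow> s a \<in> link X x \<and> cdim X (fst (s a)) = 1 \<and> half_point X (s a) = a"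
        by metis
      let ?V = "s ` A"
      have V: "?V \<subseteq> link_vertices X (link X x)" using s unfolding link_vertices_def by auto
      have im: "half_point X ` ?V = A" using s by force
      have "\<forall>a\<in>?V. \<forall>b\<in>?V. a \<noteq> b \<longrightarrow> adjacent_in_link X (link X x) a b"
      proof (intro ballI impI)
        fix a b assume ab: "a \<in> ?V" "b \<in> ?V" "a \<noteq> b"
        then obtain a' b' where ab': "a' \<in> A" "b' \<in> A" "a = s a'" "b = s b'" "a' \<noteq> b'" by blast
        then obtain \<sigma> where \<sigma>: "\<sigma> \<in> link X x" "corner_edges X \<sigma> = {a', b'}" using A by blast
        have "half_point X ` {a, b} = {a', b'}" using s ab' by auto
        then have "simplex_vertices X (link X x) \<sigma> = {a, b}" using eq[OF \<sigma>(1), of "{a, b}"] \<sigma>(2) ab V by auto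
        then show "adjacent_in_link X (link X x) a b" unfolding adjacent_in_link_def using ab \<sigma> by blast
      qed
      moreover obtain a where a: "a \<in> A" using conjunct1[OF A] by (meson ex_in_conv)
      then have "x \<in> zero_cubes X" using s[OF a] corner_vertex_zero_cube[OF X, of "s a"] by (auto simp: link_corners)
      ultimately obtain \<sigma> where "\<sigma> \<in> link X x" "simplex_vertices X (link X x) \<sigma> = ?V"
        using L V A unfolding flag_link_def by (metis finite_imageI image_is_empty)
      then show "\<exists>\<sigma>\<in>link X x. corner_edges X \<sigma> = A" using eq V im by metis
    qed
  }
  {
    assume R: "edge_flag X"
    show "\<forall>x\<in>zero_cubes X. flag_link X (link X x)"
      unfolding flag_link_def
    proof (intro ballI allI impI)
      fix x V
      assume V: "V \<subseteq> link_vertices X (link X x) \<and> finite V \<and> V \<noteq> {} \<and>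
        (\<forall>a\<in>V. \<forall>b\<in>V. a \<noteq> b \<longrightarrow> adjacent_in_link X (link X x) a b)"
      have "\<exists>\<sigma>\<in>link X x. corner_edges X \<sigma> = half_point X ` V"
      proof (rule R[unfolded edge_flag_def, rule_format], intro conjI ballI impI)
        show "half_point X ` V \<noteq> {}" "finite (half_point X ` V)" using V by auto
        fix a assume a: "a \<in> half_point X ` V"
        then show "\<exists>\<sigma>\<in>link X x. cdim X (fst \<sigma>) = 1 \<and> half_point X \<sigma> = a"
          using V unfolding link_vertices_def by (elim imageE) auto
        fix b assume b: "b \<in> half_point X ` V" "a \<noteq> b"
        obtain a' b' where ab: "a' \<in> V" "b' \<in> V" "a = half_point X a'" "b = half_point X b'" using a b by blast
        then have "a' \<noteq> b'" using b by blast
        then obtain \<sigma> where s: "\<sigma> \<in> link X x" "simplex_vertices X (link X x) \<sigma> = {a', b'}"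
          using V ab unfolding adjacent_in_link_def by blast
        have "{a', b'} \<subseteq> link_vertices X (link X x)" using ab(1,2) conjunct1[OF V] by blast
        then have "corner_edges X \<sigma> = half_point X ` {a', b'}" using iffD1[OF eq[OF s(1)] s(2)] by blast
        then have "corner_edges X \<sigma> = {a, b}" using ab(3,4) by simp
        then show "\<exists>\<sigma>\<in>link X x. corner_edges X \<sigma> = {a, b}" using s(1) by (rule bexI)
      qed
      then show "\<exists>\<sigma>\<in>link X x. simplex_vertices X (link X x) \<sigma> = V" using eq[OF _ conjunct1[OF V]] by metis
    qed
  }
qed

text \<open>Half points identify corners, so passing from vertices of a link to half points loses nothing.\<close>

lemma npc_iff: "npc X \<longleftrightarrow> cube_complex X \<and> edge_simplicial X \<and> edge_flag X"
  unfolding npc_def using simplicial_link_iff[of X] flag_link_iff[of X] by blast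

section \<open>Topology\<close>

lemma compact_cube: "compact (cube n)"
proof -
  have "cube n = Pi\<^sub>E UNIV (\<lambda>i. if i < n then {-1..1} else {undefined})"
    by (auto simp: cube_iff PiE_iff abs_le_iff split: if_splits) (meson not_less)+
  moreover have "compactin (product_topology (\<lambda>i. euclidean) UNIV) (Pi\<^sub>E UNIV (\<lambda>i::nat. if i < n then {-1..1::real} else {undefined}))"
    unfolding compactin_PiE by auto
  ultimately show ?thesis by (simp add: euclidean_product_topology)
qed

lemma continuous_face_map:
  assumes "face_map m n g" shows "continuous_on (cube m) g"
proof (rule continuous_on_coordinatewise_then_product)
  obtain \<pi> \<epsilon> s where 1: "inj_on \<pi> {..<m}" "\<pi> ` {..<m} \<subseteq> {..<n}" "\<And>i. i < m \<Longrightarrow> \<epsilon> i \<in> {-1, 1::real}"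
    "\<And>j. j < n \<Longrightarrow> j \<notin> \<pi> ` {..<m} \<Longrightarrow> s j \<in> {-1, 1}" "\<And>u. u \<in> cube m \<Longrightarrow> g u \<in> cube n"
    "\<And>u i. u \<in> cube m \<Longrightarrow> i < m \<Longrightarrow> g u (\<pi> i) = \<epsilon> i * u i"
    "\<And>u j. u \<in> cube m \<Longrightarrow> j < n \<Longrightarrow> j \<notin> \<pi> ` {..<m} \<Longrightarrow> g u j = s j"
    by (rule face_mapE[OF assms]) blast
  fix j
  show "continuous_on (cube m) (\<lambda>u. g u j)"
  proof (cases "j < n")
    case False
    then have "g u j = undefined" if "u \<in> cube m" for u using 1(5)[OF that] by (auto simp: cube_iff)
    then show ?thesis by (simp cong: continuous_on_cong)
  next
    case True
    show ?thesis
    proof (cases "j \<in> \<pi> ` {..<m}")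
      case True
      then obtain i where i: "i < m" "j = \<pi> i" by auto
      have "continuous_on (cube m) (\<lambda>u. \<epsilon> i * u i)"
        by (intro continuous_on_mult_left continuous_on_subset[OF continuous_on_product_coordinates subset_UNIV])
      then show ?thesis using 1(6) i by (simp cong: continuous_on_cong)
    next
      case False then show ?thesis using 1(7) \<open>j < n\<close> by (simp cong: continuous_on_cong)
    qed
  qed
qed

lemma chart_continuous:
  assumes "c \<in> cells X"
  shows "continuous_map (top_of_set (cube (cdim X c))) (cc_topology X) (chart X c)"
  unfolding continuous_map_def
proof (intro conjI allI impI)
  show "chart X c \<in> topspace (top_of_set (cube (cdim X c))) \<rightarrow> topspace (cc_topology X)"
    using chart_points[OF assms] by auto
  fix U assume "openin (cc_topology X) U"
  then show "openin (top_of_set (cube (cdim X c))) {x \<in> topspace (top_of_set (cube (cdim X c))). chart X c x \<in> U}"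
    using assms by (simp add: openin_cc_topology)
qed

lemma closedin_cc_topology:
  "closedin (cc_topology X) B \<longleftrightarrow> B \<subseteq> points X \<and>
     (\<forall>c\<in>cells X. closedin (top_of_set (cube (cdim X c))) {u \<in> cube (cdim X c). chart X c u \<in> B})"
proof -
  have eq: "{u \<in> cube (cdim X c). chart X c u \<in> points X - B} =
      cube (cdim X c) - {u \<in> cube (cdim X c). chart X c u \<in> B}" if "c \<in> cells X" for c
    using chart_points[OF that] by blast
  show ?thesis
    unfolding closedin_def openin_cc_topology topspace_cc_topology topspace_euclidean_subtopology
    using eq by auto
qed

lemma compact_space_finite_cells:
  assumes "finite (cells X)" shows "compact_space (cc_topology X)"
proof -
  have "compactin (cc_topology X) (chart X c ` cube (cdim X c))" if "c \<in> cells X" for c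
    by (rule image_compactin[OF _ chart_continuous[OF that]]) (simp add: compact_cube compactin_subtopology)
  then have "compactin (cc_topology X) (\<Union>c\<in>cells X. chart X c ` cube (cdim X c))"
    using assms by (intro compactin_Union) auto
  then show ?thesis unfolding compact_space_def topspace_cc_topology points_def .
qed

lemma finite_cube_faces: "finite (cube_faces n)"
proof -
  have "cube_faces n \<subseteq> (\<lambda>(J, s). {v \<in> cube n. \<forall>i\<in>J. v i = s i}) ` (Pow {..<n} \<times> Pi\<^sub>E {..<n} (\<lambda>_. {-1, 1}))"
  proof
    fix F :: "(nat \<Rightarrow> real) set" assume "F \<in> cube_faces n"
    then obtain J s where J: "J \<subseteq> {..<n}" "s \<in> J \<rightarrow> {-1, 1}" "F = {v \<in> cube n. \<forall>i\<in>J. v i = s i}"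
      unfolding cube_faces_def by blast
    define s' where "s' = (\<lambda>i. if i < n then (if i \<in> J then s i else 1) else undefined)"
    have "s' \<in> Pi\<^sub>E {..<n} (\<lambda>_. {-1, 1})" using J by (auto simp: s'_def PiE_iff extensional_def Pi_iff)
    moreover have "F = {v \<in> cube n. \<forall>i\<in>J. v i = s' i}" using J by (auto simp: s'_def)
    ultimately show "F \<in> (\<lambda>(J, s). {v \<in> cube n. \<forall>i\<in>J. v i = s i}) ` (Pow {..<n} \<times> Pi\<^sub>E {..<n} (\<lambda>_. {-1, 1}))"
      using J(1) by auto
  qed
  moreover have "finite (Pow {..<n} \<times> Pi\<^sub>E {..<n} (\<lambda>_. {-1, 1::real}))" by (intro finite_cartesian_product finite_PiE) auto
  ultimately show ?thesis using finite_surj by blast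
qed

lemma face_choice:
  assumes "cube_complex X" "c \<in> cells X"
  obtains d g where "\<And>F. F \<in> cube_faces (cdim X c) \<Longrightarrow> d F \<in> cells X"
    "\<And>F. F \<in> cube_faces (cdim X c) \<Longrightarrow> face_map (cdim X (d F)) (cdim X c) (g F)"
    "\<And>F. F \<in> cube_faces (cdim X c) \<Longrightarrow> g F ` cube (cdim X (d F)) = F"
    "\<And>F u. F \<in> cube_faces (cdim X c) \<Longrightarrow> u \<in> cube (cdim X (d F)) \<Longrightarrow> chart X c (g F u) = chart X (d F) u"
proof -
  have "\<forall>F\<in>cube_faces (cdim X c). \<exists>d g. d \<in> cells X \<and> face_map (cdim X d) (cdim X c) g \<and> g ` cube (cdim X d) = F \<and>
    (\<forall>u\<in>cube (cdim X d). chart X c (g u) = chart X d u)"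
    using face_cell[OF assms] by metis
  then show ?thesis using that by metis
qed

lemma face_choice_carrier:
  assumes "\<And>F. F \<in> cube_faces (cdim X c) \<Longrightarrow> face_map (cdim X (d F)) (cdim X c) (g F)"
    "\<And>F. F \<in> cube_faces (cdim X c) \<Longrightarrow> g F ` cube (cdim X (d F)) = F"
    "v \<in> cube (cdim X c)"
  obtains F u where "F \<in> cube_faces (cdim X c)" "u \<in> open_cube (cdim X (d F))" "g F u = v"
proof -
  obtain F where F: "F \<in> cube_faces (cdim X c)"
    "\<And>m g. face_map m (cdim X c) g \<Longrightarrow> g ` cube m = F \<Longrightarrow> \<exists>u\<in>open_cube m. g u = v"
    by (rule carrier_face[OF assms(3)]) blast
  then show ?thesis using that F(2)[OF assms(1)[OF F(1)] assms(2)[OF F(1)]] by blast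
qed

text \<open>Any set of centres of cells is closed, since a closed cell contains at most one centre for each
  of its finitely many faces. So the set of all centres is closed and discrete, and in a compact space it
  is finite.\<close>

lemma compact_space_imp_finite_cells:
  assumes X: "cube_complex X" and comp: "compact_space (cc_topology X)"
  shows "finite (cells X)"
proof (rule ccontr)
  assume inf: "infinite (cells X)"
  define b where "b c = chart X c (bary (cdim X c))" for c
  have binj: "inj_on b (cells X)"
    unfolding b_def inj_on_def using open_inj(1)[OF X] bary_open by blast
  have bp: "b ` cells X \<subseteq> points X"
    unfolding b_def by (intro image_subsetI chart_points open_cube_sub[OF bary_open])
  have closed: "closedin (cc_topology X) D" if D: "D \<subseteq> b ` cells X" for D
    unfolding closedin_cc_topology
  proof (intro conjI ballI)
    show "D \<subseteq> points X" using D bp by blast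
    fix c assume c: "c \<in> cells X"
    obtain d g where d: "\<And>F. F \<in> cube_faces (cdim X c) \<Longrightarrow> d F \<in> cells X"
      "\<And>F. F \<in> cube_faces (cdim X c) \<Longrightarrow> face_map (cdim X (d F)) (cdim X c) (g F)"
      "\<And>F. F \<in> cube_faces (cdim X c) \<Longrightarrow> g F ` cube (cdim X (d F)) = F"
      "\<And>F u. F \<in> cube_faces (cdim X c) \<Longrightarrow> u \<in> cube (cdim X (d F)) \<Longrightarrow> chart X c (g F u) = chart X (d F) u"
      by (rule face_choice[OF X c]) blast
    have "{u \<in> cube (cdim X c). chart X c u \<in> D} \<subseteq> (\<lambda>F. g F (bary (cdim X (d F)))) ` cube_faces (cdim X c)"
    proof
      fix v assume v: "v \<in> {u \<in> cube (cdim X c). chart X c u \<in> D}"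
      then have vc: "v \<in> cube (cdim X c)" by simp
      obtain F u where F: "F \<in> cube_faces (cdim X c)" "u \<in> open_cube (cdim X (d F))" "g F u = v"
        by (rule face_choice_carrier[OF d(2,3) vc])
      obtain e where e: "e \<in> cells X" "chart X c v = b e" using v D by blast
      have "chart X (d F) u = chart X e (bary (cdim X e))"
        using d(4)[OF F(1) open_cube_sub[OF F(2)]] F(3) e(2) by (simp add: b_def)
      then have "u = bary (cdim X (d F))" using open_inj[OF X d(1)[OF F(1)] e(1) F(2) bary_open] by simp
      then show "v \<in> (\<lambda>F. g F (bary (cdim X (d F)))) ` cube_faces (cdim X c)" using F by blast
    qed
    then have "finite {u \<in> cube (cdim X c). chart X c u \<in> D}"
      using finite_cube_faces finite_surj by blast
    then have "closed {u \<in> cube (cdim X c). chart X c u \<in> D}" by (rule finite_imp_closed)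
    then show "closedin (top_of_set (cube (cdim X c))) {u \<in> cube (cdim X c). chart X c u \<in> D}"
      by (rule closed_subset[rotated]) auto
  qed
  have "compactin (cc_topology X) (b ` cells X)"
    by (rule closedin_compact_space[OF comp closed]) simp
  then have cs: "compact_space (subtopology (cc_topology X) (b ` cells X))"
    by (simp add: compact_space_subtopology)
  have "subtopology (cc_topology X) (b ` cells X) = discrete_topology (b ` cells X)"
  proof -
    have "closedin (subtopology (cc_topology X) (b ` cells X)) D" if "D \<subseteq> b ` cells X" for D
      using closed[OF that] that by (auto simp: closedin_subtopology)
    then have "openin (subtopology (cc_topology X) (b ` cells X)) D" if "D \<subseteq> b ` cells X" for D
      using that bp unfolding openin_closedin_eq by (auto simp: Int_absorb1)
    then show ?thesis by (intro topology_eq[THEN iffD2]) (auto dest: openin_imp_subset)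
  qed
  then have "finite (b ` cells X)" using cs by (simp add: compact_space_discrete_topology)
  then show False using inf binj by (simp add: finite_image_iff)
qed

text \<open>Characteristic maps are closed: the preimage of \<open>chart X d ` C\<close> in the cube \<open>c\<close> is a finite union of
  compact sets, one for each pair of a face of \<open>c\<close> and a face of \<open>d\<close> that are the same cell.\<close>

lemma closedin_chart_image:
  assumes X: "cube_complex X" and d: "d \<in> cells X" and C: "compact C" "C \<subseteq> cube (cdim X d)"
  shows "closedin (cc_topology X) (chart X d ` C)"
  unfolding closedin_cc_topology
proof (intro conjI ballI)
  show "chart X d ` C \<subseteq> points X" using C chart_points[OF d] by blast
  fix c assume c: "c \<in> cells X"
  obtain a g where a: "\<And>F. F \<in> cube_faces (cdim X c) \<Longrightarrow> a F \<in> cells X"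
      "\<And>F. F \<in> cube_faces (cdim X c) \<Longrightarrow> face_map (cdim X (a F)) (cdim X c) (g F)"
      "\<And>F. F \<in> cube_faces (cdim X c) \<Longrightarrow> g F ` cube (cdim X (a F)) = F"
      "\<And>F u. F \<in> cube_faces (cdim X c) \<Longrightarrow> u \<in> cube (cdim X (a F)) \<Longrightarrow> chart X c (g F u) = chart X (a F) u"
    by (rule face_choice[OF X c]) blast
  obtain b h where b: "\<And>F. F \<in> cube_faces (cdim X d) \<Longrightarrow> b F \<in> cells X"
      "\<And>F. F \<in> cube_faces (cdim X d) \<Longrightarrow> face_map (cdim X (b F)) (cdim X d) (h F)"
      "\<And>F. F \<in> cube_faces (cdim X d) \<Longrightarrow> h F ` cube (cdim X (b F)) = F"
      "\<And>F u. F \<in> cube_faces (cdim X d) \<Longrightarrow> u \<in> cube (cdim X (b F)) \<Longrightarrow> chart X d (h F u) = chart X (b F) u"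
    by (rule face_choice[OF X d]) blast
  let ?I = "{(F, G). F \<in> cube_faces (cdim X c) \<and> G \<in> cube_faces (cdim X d) \<and> a F = b G}"
  have "finite ?I" by (rule finite_subset[of _ "cube_faces (cdim X c) \<times> cube_faces (cdim X d)"]) (auto simp: finite_cube_faces)
  moreover have "compact (g F ` {t \<in> cube (cdim X (b G)). h G t \<in> C})" if FG: "(F, G) \<in> ?I" for F G
  proof -
    have ab: "a F = b G" and F: "F \<in> cube_faces (cdim X c)" and G: "G \<in> cube_faces (cdim X d)" using FG by auto
    have "closedin (top_of_set (cube (cdim X (b G)))) (cube (cdim X (b G)) \<inter> h G -` C)"
      by (rule continuous_closedin_preimage[OF continuous_face_map[OF b(2)[OF G]] compact_imp_closed[OF C(1)]])
    then have "compact (cube (cdim X (b G)) \<inter> h G -` C)"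
      using closedin_compact[OF compact_cube] by blast
    moreover have "{t \<in> cube (cdim X (b G)). h G t \<in> C} = cube (cdim X (b G)) \<inter> h G -` C" by blast
    moreover have "continuous_on (cube (cdim X (b G)) \<inter> h G -` C) (g F)"
      using continuous_on_subset[OF continuous_face_map[OF a(2)[OF F]]] ab by auto
    ultimately show ?thesis using compact_continuous_image by metis
  qed
  ultimately have comp: "compact (\<Union>(F, G)\<in>?I. g F ` {t \<in> cube (cdim X (b G)). h G t \<in> C})"
    by (intro compact_UN) auto
  have "{u \<in> cube (cdim X c). chart X c u \<in> chart X d ` C} = (\<Union>(F, G)\<in>?I. g F ` {t \<in> cube (cdim X (b G)). h G t \<in> C})"
  proof (intro equalityI subsetI)
    fix v assume "v \<in> {u \<in> cube (cdim X c). chart X c u \<in> chart X d ` C}"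
    then obtain w where v: "v \<in> cube (cdim X c)" and w: "w \<in> C" "chart X c v = chart X d w" by blast
    obtain F t where F: "F \<in> cube_faces (cdim X c)" "t \<in> open_cube (cdim X (a F))" "g F t = v"
      by (rule face_choice_carrier[OF a(2,3) v])
    have wc: "w \<in> cube (cdim X d)" using w C by blast
    obtain G s where G: "G \<in> cube_faces (cdim X d)" "s \<in> open_cube (cdim X (b G))" "h G s = w"
      by (rule face_choice_carrier[OF b(2,3) wc])
    have "chart X (a F) t = chart X (b G) s"
      using a(4)[OF F(1) open_cube_sub[OF F(2)]] b(4)[OF G(1) open_cube_sub[OF G(2)]] F(3) G(3) w(2) by simp
    then have "a F = b G" "t = s" using open_inj[OF X a(1)[OF F(1)] b(1)[OF G(1)] F(2) G(2)] by auto
    then show "v \<in> (\<Union>(F, G)\<in>?I. g F ` {t \<in> cube (cdim X (b G)). h G t \<in> C})"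
      using F G w open_cube_sub[OF G(2)] by blast
  next
    fix v assume "v \<in> (\<Union>(F, G)\<in>?I. g F ` {t \<in> cube (cdim X (b G)). h G t \<in> C})"
    then obtain F G t where FG: "F \<in> cube_faces (cdim X c)" "G \<in> cube_faces (cdim X d)" "a F = b G"
      and t: "t \<in> cube (cdim X (b G))" "h G t \<in> C" "v = g F t" by blast
    have "chart X c v = chart X d (h G t)" using a(4)[OF FG(1)] b(4)[OF FG(2)] FG(3) t by simp
    moreover have "v \<in> cube (cdim X c)" using face_map_cube[OF a(2)[OF FG(1)]] FG(3) t by simp
    ultimately show "v \<in> {u \<in> cube (cdim X c). chart X c u \<in> chart X d ` C}" using t by blast
  qed
  then have "closed {u \<in> cube (cdim X c). chart X c u \<in> chart X d ` C}"
    using compact_imp_closed[OF comp] by simp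
  then show "closedin (top_of_set (cube (cdim X c))) {u \<in> cube (cdim X c). chart X c u \<in> chart X d ` C}"
    by (rule closed_subset[rotated]) auto
qed

section \<open>Cellular maps\<close>

definition cell_to_cell ::
  "('p \<Rightarrow> 'q) \<Rightarrow> ('c, 'p) cube_complex \<Rightarrow> 'c \<Rightarrow> ('d, 'q) cube_complex \<Rightarrow> 'd \<Rightarrow>
     ((nat \<Rightarrow> real) \<Rightarrow> nat \<Rightarrow> real) \<Rightarrow> bool" where
  "cell_to_cell f X c Z d g \<longleftrightarrow> d \<in> cells Z \<and> cdim Z d = cdim X c \<and> face_map (cdim X c) (cdim X c) g \<and>
     (\<forall>u\<in>cube (cdim X c). f (chart X c u) = chart Z d (g u))"

text \<open>In contrast to a combinatorial map, the formula in coordinates is required on closed cubes;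
  continuity follows (\<open>cellular_imp_combinatorial\<close>).\<close>

definition cellular :: "('p \<Rightarrow> 'q) \<Rightarrow> ('c, 'p) cube_complex \<Rightarrow> ('d, 'q) cube_complex \<Rightarrow> bool" where
  "cellular f X Z \<longleftrightarrow> (\<forall>c\<in>cells X. \<exists>d g. cell_to_cell f X c Z d g)"

lemma cellular_imp_combinatorial:
  assumes "cellular f X Z" shows "combinatorial_map f X Z"
  unfolding combinatorial_map_def
proof (intro conjI ballI)
  have cells: "\<exists>d g. cell_to_cell f X c Z d g" if "c \<in> cells X" for c
    using assms that unfolding cellular_def by blast
  show "continuous_map (cc_topology X) (cc_topology Z) f"
    unfolding continuous_map_def topspace_cc_topology
  proof (intro conjI allI impI)
    show "f \<in> points X \<rightarrow> points Z"
    proof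
      fix p assume "p \<in> points X"
      then obtain c u where c: "c \<in> cells X" "u \<in> cube (cdim X c)" "p = chart X c u" unfolding points_def by blast
      then obtain d g where "cell_to_cell f X c Z d g" using cells by blast
      then show "f p \<in> points Z"
        using c chart_points[of d Z "g u"] face_map_cube[of "cdim X c" "cdim X c" g u] unfolding cell_to_cell_def by simp
    qed
    fix U assume U: "openin (cc_topology Z) U"
    show "openin (cc_topology X) {x \<in> points X. f x \<in> U}"
      unfolding openin_cc_topology
    proof (intro conjI ballI)
      fix c assume c: "c \<in> cells X"
      obtain d g where d: "d \<in> cells Z" "cdim Z d = cdim X c" "face_map (cdim X c) (cdim X c) g"
        "\<And>u. u \<in> cube (cdim X c) \<Longrightarrow> f (chart X c u) = chart Z d (g u)"
        using cells[OF c] unfolding cell_to_cell_def by blast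
      have o: "openin (top_of_set (cube (cdim X c))) {u \<in> cube (cdim X c). chart Z d u \<in> U}"
        using conjunct2[OF U[unfolded openin_cc_topology], rule_format, OF d(1)] unfolding d(2) .
      have "openin (top_of_set (cube (cdim X c))) (cube (cdim X c) \<inter> g -` {u \<in> cube (cdim X c). chart Z d u \<in> U})"
        by (rule continuous_openin_preimage[OF continuous_face_map[OF d(3)] _ o]) (use face_map_cube[OF d(3)] in blast)
      moreover have "cube (cdim X c) \<inter> g -` {u \<in> cube (cdim X c). chart Z d u \<in> U} =
          {u \<in> cube (cdim X c). chart X c u \<in> {x \<in> points X. f x \<in> U}}"
        using d(4) face_map_cube[OF d(3)] chart_points[OF c] by auto
      ultimately show "openin (top_of_set (cube (cdim X c))) {u \<in> cube (cdim X c). chart X c u \<in> {x \<in> points X. f x \<in> U}}"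
        by simp
    qed auto
  qed
  fix c assume "c \<in> cells X"
  then obtain d g where d: "cell_to_cell f X c Z d g" using cells by blast
  then have "carries_cell f X c Z d g"
    unfolding carries_cell_def isometry_of_cubes_iff cell_to_cell_def using open_cube_sub by auto
  then show "\<exists>d\<in>cells Z. \<exists>g. carries_cell f X c Z d g" using d unfolding cell_to_cell_def by blast
qed

text \<open>The formula for a combinatorial map on an open cell extends to the closed cell. Let \<open>u\<close> be a boundary
  point at which it fails, and let \<open>p t\<close> for \<open>0 < t\<close> be the interior points on the segment from \<open>u\<close> to
  the centre. Since characteristic maps are closed, the image of \<open>u\<close> lies in the image of each
  segment from \<open>u\<close>, so it is the image of \<open>p t\<close> for arbitrarily small \<open>t\<close>. Two such parameters
  contradict injectivity on the open cell.\<close>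

lemma carries_cell_closed:
  assumes X: "cube_complex X" and Z: "cube_complex Z" and f: "continuous_map (cc_topology X) (cc_topology Z) f"
    and c: "c \<in> cells X" and d: "d \<in> cells Z" and g: "carries_cell f X c Z d g"
  shows "cell_to_cell f X c Z d g"
proof -
  let ?n = "cdim X c"
  have fm: "face_map ?n ?n g" and dim: "cdim Z d = ?n"
    using g unfolding carries_cell_def isometry_of_cubes_iff by auto
  have op: "f (chart X c u) = chart Z d (g u)" if "u \<in> open_cube ?n" for u
    using g that unfolding carries_cell_def by blast
  have "f (chart X c u) = chart Z d (g u)" if u: "u \<in> cube ?n" for u
  proof (rule ccontr)
    assume neq: "f (chart X c u) \<noteq> chart Z d (g u)"
    define p where "p t = (\<lambda>i. if i < ?n then (1 - t) * u i else undefined)" for t :: real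
    have p0: "p 0 = u" using u by (auto simp: p_def cube_iff)
    have popen: "p t \<in> open_cube ?n" if "0 < t" "t \<le> 1" for t
    proof -
      have "\<bar>(1 - t) * u i\<bar> < 1" if "i < ?n" for i
      proof -
        have "\<bar>(1 - t) * u i\<bar> \<le> \<bar>1 - t\<bar> * 1" unfolding abs_mult
          by (rule mult_left_mono) (use u that in \<open>auto simp: cube_iff\<close>)
        also have "\<dots> < 1" using \<open>0 < t\<close> \<open>t \<le> 1\<close> by auto
        finally show ?thesis .
      qed
      then show ?thesis by (auto simp: p_def open_cube_iff)
    qed
    have pc: "p t \<in> cube ?n" if "0 \<le> t" "t \<le> 1" for t
      using popen[THEN open_cube_sub] that p0 u by (cases "t = 0") auto
    have cont: "continuous_on A p" for A
    proof (rule continuous_on_coordinatewise_then_product)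
      show "continuous_on A (\<lambda>t. p t i)" for i
        by (cases "i < ?n") (auto simp: p_def intro!: continuous_intros)
    qed
    have ex: "\<exists>t. 0 < t \<and> t \<le> r \<and> f (chart X c u) = chart Z d (g (p t))" if r: "0 < r" "r \<le> 1" for r
    proof -
      have pr: "p ` {0..r} \<subseteq> cube ?n" using pc r by auto
      have "compact (p ` {0..r})" by (intro compact_continuous_image cont) simp
      then have C: "compact (g ` p ` {0..r})"
        by (rule compact_continuous_image[OF continuous_on_subset[OF continuous_face_map[OF fm] pr]])
      have Cs: "g ` p ` {0..r} \<subseteq> cube (cdim Z d)" using pr face_map_cube[OF fm] dim by fastforce
      have "closedin (cc_topology Z) (chart Z d ` g ` p ` {0..r})"
        by (rule closedin_chart_image[OF Z d C Cs])
      then have "closedin (top_of_set (cube ?n)) {v \<in> cube ?n. f (chart X c v) \<in> chart Z d ` g ` p ` {0..r}}"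
        using closedin_continuous_map_preimage[OF continuous_map_compose[OF chart_continuous[OF c] f]]
        by (auto simp: o_def)
      then have cl: "closed {v \<in> cube ?n. f (chart X c v) \<in> chart Z d ` g ` p ` {0..r}}"
        using closedin_compact[OF compact_cube] compact_imp_closed by blast
      have "closed (p -` {v \<in> cube ?n. f (chart X c v) \<in> chart Z d ` g ` p ` {0..r}})"
        by (rule continuous_closed_vimage[OF cl]) (use cont[of UNIV] in \<open>simp add: continuous_on_eq_continuous_at\<close>)
      moreover have "{0<..<r} \<subseteq> p -` {v \<in> cube ?n. f (chart X c v) \<in> chart Z d ` g ` p ` {0..r}}"
      proof
        fix t assume t: "t \<in> {0<..<r}"
        then have "p t \<in> open_cube ?n" using popen r by auto
        then have "f (chart X c (p t)) = chart Z d (g (p t))" "p t \<in> cube ?n" using op open_cube_sub by blast+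
        then show "t \<in> p -` {v \<in> cube ?n. f (chart X c v) \<in> chart Z d ` g ` p ` {0..r}}" using t by auto
      qed
      ultimately have "closure {0<..<r} \<subseteq> p -` {v \<in> cube ?n. f (chart X c v) \<in> chart Z d ` g ` p ` {0..r}}"
        by (rule closure_minimal[rotated])
      moreover have "(0::real) \<in> closure {0<..<r}" using r by simp
      ultimately obtain t where t: "t \<in> {0..r}" "f (chart X c u) = chart Z d (g (p t))" using p0 by auto
      moreover have "t \<noteq> 0" using t neq p0 by auto
      ultimately show ?thesis by (intro exI[of _ t]) auto
    qed
    obtain t where t: "0 < t" "t \<le> 1" "f (chart X c u) = chart Z d (g (p t))" using ex[of 1] by auto
    obtain s where s: "0 < s" "s \<le> t / 2" "f (chart X c u) = chart Z d (g (p s))" using ex[of "t / 2"] t by auto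
    have "g (p s) = g (p t)"
      by (rule open_inj(2)[OF Z d d])
         (use s t face_map_self_open[OF fm popen[of s]] face_map_self_open[OF fm popen[of t]] dim in auto)
    then have "p s = p t" using face_map_inj[OF fm] pc[of s] pc[of t] s t by (auto dest: inj_onD)
    have "u i = 0" if "i < ?n" for i
      using fun_cong[OF \<open>p s = p t\<close>, of i] that s t by (auto simp: p_def)
    then have "u \<in> open_cube ?n" using u by (auto simp: open_cube_iff cube_iff)
    then show False using neq op by blast
  qed
  then show ?thesis using fm dim d unfolding cell_to_cell_def by blast
qed

section \<open>Locally convex sets of points and partial isometries\<close>

text \<open>The point set of a locally convex subcomplex (\<open>convex_set_subcomplex\<close>): the second condition says
  that it is a union of closed cells, the third one that the link inside it is full.\<close>

definition convex_set :: "('c, 'p) cube_complex \<Rightarrow> 'p set \<Rightarrow> bool" where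
  "convex_set Y D \<longleftrightarrow> D \<subseteq> points Y \<and>
     (\<forall>c\<in>cells Y. \<forall>u\<in>open_cube (cdim Y c). chart Y c u \<in> D \<longrightarrow> chart Y c ` cube (cdim Y c) \<subseteq> D) \<and>
     (\<forall>\<sigma>\<in>corners Y. corner_edges Y \<sigma> \<subseteq> D \<longrightarrow> chart Y (fst \<sigma>) ` cube (cdim Y (fst \<sigma>)) \<subseteq> D)"

lemma convex_set_points: "convex_set Y (points Y)"
  unfolding convex_set_def corners_def using chart_points by fastforce

lemma convex_setD:
  assumes "convex_set Y D"
  shows "D \<subseteq> points Y"
    and "\<And>c u w. c \<in> cells Y \<Longrightarrow> u \<in> open_cube (cdim Y c) \<Longrightarrow> chart Y c u \<in> D \<Longrightarrow> w \<in> cube (cdim Y c) \<Longrightarrow> chart Y c w \<in> D"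
    and "\<And>c v w. (c, v) \<in> corners Y \<Longrightarrow> corner_edges Y (c, v) \<subseteq> D \<Longrightarrow> w \<in> cube (cdim Y c) \<Longrightarrow> chart Y c w \<in> D"
proof -
  show "D \<subseteq> points Y" using assms unfolding convex_set_def by blast
  have "\<forall>c\<in>cells Y. \<forall>u\<in>open_cube (cdim Y c). chart Y c u \<in> D \<longrightarrow> chart Y c ` cube (cdim Y c) \<subseteq> D"
    using assms unfolding convex_set_def by (elim conjE)
  note closure = this
  show "chart Y c w \<in> D" if c: "c \<in> cells Y" "u \<in> open_cube (cdim Y c)" "chart Y c u \<in> D" "w \<in> cube (cdim Y c)" for c u w
  proof -
    have "chart Y c ` cube (cdim Y c) \<subseteq> D" using closure c(1,2,3) by blast
    then show ?thesis using c(4) by blast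
  qed
  fix c v w assume c: "(c, v) \<in> corners Y" "corner_edges Y (c, v) \<subseteq> D" and w: "w \<in> cube (cdim Y c)"
  have "\<forall>\<sigma>\<in>corners Y. corner_edges Y \<sigma> \<subseteq> D \<longrightarrow> chart Y (fst \<sigma>) ` cube (cdim Y (fst \<sigma>)) \<subseteq> D"
    using assms unfolding convex_set_def by (elim conjE)
  from bspec[OF this c(1)] c(2) have "chart Y c ` cube (cdim Y c) \<subseteq> D" by simp
  then show "chart Y c w \<in> D" using w by blast
qed

text \<open>If the half points of all edges at a corner lie in the subcomplex, then so do the vertices of the
  corresponding simplex of the link, and fullness gives the simplex.\<close>

lemma convex_set_subcomplex:
  assumes Y: "cube_complex Y" and S: "locally_convex Y S"
  shows "convex_set Y (points (subcomplex_on Y S))"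
proof -
  let ?X = "subcomplex_on Y S"
  have SX: "S \<subseteq> cells Y" and X: "cube_complex ?X" and
    full: "\<And>x. x \<in> zero_cubes ?X \<Longrightarrow> full_subcomplex Y (link ?X x) (link Y x)"
    using S unfolding locally_convex_def is_subcomplex_def by auto
  have [simp]: "cells ?X = S" "cdim ?X = cdim Y" "chart ?X = chart Y" unfolding subcomplex_on_def by auto
  have cellS: "c \<in> S" if "c \<in> cells Y" "u \<in> open_cube (cdim Y c)" "chart Y c u \<in> points ?X" for c u
  proof -
    note cu = that
    obtain s w where s: "s \<in> cells ?X" "w \<in> open_cube (cdim ?X s)" "chart Y c u = chart ?X s w"
      by (rule points_open[OF X cu(3)])
    have "s \<in> cells Y" "w \<in> open_cube (cdim Y s)" "chart Y c u = chart Y s w" using s SX by auto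
    then have "c = s" by (rule open_inj(1)[OF Y cu(1) _ cu(2)])
    then show ?thesis using s(1) by simp
  qed
  have cornerS: "c \<in> S" if \<sigma>: "(c, v) \<in> corners Y" and sub: "corner_edges Y (c, v) \<subseteq> points ?X" for c v
  proof -
    let ?x = "chart Y c v"
    have l: "(c, v) \<in> link Y ?x" using \<sigma> by (simp add: link_corners)
    have vin: "\<tau> \<in> link ?X ?x" if t: "\<tau> \<in> simplex_vertices Y (link Y ?x) (c, v)" for \<tau>
    proof -
      have tl: "\<tau> \<in> link Y ?x" using t simplex_vertices_sub by (metis subsetD)
      have "half_point Y \<tau> \<in> points ?X" using half_points_simplex_vertices[OF Y l] t sub by blast
      then have "fst \<tau> \<in> S"
        using cellS[of "fst \<tau>" "half (cdim Y (fst \<tau>)) (snd \<tau>)"] tl half_open[OF vertex_in_cube]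
        unfolding half_point_def link_def by auto
      then show ?thesis using tl unfolding link_def by auto
    qed
    have "0 < cdim Y c" using \<sigma> unfolding corners_def by auto
    then have "corner_edges Y (c, v) \<noteq> {}" unfolding corner_edges_def by auto
    then obtain \<tau> where "\<tau> \<in> simplex_vertices Y (link Y ?x) (c, v)"
      using half_points_simplex_vertices[OF Y l] by blast
    then have "\<tau> \<in> link ?X ?x" by (rule vin)
    then have "?x \<in> zero_cubes ?X" using corner_vertex_zero_cube[OF X, of \<tau>] by (auto simp: link_corners)
    then have "(c, v) \<in> link ?X ?x" using full[of ?x] vin l unfolding full_subcomplex_def by blast
    then show ?thesis unfolding link_def by auto
  qed
  show ?thesis
    unfolding convex_set_def
  proof (intro conjI ballI impI)
    show "points ?X \<subseteq> points Y" using SX unfolding points_def by auto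
    show "chart Y c ` cube (cdim Y c) \<subseteq> points ?X"
      if "c \<in> cells Y" "u \<in> open_cube (cdim Y c)" "chart Y c u \<in> points ?X" for c u
      using cellS[OF that] unfolding points_def by auto
    fix \<sigma> assume "\<sigma> \<in> corners Y" "corner_edges Y \<sigma> \<subseteq> points ?X"
    then have "fst \<sigma> \<in> S" using cornerS[of "fst \<sigma>" "snd \<sigma>"] by simp
    then show "chart Y (fst \<sigma>) ` cube (cdim Y (fst \<sigma>)) \<subseteq> points ?X" unfolding points_def by auto
  qed
qed

text \<open>Cells are recognized by their centres; on a domain that is a union of closed cells this suffices.\<close>

definition partial_isometries :: "('c, 'p) cube_complex \<Rightarrow> ('p \<rightharpoonup> 'p) set" where
  "partial_isometries Y = {f. convex_set Y (dom f) \<and>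
     (\<forall>c\<in>cells Y. chart Y c (bary (cdim Y c)) \<in> dom f \<longrightarrow>
        (\<exists>d g. d \<in> cells Y \<and> cdim Y d = cdim Y c \<and> face_map (cdim Y c) (cdim Y c) g \<and>
           (\<forall>u\<in>cube (cdim Y c). f (chart Y c u) = Some (chart Y d (g u)))))}"

lemma partial_isometriesI:
  assumes "convex_set Y (dom f)" and "\<And>c. c \<in> cells Y \<Longrightarrow> chart Y c (bary (cdim Y c)) \<in> dom f \<Longrightarrow>
    \<exists>d g. d \<in> cells Y \<and> cdim Y d = cdim Y c \<and> face_map (cdim Y c) (cdim Y c) g \<and>
       (\<forall>u\<in>cube (cdim Y c). f (chart Y c u) = Some (chart Y d (g u)))"
  shows "f \<in> partial_isometries Y"
  using assms unfolding partial_isometries_def by simp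

lemma partial_isometriesD:
  assumes "f \<in> partial_isometries Y"
  shows "convex_set Y (dom f)"
    and "\<And>c u. c \<in> cells Y \<Longrightarrow> u \<in> open_cube (cdim Y c) \<Longrightarrow> chart Y c u \<in> dom f \<Longrightarrow>
    \<exists>d g. d \<in> cells Y \<and> cdim Y d = cdim Y c \<and> face_map (cdim Y c) (cdim Y c) g \<and>
       (\<forall>u\<in>cube (cdim Y c). f (chart Y c u) = Some (chart Y d (g u)))"
proof -
  show cv: "convex_set Y (dom f)" using assms unfolding partial_isometries_def by simp
  fix c u assume "c \<in> cells Y" "u \<in> open_cube (cdim Y c)" "chart Y c u \<in> dom f"
  moreover from this have "chart Y c (bary (cdim Y c)) \<in> dom f"
    using convex_setD(2)[OF cv] open_cube_sub[OF bary_open] by blast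
  ultimately show "\<exists>d g. d \<in> cells Y \<and> cdim Y d = cdim Y c \<and> face_map (cdim Y c) (cdim Y c) g \<and>
       (\<forall>u\<in>cube (cdim Y c). f (chart Y c u) = Some (chart Y d (g u)))"
    using assms unfolding partial_isometries_def by simp
qed

lemma edge_points_face_map:
  assumes g: "face_map n n g" and v: "v \<in> cube_vertices n"
  shows "(\<lambda>i. g (v(i := v i / 2))) ` {..<n} = (\<lambda>j. (g v)(j := g v j / 2)) ` {..<n}"
proof -
  obtain \<pi> \<epsilon> where 1: "inj_on \<pi> {..<n}" "\<pi> ` {..<n} = {..<n}" "\<And>i. i < n \<Longrightarrow> \<epsilon> i \<in> {-1, 1::real}"
    "\<And>u i. u \<in> cube n \<Longrightarrow> i < n \<Longrightarrow> g u (\<pi> i) = \<epsilon> i * u i"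
    by (rule self_face_map[OF g]) blast
  have vc: "v \<in> cube n" using v vertex_in_cube by blast
  have "g (v(i := v i / 2)) = (g v)(\<pi> i := g v (\<pi> i) / 2)" if i: "i < n" for i
  proof -
    have c: "v(i := v i / 2) \<in> cube n" by (rule edge_point_cube[OF i v])
    have pn: "\<pi> k < n" if "k < n" for k using 1(2) that by auto
    show ?thesis
    proof (rule cube_eqI[OF face_map_cube[OF g c]])
      show "(g v)(\<pi> i := g v (\<pi> i) / 2) \<in> cube n"
        by (rule edge_point_cube[OF pn[OF i] face_map_vertex[OF g v]])
      fix j assume "j < n"
      then obtain k where k: "k < n" "j = \<pi> k" using 1(2) by (metis imageE lessThan_iff)
      have "\<pi> k = \<pi> i \<longleftrightarrow> k = i" using 1(1) k i by (auto dest: inj_onD)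
      then show "g (v(i := v i / 2)) j = ((g v)(\<pi> i := g v (\<pi> i) / 2)) j"
        using 1(4)[OF c k(1)] 1(4)[OF vc k(1)] k(2) by auto
    qed
  qed
  then have "(\<lambda>i. g (v(i := v i / 2))) ` {..<n} = (\<lambda>i. (g v)(\<pi> i := g v (\<pi> i) / 2)) ` {..<n}"
    by (intro image_cong) auto
  also have "\<dots> = (\<lambda>j. (g v)(j := g v j / 2)) ` \<pi> ` {..<n}" by (simp add: image_image)
  finally show ?thesis using 1(2) by simp
qed

lemma corner_edges_image: "corner_edges Y (c, v) = (\<lambda>i. chart Y c (v(i := v i / 2))) ` {..<cdim Y c}"
  unfolding corner_edges_def by auto

text \<open>Maps that are isometries on a closed cube take the half points of edges at a corner to half points
  of edges, since they permute coordinates up to sign.\<close>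

lemma corner_edges_cell_map:
  assumes "cdim Z d = cdim X c" "face_map (cdim X c) (cdim X c) g" "v \<in> cube_vertices (cdim X c)"
    "\<And>u. u \<in> cube (cdim X c) \<Longrightarrow> f (chart X c u) = chart Z d (g u)"
  shows "corner_edges Z (d, g v) = f ` corner_edges X (c, v)"
proof -
  have "f ` corner_edges X (c, v) = chart Z d ` (\<lambda>i. g (v(i := v i / 2))) ` {..<cdim X c}"
    unfolding corner_edges_image image_image
    by (intro image_cong refl) (simp add: assms(4) edge_point_cube[OF _ assms(3)])
  also have "\<dots> = corner_edges Z (d, g v)"
    unfolding edge_points_face_map[OF assms(2,3)] corner_edges_image assms(1) by (simp add: image_image)
  finally show ?thesis by simp
qed

lemma corner_map:
  assumes "(c, v) \<in> corners X" "cdim Z d = cdim X c" "face_map (cdim X c) (cdim X c) g" "d \<in> cells Z"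
  shows "(d, g v) \<in> corners Z"
  using assms face_map_vertex[OF assms(3)] unfolding corners_def by auto

text \<open>The domain of \<open>f \<circ>\<^sub>m h\<close> is locally convex: if it contains all edges at a corner, then \<open>h\<close> is defined
  on the cube and takes it to a cube with all edges at a corner in the domain of \<open>f\<close>.\<close>

lemma partial_isometries_comp:
  assumes f: "f \<in> partial_isometries Y" and h: "h \<in> partial_isometries Y"
  shows "f \<circ>\<^sub>m h \<in> partial_isometries Y"
proof (rule partial_isometriesI)
  note cf = partial_isometriesD(1)[OF f] and ch = partial_isometriesD(1)[OF h]
  have dm: "p \<in> dom (f \<circ>\<^sub>m h) \<longleftrightarrow> (\<exists>q. h p = Some q \<and> q \<in> dom f)" for p
    by (auto simp: map_comp_def split: option.splits)
  have cell: "\<exists>d g. d \<in> cells Y \<and> cdim Y d = cdim Y c \<and> face_map (cdim Y c) (cdim Y c) g \<and>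
       (\<forall>w\<in>cube (cdim Y c). h (chart Y c w) = Some (chart Y d (g w))) \<and>
       (\<forall>w\<in>cube (cdim Y c). chart Y d w \<in> dom f)"
    if c: "c \<in> cells Y" and u: "u \<in> open_cube (cdim Y c)" and p: "chart Y c u \<in> dom (f \<circ>\<^sub>m h)" for c u
  proof -
    have "chart Y c u \<in> dom h" using p dm by auto
    then obtain d g where d: "d \<in> cells Y" "cdim Y d = cdim Y c" "face_map (cdim Y c) (cdim Y c) g"
       "\<And>u. u\<in>cube (cdim Y c) \<Longrightarrow> h (chart Y c u) = Some (chart Y d (g u))"
      using partial_isometriesD(2)[OF h c u] by blast
    have "chart Y d (g u) \<in> dom f" using p dm[of "chart Y c u"] d(4)[OF open_cube_sub[OF u]] by auto
    then have "\<forall>w\<in>cube (cdim Y c). chart Y d w \<in> dom f"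
      using convex_setD(2)[OF cf d(1)] face_map_self_open[OF d(3) u] d(2) by metis
    then show ?thesis using d by blast
  qed
  show "convex_set Y (dom (f \<circ>\<^sub>m h))"
    unfolding convex_set_def
  proof (intro conjI ballI impI)
    show "dom (f \<circ>\<^sub>m h) \<subseteq> points Y" using convex_setD(1)[OF ch] dm by blast
    fix c u assume "c \<in> cells Y" "u \<in> open_cube (cdim Y c)" "chart Y c u \<in> dom (f \<circ>\<^sub>m h)"
    then obtain d g where "cdim Y d = cdim Y c" "face_map (cdim Y c) (cdim Y c) g"
       "\<And>w. w \<in> cube (cdim Y c) \<Longrightarrow> h (chart Y c w) = Some (chart Y d (g w))"
       "\<And>w. w \<in> cube (cdim Y c) \<Longrightarrow> chart Y d w \<in> dom f" using cell by metis
    then show "chart Y c ` cube (cdim Y c) \<subseteq> dom (f \<circ>\<^sub>m h)" using dm face_map_cube by blast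
  next
    fix \<sigma> assume s: "\<sigma> \<in> corners Y" "corner_edges Y \<sigma> \<subseteq> dom (f \<circ>\<^sub>m h)"
    obtain c v where [simp]: "\<sigma> = (c, v)" by fastforce
    have c: "c \<in> cells Y" and v: "v \<in> cube_vertices (cdim Y c)" using s unfolding corners_def by auto
    have "corner_edges Y \<sigma> \<subseteq> dom h" using s(2) dm by blast
    then have "chart Y c (bary (cdim Y c)) \<in> dom h"
      using convex_setD(3)[OF ch, of c v] s open_cube_sub[OF bary_open] by auto
    then obtain d g where d: "d \<in> cells Y" "cdim Y d = cdim Y c" "face_map (cdim Y c) (cdim Y c) g"
       "\<And>u. u \<in> cube (cdim Y c) \<Longrightarrow> h (chart Y c u) = Some (chart Y d (g u))"
      using partial_isometriesD(2)[OF h c bary_open] by blast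
    have "corner_edges Y (d, g v) = (\<lambda>p. the (h p)) ` corner_edges Y (c, v)"
      by (rule corner_edges_cell_map[OF d(2,3) v]) (simp add: d(4))
    moreover have "the (h p) \<in> dom f" if "p \<in> corner_edges Y (c, v)" for p
    proof -
      have "p \<in> dom (f \<circ>\<^sub>m h)" using s(2) that by auto
      then show ?thesis using dm[of p] by auto
    qed
    ultimately have "corner_edges Y (d, g v) \<subseteq> dom f" by auto
    then have "chart Y d w \<in> dom f" if "w \<in> cube (cdim Y c)" for w
      using convex_setD(3)[OF cf corner_map[OF _ d(2,3,1)]] s that d(2) by auto
    then have "chart Y c w \<in> dom (f \<circ>\<^sub>m h)" if "w \<in> cube (cdim Y c)" for w
      using dm d(4)[OF that] face_map_cube[OF d(3) that] by blast
    then show "chart Y (fst \<sigma>) ` cube (cdim Y (fst \<sigma>)) \<subseteq> dom (f \<circ>\<^sub>m h)"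
      by (simp add: image_subset_iff)
  qed
  fix c assume c: "c \<in> cells Y" "chart Y c (bary (cdim Y c)) \<in> dom (f \<circ>\<^sub>m h)"
  obtain d g where d: "d \<in> cells Y" "cdim Y d = cdim Y c" "face_map (cdim Y c) (cdim Y c) g"
    "\<And>w. w \<in> cube (cdim Y c) \<Longrightarrow> h (chart Y c w) = Some (chart Y d (g w))"
    "\<And>w. w \<in> cube (cdim Y c) \<Longrightarrow> chart Y d w \<in> dom f"
    using cell[OF c(1) bary_open c(2)] by metis
  obtain e g' where e: "e \<in> cells Y" "cdim Y e = cdim Y d" "face_map (cdim Y d) (cdim Y d) g'"
    "\<And>w. w \<in> cube (cdim Y d) \<Longrightarrow> f (chart Y d w) = Some (chart Y e (g' w))"
    using partial_isometriesD(2)[OF f d(1) bary_open] d(5)[OF open_cube_sub[OF bary_open]] d(2) by metis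
  show "\<exists>d g. d \<in> cells Y \<and> cdim Y d = cdim Y c \<and> face_map (cdim Y c) (cdim Y c) g \<and>
       (\<forall>u\<in>cube (cdim Y c). (f \<circ>\<^sub>m h) (chart Y c u) = Some (chart Y d (g u)))"
  proof (intro exI conjI ballI)
    show "e \<in> cells Y" "cdim Y e = cdim Y c" using e d by auto
    show "face_map (cdim Y c) (cdim Y c) (\<lambda>u. g' (g u))" using face_map_comp d(3) e(3) d(2) by metis
    fix u assume "u \<in> cube (cdim Y c)"
    then show "(f \<circ>\<^sub>m h) (chart Y c u) = Some (chart Y e (g' (g u)))"
      using d(2,4) e(4) face_map_cube[OF d(3)] by (simp add: map_comp_def)
  qed
qed

lemma partial_isometries_id:
  assumes "convex_set Y D" shows "Some |` D \<in> partial_isometries Y"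
proof (rule partial_isometriesI)
  have [simp]: "dom (Some |` D) = D" by (auto simp: restrict_map_def split: if_splits)
  show "convex_set Y (dom (Some |` D))" using assms by simp
  fix c assume c: "c \<in> cells Y" "chart Y c (bary (cdim Y c)) \<in> dom (Some |` D)"
  then have "chart Y c (bary (cdim Y c)) \<in> D" by simp
  then have "\<forall>u\<in>cube (cdim Y c). (Some |` D) (chart Y c u) = Some (chart Y c u)"
    using convex_setD(2)[OF assms c(1) bary_open] by (simp add: restrict_map_def)
  then show "\<exists>d g. d \<in> cells Y \<and> cdim Y d = cdim Y c \<and> face_map (cdim Y c) (cdim Y c) g \<and>
       (\<forall>u\<in>cube (cdim Y c). (Some |` D) (chart Y c u) = Some (chart Y d (g u)))"
    using c(1) face_map_id by blast
qed

lemma finite_self_face_maps: "finite {restrict g (cube n) | g. face_map n n g}"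
proof -
  let ?P = "Pi\<^sub>E {..<n} (\<lambda>_. {..<n}) \<times> Pi\<^sub>E {..<n} (\<lambda>_. {-1, 1::real})"
  let ?G = "\<lambda>(\<pi>, \<epsilon>). restrict (\<lambda>u j. if j < n then \<epsilon> (\<pi> j) * u (\<pi> j) else undefined) (cube n)"
  have "{restrict g (cube n) | g. face_map n n g} \<subseteq> ?G ` ?P"
  proof
    fix r assume "r \<in> {restrict g (cube n) | g. face_map n n g}"
    then obtain g where g: "face_map n n g" "r = restrict g (cube n)" by blast
    obtain \<pi> \<epsilon> where 1: "inj_on \<pi> {..<n}" "\<pi> ` {..<n} = {..<n}" "\<And>i. i < n \<Longrightarrow> \<epsilon> i \<in> {-1, 1::real}"
      "\<And>u i. u \<in> cube n \<Longrightarrow> i < n \<Longrightarrow> g u (\<pi> i) = \<epsilon> i * u i"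
      by (rule self_face_map[OF g(1)]) blast
    let ?\<rho> = "restrict (inv_into {..<n} \<pi>) {..<n}"
    have inv: "?\<rho> j < n \<and> \<pi> (?\<rho> j) = j" if "j < n" for j
      using that 1(2) inv_into_into[of j \<pi> "{..<n}"] f_inv_into_f[of j \<pi> "{..<n}"] by auto
    have "g u j = (if j < n then restrict \<epsilon> {..<n} (?\<rho> j) * u (?\<rho> j) else undefined)" if u: "u \<in> cube n" for u j
    proof (cases "j < n")
      case True
      then show ?thesis using 1(4)[OF u, of "?\<rho> j"] inv[OF True] by auto
    next
      case False then show ?thesis using face_map_cube[OF g(1) u] by (auto simp: cube_iff)
    qed
    then have "r = ?G (?\<rho>, restrict \<epsilon> {..<n})"
      unfolding g(2) by (intro ext) (simp add: restrict_def)
    moreover have "(?\<rho>, restrict \<epsilon> {..<n}) \<in> ?P" using inv 1(3) by auto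
    ultimately show "r \<in> ?G ` ?P" by blast
  qed
  moreover have "finite ?P" by (intro finite_cartesian_product finite_PiE) auto
  ultimately show ?thesis using finite_surj by blast
qed

text \<open>A partial isometry is determined by the target cell and the symmetry of the cube for each cell in
  its domain.\<close>

lemma finite_partial_isometries:
  assumes Y: "cube_complex Y" and fin: "finite (cells Y)"
  shows "finite (partial_isometries Y)"
proof -
  let ?M = "\<lambda>n. {restrict g (cube n) | g. face_map n n g}"
  let ?good = "\<lambda>f c x. x \<in> cells Y \<times> ?M (cdim Y c) \<and>
     (\<forall>u\<in>cube (cdim Y c). f (chart Y c u) = Some (chart Y (fst x) (snd x u)))"
  define code where "code f = restrict (\<lambda>c. if chart Y c (bary (cdim Y c)) \<in> dom f then Some (SOME x. ?good f c x) else None) (cells Y)"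
    for f :: "'b \<rightharpoonup> 'b"
  have good: "?good f c (SOME x. ?good f c x)"
    if fc: "f \<in> partial_isometries Y" "c \<in> cells Y" "chart Y c (bary (cdim Y c)) \<in> dom f" for f c
  proof -
    obtain d g where d: "d \<in> cells Y" "face_map (cdim Y c) (cdim Y c) g"
       "\<forall>u\<in>cube (cdim Y c). f (chart Y c u) = Some (chart Y d (g u))"
      using partial_isometriesD(2)[OF fc(1,2) bary_open fc(3)] by blast
    then have "?good f c (d, restrict g (cube (cdim Y c)))" by auto
    then show ?thesis by (rule someI)
  qed
  have "code ` partial_isometries Y \<subseteq> Pi\<^sub>E (cells Y) (\<lambda>c. insert None (Some ` (cells Y \<times> ?M (cdim Y c))))"
    using good unfolding code_def by (intro image_subsetI) (auto simp: PiE_iff)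
  moreover have "finite (Pi\<^sub>E (cells Y) (\<lambda>c. insert None (Some ` (cells Y \<times> ?M (cdim Y c)))))"
    using fin finite_self_face_maps by (intro finite_PiE) auto
  ultimately have "finite (code ` partial_isometries Y)" by (rule finite_subset)
  moreover have "inj_on code (partial_isometries Y)"
  proof (rule inj_onI)
    fix f h assume fh: "f \<in> partial_isometries Y" "h \<in> partial_isometries Y" "code f = code h"
    have sub: "h p = f p" if f: "f \<in> partial_isometries Y" and h: "h \<in> partial_isometries Y" and eq: "code f = code h"
        and p: "p \<in> dom f" for f h p
    proof -
      have "p \<in> points Y" using p convex_setD(1)[OF partial_isometriesD(1)[OF f]] by blast
      then obtain c u where c: "c \<in> cells Y" "u \<in> open_cube (cdim Y c)" "p = chart Y c u"
        by (rule points_open[OF Y])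
      have bf: "chart Y c (bary (cdim Y c)) \<in> dom f"
        using convex_setD(2)[OF partial_isometriesD(1)[OF f] c(1,2)] p c(3) open_cube_sub[OF bary_open] by blast
      then have cf: "code f c = Some (SOME x. ?good f c x)" using c(1) by (simp add: code_def)
      then have "code h c \<noteq> None" using eq by simp
      have bh: "chart Y c (bary (cdim Y c)) \<in> dom h"
      proof (rule ccontr)
        assume "chart Y c (bary (cdim Y c)) \<notin> dom h"
        then have "code h c = None" using c(1) by (simp add: code_def)
        then show False using \<open>code h c \<noteq> None\<close> by simp
      qed
      then have "code h c = Some (SOME x. ?good h c x)" using c(1) by (simp add: code_def)
      then have "(SOME x. ?good f c x) = (SOME x. ?good h c x)" using cf eq by simp
      then obtain x where x: "(SOME x. ?good f c x) = x" "(SOME x. ?good h c x) = x" by metis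
      have "\<forall>u\<in>cube (cdim Y c). f (chart Y c u) = Some (chart Y (fst x) (snd x u))"
        using good[OF f c(1) bf] unfolding x(1) by (elim conjE)
      from bspec[OF this open_cube_sub[OF c(2)]]
      have "f p = Some (chart Y (fst x) (snd x u))" unfolding c(3) .
      moreover have "\<forall>u\<in>cube (cdim Y c). h (chart Y c u) = Some (chart Y (fst x) (snd x u))"
        using good[OF h c(1) bh] unfolding x(2) by (elim conjE)
      from bspec[OF this open_cube_sub[OF c(2)]]
      have "h p = Some (chart Y (fst x) (snd x u))" unfolding c(3) .
      ultimately show ?thesis by (simp only:)
    qed
    show "f = h"
    proof
      fix p show "f p = h p"
        using sub[OF fh(1,2,3), of p] sub[OF fh(2,1) fh(3)[symmetric], of p] by (cases "f p"; cases "h p") auto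
    qed
  qed
  ultimately show ?thesis by (rule finite_imageD)
qed

text \<open>Local convexity of the image is what makes the inverse a partial isometry.\<close>

lemma partial_local_isometry_maps:
  assumes Y: "cube_complex Y" and S: "partial_local_isometry Y S \<phi>" "inj_on \<phi> (points (subcomplex_on Y S))"
  obtains j j' where "j \<in> partial_isometries Y" "j' \<in> partial_isometries Y"
    "\<And>p q. j p = Some q \<longleftrightarrow> j' q = Some p" "\<And>p. p \<in> points (subcomplex_on Y S) \<Longrightarrow> j p = Some (\<phi> p)"
proof -
  let ?X = "subcomplex_on Y S"
  have [simp]: "cells ?X = S" "cdim ?X = cdim Y" "chart ?X = chart Y" unfolding subcomplex_on_def by auto
  obtain T where T: "points (subcomplex_on Y T) = \<phi> ` points ?X" "locally_convex Y T"
    and sub: "is_subcomplex Y S" and lS: "locally_convex Y S" and loc: "local_isometry \<phi> ?X Y"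
    using S(1) unfolding partial_local_isometry_def by blast
  have SX: "S \<subseteq> cells Y" and X: "cube_complex ?X" using sub unfolding is_subcomplex_def by auto
  have cS: "convex_set Y (points ?X)" by (rule convex_set_subcomplex[OF Y lS])
  have cT: "convex_set Y (\<phi> ` points ?X)" using convex_set_subcomplex[OF Y T(2)] T(1) by simp
  have cell: "\<exists>d g. cell_to_cell \<phi> ?X c Y d g" if c: "c \<in> S" for c
  proof -
    have "combinatorial_map \<phi> ?X Y" using loc unfolding local_isometry_def by blast
    then obtain d g where "continuous_map (cc_topology ?X) (cc_topology Y) \<phi>" "d \<in> cells Y" "carries_cell \<phi> ?X c Y d g"
      using c unfolding combinatorial_map_def by auto
    then show ?thesis using carries_cell_closed[OF X Y, of \<phi> c d g] c by auto
  qed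
  have inS: "c \<in> S" if "c \<in> cells Y" "u \<in> open_cube (cdim Y c)" "chart Y c u \<in> points ?X" for c u
  proof -
    note cu = that
    obtain s w where s: "s \<in> cells ?X" "w \<in> open_cube (cdim ?X s)" "chart Y c u = chart ?X s w"
      by (rule points_open[OF X cu(3)])
    have "s \<in> cells Y" "w \<in> open_cube (cdim Y s)" "chart Y c u = chart Y s w" using s SX by auto
    then have "c = s" by (rule open_inj(1)[OF Y cu(1) _ cu(2)])
    then show ?thesis using s(1) by simp
  qed
  define j where "j p = (if p \<in> points ?X then Some (\<phi> p) else None)" for p
  define j' where "j' q = (if q \<in> \<phi> ` points ?X then Some (inv_into (points ?X) \<phi> q) else None)" for q
  have "dom j = points ?X" "dom j' = \<phi> ` points ?X" by (auto simp: j_def j'_def dom_def split: if_splits)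
  have jj: "j p = Some q \<longleftrightarrow> j' q = Some p" for p q
    using S(2) by (auto simp: j_def j'_def f_inv_into_f inv_into_into inj_on_eq_iff split: if_splits)
  show ?thesis
  proof (rule that[OF _ _ jj])
    show "j \<in> partial_isometries Y"
    proof (rule partial_isometriesI)
      show "convex_set Y (dom j)" using cS \<open>dom j = points ?X\<close> by simp
      fix c assume c: "c \<in> cells Y" "chart Y c (bary (cdim Y c)) \<in> dom j"
      then have cs: "c \<in> S" using inS[OF c(1) bary_open] \<open>dom j = points ?X\<close> by simp
      then obtain d g where "cell_to_cell \<phi> ?X c Y d g" using cell by blast
      moreover have "chart Y c u \<in> points ?X" if "u \<in> cube (cdim Y c)" for u
        using chart_points[of c ?X u] cs that by simp
      ultimately show "\<exists>d g. d \<in> cells Y \<and> cdim Y d = cdim Y c \<and> face_map (cdim Y c) (cdim Y c) g \<and>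
          (\<forall>u\<in>cube (cdim Y c). j (chart Y c u) = Some (chart Y d (g u)))"
        unfolding cell_to_cell_def j_def by auto
    qed
    show "j' \<in> partial_isometries Y"
    proof (rule partial_isometriesI)
      show "convex_set Y (dom j')" using cT \<open>dom j' = \<phi> ` points ?X\<close> by simp
      fix d assume d: "d \<in> cells Y" "chart Y d (bary (cdim Y d)) \<in> dom j'"
      then obtain p where p: "p \<in> points ?X" "chart Y d (bary (cdim Y d)) = \<phi> p" using \<open>dom j' = \<phi> ` points ?X\<close> by auto
      obtain c u where c: "c \<in> S" "u \<in> open_cube (cdim Y c)" "p = chart Y c u"
        using points_open[OF X p(1)] by (metis \<open>cdim ?X = cdim Y\<close> \<open>cells ?X = S\<close> \<open>chart ?X = chart Y\<close>)
      obtain e g where e: "e \<in> cells Y" "cdim Y e = cdim Y c" "face_map (cdim Y c) (cdim Y c) g"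
        "\<And>u. u \<in> cube (cdim Y c) \<Longrightarrow> \<phi> (chart Y c u) = chart Y e (g u)"
        using cell[OF c(1)] unfolding cell_to_cell_def by auto
      have "chart Y d (bary (cdim Y d)) = chart Y e (g u)" using p c e(4) open_cube_sub by metis
      then have [simp]: "e = d"
        using bary_inj[OF Y d(1) e(1)] face_map_self_open[OF e(3) c(2)] e(2) by auto
      obtain h where h: "face_map (cdim Y c) (cdim Y c) h" "\<And>u. u \<in> cube (cdim Y c) \<Longrightarrow> g (h u) = u"
        by (rule face_map_inverse[OF e(3)]) blast
      have "j' (chart Y d w) = Some (chart Y c (h w))" if w: "w \<in> cube (cdim Y d)" for w
      proof -
        have hw: "h w \<in> cube (cdim Y c)" using face_map_cube[OF h(1)] w e(2) by simp
        have "j (chart Y c (h w)) = Some (chart Y d w)"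
          using chart_points[of c ?X "h w"] c(1) hw e(2) e(4)[OF hw] h(2)[of w] w by (simp add: j_def)
        then show ?thesis using jj by blast
      qed
      then show "\<exists>c g. c \<in> cells Y \<and> cdim Y c = cdim Y d \<and> face_map (cdim Y d) (cdim Y d) g \<and>
          (\<forall>u\<in>cube (cdim Y d). j' (chart Y d u) = Some (chart Y c (g u)))"
        using c(1) SX e(2) h(1) by auto
    qed
  qed (simp add: j_def)
qed

section \<open>Permutations extending partial maps\<close>

text \<open>Weights are chosen by recursion from large rank downwards. At each element the prescribed total
  exceeds the part already distributed among the elements above, because each of the at most
  \<open>card \<Omega>\<close> weights above is at most \<open>(card \<Omega> + 1) ^ (N - r u - 1)\<close>.\<close>

lemma finite_downward_weights:
  fixes above :: "'a \<Rightarrow> 'a set" and r :: "'a \<Rightarrow> nat" and N :: nat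
  assumes fin: "finite \<Omega>" and sub: "\<And>u. u \<in> \<Omega> \<Longrightarrow> above u \<subseteq> \<Omega>"
    and r: "\<And>u f. u \<in> \<Omega> \<Longrightarrow> f \<in> above u \<Longrightarrow> r u < r f" and N: "\<And>u. u \<in> \<Omega> \<Longrightarrow> r u \<le> N"
  obtains \<mu> :: "'a \<Rightarrow> nat" where
    "\<And>u. u \<in> \<Omega> \<Longrightarrow> 0 < \<mu> u" "\<And>u. u \<in> \<Omega> \<Longrightarrow> \<mu> u + sum \<mu> (above u) = (card \<Omega> + 1) ^ (N - r u)"
proof -
  let ?C = "card \<Omega> + 1"
  have "\<exists>\<mu>::'a \<Rightarrow> nat. \<forall>u\<in>\<Omega>. N - r u < n \<longrightarrow> 0 < \<mu> u \<and> \<mu> u + sum \<mu> (above u) = ?C ^ (N - r u)" for n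
  proof (induction n)
    case 0 then show ?case by simp
  next
    case (Suc n)
    then obtain \<mu> :: "'a \<Rightarrow> nat" where \<mu>: "\<And>u. u \<in> \<Omega> \<Longrightarrow> N - r u < n \<Longrightarrow> 0 < \<mu> u \<and> \<mu> u + sum \<mu> (above u) = ?C ^ (N - r u)"
      by blast
    define \<nu> where "\<nu> u = (if N - r u < n then \<mu> u else ?C ^ (N - r u) - sum \<mu> (above u))" for u
    have lev: "N - r f < N - r u" if "u \<in> \<Omega>" "f \<in> above u" for u f
      using r[OF that] N[of f] sub[OF that(1)] that(2) by fastforce
    have "0 < \<nu> u \<and> \<nu> u + sum \<nu> (above u) = ?C ^ (N - r u)" if u: "u \<in> \<Omega>" and un: "N - r u < Suc n" for u
    proof -
      have same: "sum \<nu> (above u) = sum \<mu> (above u)"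
        by (intro sum.cong refl) (use lev[OF u] un in \<open>force simp: \<nu>_def\<close>)
      show ?thesis
      proof (cases "N - r u < n")
        case True then show ?thesis using \<mu>[OF u True] same by (simp add: \<nu>_def)
      next
        case False
        then have n: "N - r u = n" using un by simp
        have "sum \<mu> (above u) < ?C ^ n"
        proof (cases n)
          case 0
          then have "above u = {}" using lev[OF u] n by fastforce
          then show ?thesis by simp
        next
          case (Suc k)
          have "sum \<mu> (above u) \<le> (\<Sum>f\<in>above u. ?C ^ k)"
          proof (rule sum_mono)
            fix f assume f: "f \<in> above u"
            have fO: "f \<in> \<Omega>" using sub[OF u] f by blast
            have "N - r f < n" using lev[OF u f] n by simp
            then have "\<mu> f \<le> ?C ^ (N - r f)" using \<mu>[OF fO] by simp
            also have "\<dots> \<le> ?C ^ k" by (rule power_increasing) (use \<open>N - r f < n\<close> Suc in auto)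
            finally show "\<mu> f \<le> ?C ^ k" .
          qed
          also have "\<dots> = card (above u) * ?C ^ k" by simp
          also have "\<dots> \<le> card \<Omega> * ?C ^ k" using card_mono[OF fin sub[OF u]] by simp
          also have "\<dots> < ?C ^ n" using Suc by simp
          finally show ?thesis .
        qed
        then show ?thesis using same n False by (simp add: \<nu>_def)
      qed
    qed
    then show ?case by blast
  qed
  from this[of "Suc N"] obtain \<mu> :: "'a \<Rightarrow> nat" where
    "\<forall>u\<in>\<Omega>. N - r u < Suc N \<longrightarrow> 0 < \<mu> u \<and> \<mu> u + sum \<mu> (above u) = ?C ^ (N - r u)" by blast
  then show ?thesis using that[of \<mu>] by (meson diff_le_self le_imp_less_Suc)
qed

text \<open>Match the elements colour by colour; composing with a transposition inside the colour of \<open>a0\<close>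
  arranges the prescribed value there.\<close>

lemma colour_bijection:
  assumes fin: "finite A" and count: "\<And>x. card {a\<in>A. k a = x} = card {a\<in>A. l a = x}"
    and a0: "a0 \<in> A" "b0 \<in> A" "l b0 = k a0"
  obtains \<gamma> where "\<gamma> permutes A" "\<And>a. a \<in> A \<Longrightarrow> l (\<gamma> a) = k a" "\<gamma> a0 = b0"
proof -
  have "\<exists>h. bij_betw h {a\<in>A. k a = x} {a\<in>A. l a = x} \<and> (x = k a0 \<longrightarrow> h a0 = b0)" for x
  proof -
    obtain h where h: "bij_betw h {a\<in>A. k a = x} {a\<in>A. l a = x}"
      using finite_same_card_bij[OF _ _ count[of x]] fin by auto
    show ?thesis
    proof (cases "x = k a0")
      case False then show ?thesis using h by blast
    next
      case True
      let ?B = "{a\<in>A. l a = x}"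
      have b: "h a0 \<in> ?B" "b0 \<in> ?B" using h a0 True by (auto dest: bij_betwE)
      have "Transposition.transpose (h a0) b0 permutes ?B" using b by (rule permutes_swap_id)
      then have "bij_betw (Transposition.transpose (h a0) b0 \<circ> h) {a\<in>A. k a = x} ?B"
        using h by (meson bij_betw_trans permutes_imp_bij)
      then show ?thesis by (intro exI[of _ "Transposition.transpose (h a0) b0 \<circ> h"]) simp
    qed
  qed
  then obtain h where h: "\<And>x. bij_betw (h x) {a\<in>A. k a = x} {a\<in>A. l a = x}" "h (k a0) a0 = b0" by metis
  define \<gamma> where "\<gamma> a = (if a \<in> A then h (k a) a else a)" for a
  have \<gamma>: "\<gamma> a \<in> A \<and> l (\<gamma> a) = k a" if "a \<in> A" for a
    using bij_betwE[OF h(1)[of "k a"]] that by (auto simp: \<gamma>_def)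
  have "inj_on \<gamma> A"
  proof (rule inj_onI)
    fix a b assume ab: "a \<in> A" "b \<in> A" "\<gamma> a = \<gamma> b"
    then have "k a = k b" using \<gamma> by metis
    then show "a = b" using ab h(1)[of "k a"] unfolding bij_betw_def by (auto simp: \<gamma>_def dest: inj_onD)
  qed
  then have "bij_betw \<gamma> A A" using \<gamma> fin by (simp add: bij_betw_def endo_inj_surj image_subsetI)
  then have "\<gamma> permutes A" by (rule bij_imp_permutes) (simp add: \<gamma>_def)
  then show ?thesis using that \<gamma> h(2) a0 by (simp add: \<gamma>_def)
qed

definition inverse_pair :: "('p \<rightharpoonup> 'p) \<Rightarrow> ('p \<rightharpoonup> 'p) \<Rightarrow> bool" where
  "inverse_pair j j' \<longleftrightarrow> (\<forall>p q. j p = Some q \<longleftrightarrow> j' q = Some p)"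

lemma inverse_pair_comp:
  assumes "inverse_pair j j'"
  shows "j' \<circ>\<^sub>m j = Some |` dom j"
proof
  fix p show "(j' \<circ>\<^sub>m j) p = (Some |` dom j) p"
  proof (cases "j p")
    case None then show ?thesis by (simp add: map_comp_def restrict_map_def domIff)
  next
    case (Some q)
    then have "j' q = Some p" using assms unfolding inverse_pair_def by blast
    then show ?thesis using Some by (simp add: map_comp_def restrict_map_def domIff)
  qed
qed

lemma inverse_pair_sym: "inverse_pair j j' \<Longrightarrow> inverse_pair j' j"
  unfolding inverse_pair_def by blast

text \<open>The label \<open>(f, n)\<close> is the \<open>n\<close>-th repetition of \<open>f\<close>. A permutation as required exists if for every
  partial map \<open>u\<close> with domain inside \<open>dom j\<close>, as many labels restrict on \<open>dom j\<close> to \<open>u\<close> as restrict on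
  \<open>dom j'\<close> to \<open>u \<circ>\<^sub>m j'\<close>. The number of labels that extend \<open>u\<close> is made to depend only on the rank
  of \<open>u\<close>, the number of partial isometries below \<open>u\<close>, and transport by \<open>j'\<close> preserves the rank. Labels
  restricting exactly to \<open>u\<close> are those that extend \<open>u\<close> but restrict to no proper extension of \<open>u\<close>
  inside the domain, so the two counts agree by induction. The last clause follows since \<open>j'\<close> itself
  is a label whose restriction corresponds to the identity of \<open>dom j\<close>; it locates the domains of
  \<open>j\<close> and \<open>j'\<close> at the ends of an edge.\<close>

lemma permutation_extension:
  assumes fin: "finite \<Omega>" and comp: "\<And>f h. f \<in> \<Omega> \<Longrightarrow> h \<in> \<Omega> \<Longrightarrow> f \<circ>\<^sub>m h \<in> \<Omega>"
  obtains \<Theta> :: "(('p \<rightharpoonup> 'p) \<times> nat) set" where "finite \<Theta>" "\<And>f. f \<in> \<Omega> \<Longrightarrow> (f, 0) \<in> \<Theta>" "\<And>\<theta>. \<theta> \<in> \<Theta> \<Longrightarrow> fst \<theta> \<in> \<Omega>"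
    "\<And>j j'. j \<in> \<Omega> \<Longrightarrow> j' \<in> \<Omega> \<Longrightarrow> inverse_pair j j' \<Longrightarrow>
      \<exists>\<gamma>. \<gamma> permutes \<Theta> \<and> (\<forall>\<theta>\<in>\<Theta>. \<forall>p q. j p = Some q \<longrightarrow> fst (\<gamma> \<theta>) q = fst \<theta> p) \<and>
         \<gamma> (Some |` dom j, 0) = (j', 0)"
proof -
  define above where "above u = {f\<in>\<Omega>. u \<subseteq>\<^sub>m f \<and> f \<noteq> u}" for u
  define r where "r u = card {f\<in>\<Omega>. f \<subseteq>\<^sub>m u}" for u
  have r_less: "r u < r f" if "u \<in> \<Omega>" "f \<in> above u" for u f
  proof -
    have "{g\<in>\<Omega>. g \<subseteq>\<^sub>m u} \<subseteq> {g\<in>\<Omega>. g \<subseteq>\<^sub>m f}" using that by (auto simp: above_def intro: map_le_trans)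
    moreover have "f \<in> {g\<in>\<Omega>. g \<subseteq>\<^sub>m f}" "f \<notin> {g\<in>\<Omega>. g \<subseteq>\<^sub>m u}"
      using that by (auto simp: above_def dest: map_le_antisym)
    ultimately have "{g\<in>\<Omega>. g \<subseteq>\<^sub>m u} \<subset> {g\<in>\<Omega>. g \<subseteq>\<^sub>m f}" by blast
    then show ?thesis unfolding r_def using fin by (intro psubset_card_mono) auto
  qed
  obtain \<mu> :: "('p \<rightharpoonup> 'p) \<Rightarrow> nat" where \<mu>pos: "\<And>u. u \<in> \<Omega> \<Longrightarrow> 0 < \<mu> u"
    and \<mu>: "\<And>u. u \<in> \<Omega> \<Longrightarrow> \<mu> u + sum \<mu> (above u) = (card \<Omega> + 1) ^ (card \<Omega> - r u)"
  proof (rule finite_downward_weights[of \<Omega> above r "card \<Omega>"])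
    show "above u \<subseteq> \<Omega>" for u by (auto simp: above_def)
    show "r u \<le> card \<Omega>" for u unfolding r_def by (intro card_mono fin) auto
  qed (use fin r_less in auto)
  have \<mu>': "(\<Sum>f\<in>{f\<in>\<Omega>. u \<subseteq>\<^sub>m f}. \<mu> f) = (card \<Omega> + 1) ^ (card \<Omega> - r u)" if "u \<in> \<Omega>" for u
  proof -
    have "{f\<in>\<Omega>. u \<subseteq>\<^sub>m f} = insert u (above u)" "u \<notin> above u" "finite (above u)"
      using that fin by (auto simp: above_def)
    then show ?thesis using \<mu>[OF that] by simp
  qed
  define \<Theta> where "\<Theta> = Sigma \<Omega> (\<lambda>f. {..<\<mu> f})"
  have fin\<Theta>: "finite \<Theta>" unfolding \<Theta>_def using fin by simp
  have zero: "(f, 0) \<in> \<Theta>" if "f \<in> \<Omega>" for f using \<mu>pos[OF that] that by (simp add: \<Theta>_def)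
  have "\<exists>\<gamma>. \<gamma> permutes \<Theta> \<and> (\<forall>\<theta>\<in>\<Theta>. \<forall>p q. j p = Some q \<longrightarrow> fst (\<gamma> \<theta>) q = fst \<theta> p) \<and>
         \<gamma> (Some |` dom j, 0) = (j', 0)"
    if j: "j \<in> \<Omega>" "j' \<in> \<Omega>" "inverse_pair j j'" for j j'
  proof -
    have jj: "\<And>p q. j p = Some q \<longleftrightarrow> j' q = Some p" using j(3) unfolding inverse_pair_def by blast
    define S where "S i u = {f\<in>\<Omega>. f |` dom i = u}" for i u :: "'p \<rightharpoonup> 'p"
    have restr: "f |` dom i = f \<circ>\<^sub>m (i' \<circ>\<^sub>m i)" if "inverse_pair i i'" for f i i' :: "'p \<rightharpoonup> 'p"
      unfolding inverse_pair_comp[OF that] by (auto simp: map_comp_def restrict_map_def split: option.splits)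
    have restrO: "f |` dom i \<in> \<Omega>" if "f \<in> \<Omega>" "i \<in> \<Omega>" "i' \<in> \<Omega>" "inverse_pair i i'" for f i i'
      unfolding restr[OF that(4)] using comp that by blast
    \<comment> \<open>Sort the partial isometries above \<open>u\<close> by their restriction to \<open>dom i\<close>.\<close>
    have key: "sum \<mu> (S i u) + (\<Sum>w\<in>{w\<in>\<Omega>. u \<subseteq>\<^sub>m w \<and> dom w \<subseteq> dom i \<and> w \<noteq> u}. sum \<mu> (S i w))
        = (card \<Omega> + 1) ^ (card \<Omega> - r u)"
      if i: "i \<in> \<Omega>" "i' \<in> \<Omega>" "inverse_pair i i'" and u: "u \<in> \<Omega>" "dom u \<subseteq> dom i" for i i' u
    proof -
      let ?W = "{w\<in>\<Omega>. u \<subseteq>\<^sub>m w \<and> dom w \<subseteq> dom i}"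
      have "{f\<in>\<Omega>. u \<subseteq>\<^sub>m f} = (\<Union>w\<in>?W. S i w)"
      proof (intro equalityI subsetI)
        fix f assume f: "f \<in> {f\<in>\<Omega>. u \<subseteq>\<^sub>m f}"
        have "u \<subseteq>\<^sub>m f |` dom i" using f u(2) by (auto simp: map_le_def restrict_map_def)
        then have "f |` dom i \<in> ?W" using restrO[OF _ i] f by auto
        then show "f \<in> (\<Union>w\<in>?W. S i w)" using f unfolding S_def by blast
      next
        fix f assume "f \<in> (\<Union>w\<in>?W. S i w)"
        then have "f \<in> \<Omega>" "u \<subseteq>\<^sub>m f |` dom i" unfolding S_def by auto
        then show "f \<in> {f\<in>\<Omega>. u \<subseteq>\<^sub>m f}" 
          unfolding map_le_def restrict_map_def dom_def by (auto split: if_splits) (metis option.distinct(1))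
      qed
      then have "(\<Sum>f\<in>{f\<in>\<Omega>. u \<subseteq>\<^sub>m f}. \<mu> f) = (\<Sum>w\<in>?W. sum \<mu> (S i w))"
        using fin by (simp only:) (intro sum.UNION_disjoint, auto simp: S_def)
      moreover have "?W = insert u {w\<in>\<Omega>. u \<subseteq>\<^sub>m w \<and> dom w \<subseteq> dom i \<and> w \<noteq> u}" using u by auto
      ultimately show ?thesis using \<mu>'[OF u(1)] fin by simp
    qed
    \<comment> \<open>Composition with \<open>j'\<close> is an isomorphism of orders from the partial maps inside \<open>dom j\<close> to those inside \<open>dom j'\<close>.\<close>
    have trans_le: "u \<circ>\<^sub>m j' \<subseteq>\<^sub>m w \<circ>\<^sub>m j' \<longleftrightarrow> u \<subseteq>\<^sub>m w" if du: "dom u \<subseteq> dom j" for u w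
    proof
      assume L: "u \<circ>\<^sub>m j' \<subseteq>\<^sub>m w \<circ>\<^sub>m j'"
      show "u \<subseteq>\<^sub>m w"
        unfolding map_le_def
      proof
        fix p assume p: "p \<in> dom u"
        then obtain q where q: "j p = Some q" using du by blast
        then have "j' q = Some p" using jj by blast
        then have "(u \<circ>\<^sub>m j') q = u p" "(w \<circ>\<^sub>m j') q = w p" by (auto simp: map_comp_def)
        moreover have "q \<in> dom (u \<circ>\<^sub>m j')" using p calculation by auto
        ultimately show "u p = w p" using L unfolding map_le_def by metis
      qed
    next
      assume "u \<subseteq>\<^sub>m w" then show "u \<circ>\<^sub>m j' \<subseteq>\<^sub>m w \<circ>\<^sub>m j'"
        by (auto simp: map_le_def map_comp_def dom_def split: option.splits)
    qed
    have retract: "(u \<circ>\<^sub>m j') \<circ>\<^sub>m j = u" if "dom u \<subseteq> dom j" for u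
    proof
      fix p show "((u \<circ>\<^sub>m j') \<circ>\<^sub>m j) p = u p"
        proof (cases "j p")
        case None
        then have "u p = None" using that by blast
        then show ?thesis using None by (simp add: map_comp_def)
      next
        case (Some q)
        then have "j' q = Some p" using jj by blast
        then show ?thesis using Some by (simp add: map_comp_def)
      qed
    qed
    have forth: "(w \<circ>\<^sub>m j) \<circ>\<^sub>m j' = w" if "dom w \<subseteq> dom j'" for w
    proof
      fix q show "((w \<circ>\<^sub>m j) \<circ>\<^sub>m j') q = w q"
        proof (cases "j' q")
        case None
        then have "w q = None" using that by blast
        then show ?thesis using None by (simp add: map_comp_def)
      next
        case (Some p)
        then have "j p = Some q" using jj by blast
        then show ?thesis using Some by (simp add: map_comp_def)
      qed
    qed
    have domj': "dom (u \<circ>\<^sub>m j') \<subseteq> dom j'" "dom (u \<circ>\<^sub>m j) \<subseteq> dom j" for u :: "'p \<rightharpoonup> 'p"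
      by (auto simp: map_comp_def dom_def split: option.splits)
    have above_bij: "bij_betw (\<lambda>w. w \<circ>\<^sub>m j') {w\<in>\<Omega>. u \<subseteq>\<^sub>m w \<and> dom w \<subseteq> dom j \<and> w \<noteq> u}
        {w\<in>\<Omega>. u \<circ>\<^sub>m j' \<subseteq>\<^sub>m w \<and> dom w \<subseteq> dom j' \<and> w \<noteq> u \<circ>\<^sub>m j'}" if u: "dom u \<subseteq> dom j" for u
    proof (rule bij_betwI[where g = "\<lambda>w. w \<circ>\<^sub>m j"])
      show "(\<lambda>w. w \<circ>\<^sub>m j') \<in> {w\<in>\<Omega>. u \<subseteq>\<^sub>m w \<and> dom w \<subseteq> dom j \<and> w \<noteq> u} \<rightarrow>
          {w\<in>\<Omega>. u \<circ>\<^sub>m j' \<subseteq>\<^sub>m w \<and> dom w \<subseteq> dom j' \<and> w \<noteq> u \<circ>\<^sub>m j'}"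
      proof
        fix w assume w: "w \<in> {w\<in>\<Omega>. u \<subseteq>\<^sub>m w \<and> dom w \<subseteq> dom j \<and> w \<noteq> u}"
        then have "(w \<circ>\<^sub>m j') \<circ>\<^sub>m j = w" "(u \<circ>\<^sub>m j') \<circ>\<^sub>m j = u" using retract u by blast+
        then have "w \<circ>\<^sub>m j' \<noteq> u \<circ>\<^sub>m j'" using w by auto
        moreover have "u \<circ>\<^sub>m j' \<subseteq>\<^sub>m w \<circ>\<^sub>m j'" using trans_le[OF u, of w] w by blast
        ultimately show "w \<circ>\<^sub>m j' \<in> {w\<in>\<Omega>. u \<circ>\<^sub>m j' \<subseteq>\<^sub>m w \<and> dom w \<subseteq> dom j' \<and> w \<noteq> u \<circ>\<^sub>m j'}"
          using comp[OF _ j(2)] domj' w by blast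
      qed
      show "(\<lambda>w. w \<circ>\<^sub>m j) \<in> {w\<in>\<Omega>. u \<circ>\<^sub>m j' \<subseteq>\<^sub>m w \<and> dom w \<subseteq> dom j' \<and> w \<noteq> u \<circ>\<^sub>m j'} \<rightarrow>
          {w\<in>\<Omega>. u \<subseteq>\<^sub>m w \<and> dom w \<subseteq> dom j \<and> w \<noteq> u}"
      proof
        fix w assume w: "w \<in> {w\<in>\<Omega>. u \<circ>\<^sub>m j' \<subseteq>\<^sub>m w \<and> dom w \<subseteq> dom j' \<and> w \<noteq> u \<circ>\<^sub>m j'}"
        then have f: "(w \<circ>\<^sub>m j) \<circ>\<^sub>m j' = w" using forth by blast
        have "u \<subseteq>\<^sub>m w \<circ>\<^sub>m j" using trans_le[OF u, of "w \<circ>\<^sub>m j"] f w by simp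
        moreover have "w \<circ>\<^sub>m j \<noteq> u" using f w by auto
        ultimately show "w \<circ>\<^sub>m j \<in> {w\<in>\<Omega>. u \<subseteq>\<^sub>m w \<and> dom w \<subseteq> dom j \<and> w \<noteq> u}"
          using comp[OF _ j(1)] domj' w by blast
      qed
    qed (use retract forth in auto)
    have r_inv: "r (u \<circ>\<^sub>m j') = r u" if u: "dom u \<subseteq> dom j" for u
    proof -
      have "bij_betw (\<lambda>w. w \<circ>\<^sub>m j') {f\<in>\<Omega>. f \<subseteq>\<^sub>m u} {f\<in>\<Omega>. f \<subseteq>\<^sub>m u \<circ>\<^sub>m j'}"
      proof (rule bij_betwI[where g = "\<lambda>w. w \<circ>\<^sub>m j"])
        have d: "dom f \<subseteq> dom j" if "f \<subseteq>\<^sub>m u" for f using map_le_implies_dom_le[OF that] u by blast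
        have d': "dom f \<subseteq> dom j'" if "f \<subseteq>\<^sub>m u \<circ>\<^sub>m j'" for f
          using map_le_implies_dom_le[OF that] domj'(1)[of u] by blast
        show "(\<lambda>w. w \<circ>\<^sub>m j') \<in> {f\<in>\<Omega>. f \<subseteq>\<^sub>m u} \<rightarrow> {f\<in>\<Omega>. f \<subseteq>\<^sub>m u \<circ>\<^sub>m j'}"
          using comp[OF _ j(2)] trans_le d by blast
        show "(\<lambda>w. w \<circ>\<^sub>m j) \<in> {f\<in>\<Omega>. f \<subseteq>\<^sub>m u \<circ>\<^sub>m j'} \<rightarrow> {f\<in>\<Omega>. f \<subseteq>\<^sub>m u}"
        proof
          fix f assume f: "f \<in> {f\<in>\<Omega>. f \<subseteq>\<^sub>m u \<circ>\<^sub>m j'}"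
          then have "(f \<circ>\<^sub>m j) \<circ>\<^sub>m j' = f" using forth[of f] d'[of f] by blast
          then have "(f \<circ>\<^sub>m j) \<circ>\<^sub>m j' \<subseteq>\<^sub>m u \<circ>\<^sub>m j'" using f by simp
          then have "f \<circ>\<^sub>m j \<subseteq>\<^sub>m u" using trans_le[OF domj'(2)] by blast
          then show "f \<circ>\<^sub>m j \<in> {f\<in>\<Omega>. f \<subseteq>\<^sub>m u}" using f comp[OF _ j(1)] by blast
        qed
        show "(w \<circ>\<^sub>m j') \<circ>\<^sub>m j = w" if "w \<in> {f\<in>\<Omega>. f \<subseteq>\<^sub>m u}" for w
          by (rule retract, rule d) (use that in simp)
        show "(w \<circ>\<^sub>m j) \<circ>\<^sub>m j' = w" if "w \<in> {f\<in>\<Omega>. f \<subseteq>\<^sub>m u \<circ>\<^sub>m j'}" for w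
          by (rule forth, rule d') (use that in simp)
      qed
      then show ?thesis unfolding r_def by (simp only: bij_betw_same_card)
    qed
    have count: "sum \<mu> (S j u) = sum \<mu> (S j' (u \<circ>\<^sub>m j'))" if "u \<in> \<Omega>" "dom u \<subseteq> dom j" for u
      using that
    proof (induction "card \<Omega> - r u" arbitrary: u rule: less_induct)
      case less
      let ?W = "{w\<in>\<Omega>. u \<subseteq>\<^sub>m w \<and> dom w \<subseteq> dom j \<and> w \<noteq> u}"
      have "(\<Sum>w\<in>{w\<in>\<Omega>. u \<circ>\<^sub>m j' \<subseteq>\<^sub>m w \<and> dom w \<subseteq> dom j' \<and> w \<noteq> u \<circ>\<^sub>m j'}. sum \<mu> (S j' w))
          = (\<Sum>w\<in>?W. sum \<mu> (S j' (w \<circ>\<^sub>m j')))"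
        by (rule sum.reindex_bij_betw[OF above_bij[OF less.prems(2)], symmetric])
      also have "\<dots> = (\<Sum>w\<in>?W. sum \<mu> (S j w))"
      proof (rule sum.cong[OF refl])
        fix w assume w: "w \<in> ?W"
        then have "w \<in> above u" by (auto simp: above_def)
        then have "r u < r w" using r_less less.prems by blast
        moreover have "r w \<le> card \<Omega>" unfolding r_def by (intro card_mono fin) auto
        ultimately have "card \<Omega> - r w < card \<Omega> - r u" by simp
        then show "sum \<mu> (S j' (w \<circ>\<^sub>m j')) = sum \<mu> (S j w)" using less.hyps w by auto
      qed
      finally show ?case
        
        using key[OF j less.prems] key[OF j(2,1) inverse_pair_sym[OF j(3)] comp[OF less.prems(1) j(2)] domj'(1)]
          r_inv[OF less.prems(2)] by (metis (no_types, lifting) add_right_cancel)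
    qed
    have cardS: "card {\<theta>\<in>\<Theta>. fst \<theta> |` dom i = u} = sum \<mu> (S i u)" for i u
    proof -
      have "{\<theta>\<in>\<Theta>. fst \<theta> |` dom i = u} = Sigma (S i u) (\<lambda>f. {..<\<mu> f})" unfolding \<Theta>_def S_def by auto
      then show ?thesis using fin by (simp add: S_def)
    qed
    have idO: "Some |` dom j \<in> \<Omega>" using comp[OF j(2,1)] inverse_pair_comp[OF j(3)] by simp
    have jdom: "j' |` dom j' = j'" by (auto simp: restrict_map_def dom_def fun_eq_iff)
    have "(Some |` dom j) |` dom j \<circ>\<^sub>m j' = j'"
    proof
      fix q show "((Some |` dom j) |` dom j \<circ>\<^sub>m j') q = j' q"
        proof (cases "j' q")
        case (Some p)
        then have "j p = Some q" using jj by blast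
        then show ?thesis using Some by (simp add: map_comp_def restrict_map_def domIff)
      qed (simp add: map_comp_def)
    qed
    then have root: "fst (j', 0::nat) |` dom j' = (fst (Some |` dom j, 0::nat) |` dom j) \<circ>\<^sub>m j'" using jdom by simp
    have cnt: "card {\<theta>\<in>\<Theta>. fst \<theta> |` dom j \<circ>\<^sub>m j' = x} = card {\<theta>\<in>\<Theta>. fst \<theta> |` dom j' = x}" for x
    proof (cases "dom x \<subseteq> dom j' \<and> x \<in> \<Omega>")
      case True
      have "fst \<theta> |` dom j \<circ>\<^sub>m j' = x \<longleftrightarrow> fst \<theta> |` dom j = x \<circ>\<^sub>m j" for \<theta> :: "('p \<rightharpoonup> 'p) \<times> nat"
        using retract[of "fst \<theta> |` dom j"] forth[of x] True by auto
      then have "card {\<theta>\<in>\<Theta>. fst \<theta> |` dom j \<circ>\<^sub>m j' = x} = sum \<mu> (S j (x \<circ>\<^sub>m j))" using cardS by simp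
      also have "\<dots> = sum \<mu> (S j' x)" using count[of "x \<circ>\<^sub>m j", OF comp[OF _ j(1)] domj'(2)] forth[of x] True by (simp only:)
      finally show ?thesis using cardS by simp
    next
      case False
      have "{\<theta>\<in>\<Theta>. fst \<theta> |` dom j \<circ>\<^sub>m j' = x} = {}"
      proof -
        have "dom (fst \<theta> |` dom j \<circ>\<^sub>m j') \<subseteq> dom j' \<and> fst \<theta> |` dom j \<circ>\<^sub>m j' \<in> \<Omega>" if "\<theta> \<in> \<Theta>" for \<theta>
          using domj'(1) comp[OF restrO[OF _ j] j(2)] that by (auto simp only: \<Theta>_def mem_Sigma_iff split_paired_all fst_conv)
        then show ?thesis using False by blast
      qed
      moreover have "{\<theta>\<in>\<Theta>. fst \<theta> |` dom j' = x} = {}"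
      proof -
        have "dom (fst \<theta> |` dom j') \<subseteq> dom j' \<and> fst \<theta> |` dom j' \<in> \<Omega>" if "\<theta> \<in> \<Theta>" for \<theta>
          using restrO[OF _ j(2,1) inverse_pair_sym[OF j(3)]] that by (auto simp: \<Theta>_def)
        then show ?thesis using False by blast
      qed
      ultimately show ?thesis by (simp only:)
    qed
    obtain \<gamma> where \<gamma>: "\<gamma> permutes \<Theta>" "\<And>\<theta>. \<theta> \<in> \<Theta> \<Longrightarrow> fst (\<gamma> \<theta>) |` dom j' = fst \<theta> |` dom j \<circ>\<^sub>m j'"
        "\<gamma> (Some |` dom j, 0) = (j', 0)"
      by (rule colour_bijection[OF fin\<Theta> cnt zero[OF idO] zero[OF j(2)] root]) blast
    have "fst (\<gamma> \<theta>) q = fst \<theta> p" if \<theta>: "\<theta> \<in> \<Theta>" and pq: "j p = Some q" for \<theta> p q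
    proof -
      have q: "j' q = Some p" using pq jj by blast
      then have "fst (\<gamma> \<theta>) q = (fst (\<gamma> \<theta>) |` dom j') q" by (auto simp: restrict_map_def)
      also have "\<dots> = fst \<theta> p" using \<gamma>(2)[OF \<theta>] q pq by (auto simp: map_comp_def restrict_map_def)
      finally show ?thesis .
    qed
    then show ?thesis using \<gamma> by blast
  qed
  then show ?thesis using that[OF fin\<Theta> zero] by (auto simp: \<Theta>_def)
qed

section \<open>Boundaries of sets of edges modulo two\<close>

text \<open>The sum of the ends of the edges in \<open>A\<close> over the field with two elements, where \<open>s\<close> and \<open>t\<close> give the
  source and the target of an edge.\<close>

definition boundary :: "('e \<Rightarrow> 'v) \<Rightarrow> ('e \<Rightarrow> 'v) \<Rightarrow> 'e set \<Rightarrow> 'v set" where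
  "boundary s t A = {v. odd (card {e\<in>A. s e = v}) \<noteq> odd (card {e\<in>A. t e = v})}"

lemma odd_card_sym_diff:
  assumes "finite A" "finite B"
  shows "odd (card (sym_diff A B)) \<longleftrightarrow> odd (card A) \<noteq> odd (card B)"
proof -
  have "card A = card (A - B) + card (A \<inter> B)" "card B = card (B - A) + card (A \<inter> B)"
    using assms card_Diff_subset_Int[of A B] card_Diff_subset_Int[of B A] card_mono[of A "A \<inter> B"] card_mono[of B "A \<inter> B"]
    by (auto simp: Int_commute)
  moreover have "card (sym_diff A B) = card (A - B) + card (B - A)"
    using assms by (intro card_Un_disjoint) auto
  ultimately show ?thesis by auto
qed

lemma boundary_sym_diff:
  fixes s t :: "'e \<Rightarrow> 'v"
  assumes "finite A" "finite B"
  shows "boundary s t (sym_diff A B) = sym_diff (boundary s t A) (boundary s t B)"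
proof -
  have "odd (card {e\<in>sym_diff A B. f e = v}) \<longleftrightarrow> odd (card {e\<in>A. f e = v}) \<noteq> odd (card {e\<in>B. f e = v})" for f :: "'e \<Rightarrow> 'v" and v
  proof -
    have "{e\<in>sym_diff A B. f e = v} = sym_diff {e\<in>A. f e = v} {e\<in>B. f e = v}" by blast
    then show ?thesis using odd_card_sym_diff[of "{e\<in>A. f e = v}" "{e\<in>B. f e = v}"] assms by simp
  qed
  then show ?thesis unfolding boundary_def by blast
qed

lemma boundary_empty [simp]: "boundary s t {} = {}"
  by (simp add: boundary_def)

lemma boundary_singleton:
  fixes s t :: "'e \<Rightarrow> 'v"
  shows "boundary s t {e} = sym_diff {s e} {t e}"
proof -
  have "{e'\<in>{e}. f e' = v} = (if f e = v then {e} else {})" for f :: "'e \<Rightarrow> 'v" and v by auto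
  then show ?thesis unfolding boundary_def by auto
qed

lemma boundary_insert:
  assumes "finite A" "e \<notin> A"
  shows "boundary s t (insert e A) = sym_diff (boundary s t A) (sym_diff {s e} {t e})"
proof -
  have "insert e A = sym_diff A {e}" using assms by blast
  then show ?thesis using boundary_sym_diff[of A "{e}" s t] assms boundary_singleton[of s t e] by simp
qed

lemma boundary_subset: "boundary s t A \<subseteq> s ` A \<union> t ` A"
proof (intro subsetI, rule ccontr)
  fix v assume v: "v \<in> boundary s t A" "v \<notin> s ` A \<union> t ` A"
  have "{e\<in>A. s e = v} = {}" "{e\<in>A. t e = v} = {}" using v(2) by auto
  then show False using v(1) unfolding boundary_def by (simp only: mem_Collect_eq card.empty)
qed

text \<open>An edge with both ends in \<open>N\<close> or both ends outside \<open>N\<close> changes the number of boundary points in \<open>N\<close>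
  by an even number. With \<open>N = UNIV\<close> this is the evenness of boundaries.\<close>

lemma even_boundary_Int:
  assumes "finite A" "\<And>e. e \<in> A \<Longrightarrow> s e \<in> N \<longleftrightarrow> t e \<in> N"
  shows "even (card (boundary s t A \<inter> N))"
  using assms
proof (induction A)
  case empty then show ?case by simp
next
  case (insert e A)
  have fin: "finite (boundary s t A \<inter> N)"
    using boundary_subset[of s t A] insert.hyps(1) by (meson finite_Int finite_UnI finite_imageI finite_subset)
  have "boundary s t (insert e A) \<inter> N = sym_diff (boundary s t A \<inter> N) (sym_diff {s e} {t e} \<inter> N)"
    unfolding boundary_insert[OF insert.hyps] by blast
  moreover have "even (card (sym_diff {s e} {t e} \<inter> N))"
  proof (cases "s e \<in> N \<and> s e \<noteq> t e")
    case True
    then have "sym_diff {s e} {t e} \<inter> N = {s e, t e}" using insert.prems by auto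
    then show ?thesis using True by simp
  next
    case False
    then have "sym_diff {s e} {t e} \<inter> N = {}" using insert.prems by auto
    then show ?thesis by simp
  qed
  ultimately show ?case using odd_card_sym_diff[OF fin, of "sym_diff {s e} {t e} \<inter> N"] insert by auto
qed

lemma image_sym_diff_inj_on:
  "inj_on f C \<Longrightarrow> A \<subseteq> C \<Longrightarrow> B \<subseteq> C \<Longrightarrow> f ` (sym_diff A B) = sym_diff (f ` A) (f ` B)"
  using inj_on_image_set_diff[of f C A B] inj_on_image_set_diff[of f C B A] unfolding image_Un by blast

lemma boundary_image:
  assumes "finite A" and h: "inj_on h A" and f: "inj_on f C" and C: "s ` A \<union> t ` A \<subseteq> C"
    and st: "\<And>e. e \<in> A \<Longrightarrow> s (h e) = f (s e) \<and> t (h e) = f (t e)"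
  shows "boundary s t (h ` A) = f ` boundary s t A"
  using assms
proof (induction A)
  case empty then show ?case by simp
next
  case (insert e A)
  have "boundary s t (h ` insert e A) = sym_diff (boundary s t (h ` A)) (sym_diff {s (h e)} {t (h e)})"
    using boundary_insert[of "h ` A" "h e" s t] insert.hyps insert.prems(1) by (auto simp: inj_on_def)
  also have "\<dots> = sym_diff (f ` boundary s t A) (f ` sym_diff {s e} {t e})"
  proof -
    have "boundary s t (h ` A) = f ` boundary s t A" using insert by (auto simp: inj_on_def)
    moreover have "f ` sym_diff {s e} {t e} = sym_diff (f ` {s e}) (f ` {t e})"
      by (rule image_sym_diff_inj_on[OF insert.prems(2)]) (use insert.prems(3) in auto)
    ultimately show ?thesis using insert.prems(4)[of e] by simp
  qed
  also have "\<dots> = f ` sym_diff (boundary s t A) (sym_diff {s e} {t e})"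
    by (rule image_sym_diff_inj_on[OF insert.prems(2), symmetric])
       (use boundary_subset[of s t A] insert.prems(3) in auto)
  finally show ?case unfolding boundary_insert[OF insert.hyps] .
qed

lemma boundary_subset_sym_diff:
  assumes "finite A" "finite B" "\<And>e. e \<in> sym_diff A B \<Longrightarrow> s e \<in> N \<and> t e \<in> N"
  shows "sym_diff (boundary s t A) (boundary s t B) \<subseteq> N"
  using boundary_subset[of s t "sym_diff A B"] assms(3) assms(1,2) unfolding boundary_sym_diff[OF assms(1,2), symmetric]
  by blast

section \<open>Relations that carry cells to cells\<close>

text \<open>What all relations between the points of two copies have in common: a point can only be related
  together with the closed cell that carries it, by an isometry of cubes.\<close>

definition cell_transfer :: "('c, 'p) cube_complex \<Rightarrow> ('p \<Rightarrow> 'p \<Rightarrow> bool) \<Rightarrow> bool" where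
  "cell_transfer Y T \<longleftrightarrow> (\<forall>c u q. c \<in> cells Y \<and> u \<in> open_cube (cdim Y c) \<and> T (chart Y c u) q \<longrightarrow>
     (\<exists>d g. d \<in> cells Y \<and> cdim Y d = cdim Y c \<and> face_map (cdim Y c) (cdim Y c) g \<and> q = chart Y d (g u) \<and>
        (\<forall>w\<in>cube (cdim Y c). T (chart Y c w) (chart Y d (g w)))))"

lemma cell_transferI:
  assumes "\<And>c u q. c \<in> cells Y \<Longrightarrow> u \<in> open_cube (cdim Y c) \<Longrightarrow> T (chart Y c u) q \<Longrightarrow>
    \<exists>d g. d \<in> cells Y \<and> cdim Y d = cdim Y c \<and> face_map (cdim Y c) (cdim Y c) g \<and> q = chart Y d (g u) \<and>
        (\<forall>w\<in>cube (cdim Y c). T (chart Y c w) (chart Y d (g w)))"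
  shows "cell_transfer Y T"
  unfolding cell_transfer_def using assms by (intro allI impI) (elim conjE)

lemma cell_transferE:
  assumes "cell_transfer Y T" "c \<in> cells Y" "u \<in> open_cube (cdim Y c)" "T (chart Y c u) q"
  obtains d g where "d \<in> cells Y" "cdim Y d = cdim Y c" "face_map (cdim Y c) (cdim Y c) g" "q = chart Y d (g u)"
    "\<And>w. w \<in> cube (cdim Y c) \<Longrightarrow> T (chart Y c w) (chart Y d (g w))"
proof -
  have "\<exists>d g. d \<in> cells Y \<and> cdim Y d = cdim Y c \<and> face_map (cdim Y c) (cdim Y c) g \<and> q = chart Y d (g u) \<and>
        (\<forall>w\<in>cube (cdim Y c). T (chart Y c w) (chart Y d (g w)))"
    using assms unfolding cell_transfer_def by (elim allE impE) (intro conjI)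
  then show ?thesis using that by (elim exE conjE) (blast dest: bspec)
qed

lemma cell_transfer_partial_isometry:
  assumes "j \<in> partial_isometries Y"
  shows "cell_transfer Y (\<lambda>p q. j p = Some q)"
proof (rule cell_transferI)
  fix c u q assume c: "c \<in> cells Y" "u \<in> open_cube (cdim Y c)" "j (chart Y c u) = Some q"
  have "chart Y c u \<in> dom j" using c(3) by blast
  then obtain d g where d: "d \<in> cells Y" "cdim Y d = cdim Y c" "face_map (cdim Y c) (cdim Y c) g"
     "\<forall>u\<in>cube (cdim Y c). j (chart Y c u) = Some (chart Y d (g u))"
    using partial_isometriesD(2)[OF assms c(1,2)] by blast
  then show "\<exists>d g. d \<in> cells Y \<and> cdim Y d = cdim Y c \<and> face_map (cdim Y c) (cdim Y c) g \<and> q = chart Y d (g u) \<and>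
        (\<forall>w\<in>cube (cdim Y c). j (chart Y c w) = Some (chart Y d (g w)))"
    using c(3) bspec[OF d(4) open_cube_sub[OF c(2)]] by (intro exI[of _ d] exI[of _ g]) simp
qed

lemma half_point_open:
  assumes "\<sigma> \<in> corners Y"
  shows "fst \<sigma> \<in> cells Y" "half (cdim Y (fst \<sigma>)) (snd \<sigma>) \<in> open_cube (cdim Y (fst \<sigma>))"
    "snd \<sigma> \<in> cube_vertices (cdim Y (fst \<sigma>))" "1 \<le> cdim Y (fst \<sigma>)"
  using assms half_open[OF vertex_in_cube] unfolding corners_def by auto

lemma corner_edges_points:
  assumes "\<sigma> \<in> corners Y" "a \<in> corner_edges Y \<sigma>"
  obtains u where "u \<in> cube (cdim Y (fst \<sigma>))" "a = chart Y (fst \<sigma>) u"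
proof -
  obtain i where i: "i < cdim Y (fst \<sigma>)" "a = chart Y (fst \<sigma>) ((snd \<sigma>)(i := snd \<sigma> i / 2))"
    using assms(2) unfolding corner_edges_def by blast
  show ?thesis using that[OF edge_point_cube[OF i(1) half_point_open(3)[OF assms(1)]] i(2)] .
qed

text \<open>The half point of a corner is an interior point of its cell, so the whole corner follows it, with its
  vertex and its edges.\<close>

lemma corner_transfer:
  assumes T: "cell_transfer Y T" and sv: "right_unique T"
    and \<sigma>: "\<sigma> \<in> corners Y" and q: "T (half_point Y \<sigma>) q"
  shows "\<exists>\<tau>. \<tau> \<in> corners Y \<and> cdim Y (fst \<tau>) = cdim Y (fst \<sigma>) \<and> half_point Y \<tau> = q \<and>
    T (chart Y (fst \<sigma>) (snd \<sigma>)) (chart Y (fst \<tau>) (snd \<tau>)) \<and>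
    (\<forall>a\<in>corner_edges Y \<sigma>. \<exists>b\<in>corner_edges Y \<tau>. T a b) \<and> (\<forall>b\<in>corner_edges Y \<tau>. \<exists>a\<in>corner_edges Y \<sigma>. T a b)"
proof -
  have det: "q = q'" if "T p q" "T p q'" for p q q' using sv that unfolding right_unique_def by blast
  obtain c v where cv: "\<sigma> = (c, v)" by (cases \<sigma>)
  have c: "c \<in> cells Y" "half (cdim Y c) v \<in> open_cube (cdim Y c)" "v \<in> cube_vertices (cdim Y c)"
    using half_point_open[OF \<sigma>] unfolding cv by auto
  have "T (chart Y c (half (cdim Y c) v)) q" using q unfolding cv half_point_def by simp
  then obtain d g where d: "d \<in> cells Y" "cdim Y d = cdim Y c" "face_map (cdim Y c) (cdim Y c) g"
      "q = chart Y d (g (half (cdim Y c) v))" "\<And>w. w \<in> cube (cdim Y c) \<Longrightarrow> T (chart Y c w) (chart Y d (g w))"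
    by (rule cell_transferE[OF T c(1,2)]) blast
  define f where "f p = (THE q. T p q)" for p
  have f: "f (chart Y c w) = chart Y d (g w)" if "w \<in> cube (cdim Y c)" for w
    unfolding f_def using d(5)[OF that] det by blast
  have ce: "corner_edges Y (d, g v) = f ` corner_edges Y (c, v)"
    by (rule corner_edges_cell_map[OF d(2,3) c(3) f])
  have Tf: "T a (f a)" if a: "a \<in> corner_edges Y (c, v)" for a
  proof -
    obtain u where "u \<in> cube (cdim Y c)" "a = chart Y c u"
      by (rule corner_edges_points[OF \<sigma>[unfolded cv] a]) simp
    then show ?thesis using d(5) f by simp
  qed
  show ?thesis
  proof (intro exI[of _ "(d, g v)"] conjI ballI)
    show "(d, g v) \<in> corners Y" by (rule corner_map[OF \<sigma>[unfolded cv] d(2,3,1)])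
    show "cdim Y (fst (d, g v)) = cdim Y (fst \<sigma>)" using d(2) cv by simp
    show "half_point Y (d, g v) = q"
      using d(2,4) face_map_self_half[OF d(3) vertex_in_cube[OF c(3)]] by (simp add: half_point_def)
    show "T (chart Y (fst \<sigma>) (snd \<sigma>)) (chart Y (fst (d, g v)) (snd (d, g v)))"
      using d(5)[OF vertex_in_cube[OF c(3)]] cv by simp
    show "\<exists>b\<in>corner_edges Y (d, g v). T a b" if "a \<in> corner_edges Y \<sigma>" for a
      using Tf[of a] that ce cv by blast
    show "\<exists>a\<in>corner_edges Y \<sigma>. T a b" if b: "b \<in> corner_edges Y (d, g v)" for b
    proof -
      obtain a where "a \<in> corner_edges Y (c, v)" "b = f a" using b unfolding ce by blast
      then show ?thesis using Tf[of a] cv by blast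
    qed
  qed
qed

section \<open>Exact systems of copies\<close>

text \<open>Copies of \<open>Y\<close> indexed by the finite set \<open>V\<close>; \<open>rel v p w q\<close> says that the point \<open>p\<close> of the copy \<open>v\<close> is
  identified with the point \<open>q\<close> of the copy \<open>w\<close>. Across the edge from \<open>v\<close> to \<open>step j v\<close>, identification is
  by \<open>j\<close> at least. The maps \<open>shift j\<close> are symmetries of all this which start by moving the base copy
  along the edge \<open>j\<close>. In the model case steps are left multiplications and shifts are right
  multiplications, so that they commute.
  The assumption \<open>exact\<close> is the property that gives the name.\<close>

locale exact_system =
  fixes Y :: "('c, 'p) cube_complex" and I :: "('p \<rightharpoonup> 'p) set" and V :: "'v set" and v0 :: 'v
    and step shift :: "('p \<rightharpoonup> 'p) \<Rightarrow> 'v \<Rightarrow> 'v" and rel :: "'v \<Rightarrow> 'p \<Rightarrow> 'v \<Rightarrow> 'p \<Rightarrow> bool"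
  assumes cube_complex: "cube_complex Y"
    and finite_isometries: "finite I" and isometries: "j \<in> I \<Longrightarrow> j \<in> partial_isometries Y"
    and finite_sites: "finite V" and base_site: "v0 \<in> V"
    and step_site: "j \<in> I \<Longrightarrow> v \<in> V \<Longrightarrow> step j v \<in> V"
    and shift_bij: "j \<in> I \<Longrightarrow> bij_betw (shift j) V V"
    and shift_step: "i \<in> I \<Longrightarrow> j \<in> I \<Longrightarrow> v \<in> V \<Longrightarrow> shift j (step i v) = step i (shift j v)"
    and shift_base: "j \<in> I \<Longrightarrow> shift j v0 = step j v0"
    and shift_rel: "j \<in> I \<Longrightarrow> v \<in> V \<Longrightarrow> w \<in> V \<Longrightarrow> rel (shift j v) p (shift j w) q \<longleftrightarrow> rel v p w q"
    and rel_site: "rel v p w q \<Longrightarrow> v \<in> V \<and> p \<in> points Y"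
    and rel_refl: "v \<in> V \<Longrightarrow> p \<in> points Y \<Longrightarrow> rel v p v p"
    and rel_sym: "rel v p w q \<Longrightarrow> rel w q v p"
    and rel_trans: "rel u p v q \<Longrightarrow> rel v q w r \<Longrightarrow> rel u p w r"
    and rel_unique: "rel v p v q \<Longrightarrow> p = q"
    and rel_transfer: "cell_transfer Y (\<lambda>p q. rel v p w q)"
    and rel_step: "j \<in> I \<Longrightarrow> v \<in> V \<Longrightarrow> j p = Some q \<Longrightarrow> rel v p (step j v) q"
    and exact: "\<sigma> \<in> corners Y \<Longrightarrow> v \<in> V \<Longrightarrow> w \<in> V \<Longrightarrow> (\<And>a. a \<in> corner_edges Y \<sigma> \<Longrightarrow> \<exists>b. rel v a w b) \<Longrightarrow>
      x \<in> cube (cdim Y (fst \<sigma>)) \<Longrightarrow> \<exists>y. rel v (chart Y (fst \<sigma>) x) w y"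

lemma sym_diff_pair_Int: "a \<in> N \<Longrightarrow> b \<notin> N \<Longrightarrow> sym_diff {a} {b} \<inter> N = {a}"
  by auto

lemma partial_isometry_dom:
  assumes "j \<in> partial_isometries Y"
  shows "dom j \<subseteq> points Y"
  using partial_isometriesD(1)[OF assms] convex_setD(1) by blast

section \<open>Copies indexed by permutations\<close>

text \<open>Here \<open>\<Theta>\<close> is the set of labels and \<open>\<gamma> j\<close> the extension of \<open>j\<close> to a permutation of labels.\<close>

locale extended_isometries =
  fixes Y :: "('c, 'p) cube_complex" and I :: "('p \<rightharpoonup> 'p) set" and \<Theta> :: "(('p \<rightharpoonup> 'p) \<times> nat) set"
    and \<gamma> :: "('p \<rightharpoonup> 'p) \<Rightarrow> ('p \<rightharpoonup> 'p) \<times> nat \<Rightarrow> ('p \<rightharpoonup> 'p) \<times> nat"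
  assumes cube_complex: "cube_complex Y" and finite_I: "finite I"
    and iso: "j \<in> I \<Longrightarrow> j \<in> partial_isometries Y"
    and inverse: "j \<in> I \<Longrightarrow> \<exists>j'\<in>partial_isometries Y. inverse_pair j j' \<and> \<gamma> j (Some |` dom j, 0) = (j', 0)"
    and fin: "finite \<Theta>" and zero: "f \<in> partial_isometries Y \<Longrightarrow> (f, 0) \<in> \<Theta>"
    and label: "\<theta> \<in> \<Theta> \<Longrightarrow> fst \<theta> \<in> partial_isometries Y"
    and perm: "j \<in> I \<Longrightarrow> \<gamma> j permutes \<Theta>"
    and perm_label: "j \<in> I \<Longrightarrow> \<theta> \<in> \<Theta> \<Longrightarrow> j p = Some q \<Longrightarrow> fst (\<gamma> j \<theta>) q = fst \<theta> p"
begin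

definition perms :: "(('p \<rightharpoonup> 'p) \<times> nat \<Rightarrow> ('p \<rightharpoonup> 'p) \<times> nat) set" where
  "perms = {g. g permutes \<Theta>}"

text \<open>The equivalence relation generated by gluing \<open>p\<close> in the copy \<open>h\<close> to \<open>j p\<close> in the copy \<open>\<gamma> j \<circ> h\<close>.
  The rule \<open>backward\<close> makes it symmetric.\<close>

inductive glue :: "(('p \<rightharpoonup> 'p) \<times> nat \<Rightarrow> ('p \<rightharpoonup> 'p) \<times> nat) \<Rightarrow> 'p \<Rightarrow>
    (('p \<rightharpoonup> 'p) \<times> nat \<Rightarrow> ('p \<rightharpoonup> 'p) \<times> nat) \<Rightarrow> 'p \<Rightarrow> bool" where
  refl: "g \<in> perms \<Longrightarrow> p \<in> points Y \<Longrightarrow> glue g p g p"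
| forward: "glue g p h q \<Longrightarrow> j \<in> I \<Longrightarrow> j q = Some r \<Longrightarrow> glue g p (\<gamma> j \<circ> h) r"
| backward: "glue g p (\<gamma> j \<circ> h) r \<Longrightarrow> h \<in> perms \<Longrightarrow> j \<in> I \<Longrightarrow> j q = Some r \<Longrightarrow> glue g p h q"

lemma ran_points: "j \<in> I \<Longrightarrow> j p = Some q \<Longrightarrow> p \<in> points Y \<and> q \<in> points Y"
proof -
  assume j: "j \<in> I" "j p = Some q"
  obtain j' where j': "j' \<in> partial_isometries Y" "inverse_pair j j'" using inverse[OF j(1)] by blast
  have "j' q = Some p" using j' j unfolding inverse_pair_def by blast
  then show ?thesis using j partial_isometry_dom[OF iso[OF j(1)]] partial_isometry_dom[OF j'(1)] by blast
qed

lemma perms_comp: "g \<in> perms \<Longrightarrow> h \<in> perms \<Longrightarrow> g \<circ> h \<in> perms"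
  unfolding perms_def by (auto intro: permutes_compose)

lemma perms_\<gamma>: "j \<in> I \<Longrightarrow> \<gamma> j \<in> perms" using perm unfolding perms_def by auto

lemma perms_inv:
  assumes "g \<in> perms" shows "inv g \<in> perms" "inv g \<circ> g = id" "g \<circ> inv g = id"
  using assms permutes_inv permutes_inv_o unfolding perms_def by auto

lemma glue_sites: "glue g p h q \<Longrightarrow> g \<in> perms \<and> h \<in> perms \<and> p \<in> points Y \<and> q \<in> points Y"
proof (induction rule: glue.induct)
  case refl then show ?case by blast
next
  case forward then show ?case using perms_comp[OF perms_\<gamma>] ran_points by blast
next
  case backward then show ?case using ran_points by blast
qed

lemma glue_trans:
  assumes "glue g p h q" "glue h q k r" shows "glue g p k r"
  using assms(2,1)
proof (induction rule: glue.induct)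
  case refl then show ?case by simp
next
  case forward then show ?case using glue.forward by blast
next
  case backward then show ?case using glue.backward by blast
qed

lemma glue_sym: "glue g p h q \<Longrightarrow> glue h q g p"
proof (induction rule: glue.induct)
  case refl then show ?case by (rule glue.refl)
next
  case (forward g p h q j r)
  have h: "h \<in> perms" "\<gamma> j \<circ> h \<in> perms" using glue_sites[OF forward.IH] perms_comp perms_\<gamma> forward.hyps by auto
  have "r \<in> points Y" using ran_points forward.hyps by blast
  have "glue (\<gamma> j \<circ> h) r h q"
    by (rule glue.backward[OF glue.refl h(1)]) (use h ran_points forward.hyps in auto)
  then show ?case using forward.IH glue_trans by blast
next
  case (backward g p j h r q)
  have "q \<in> points Y" using ran_points backward.hyps by blast
  then have "glue h q (\<gamma> j \<circ> h) r" using glue.forward[OF glue.refl] backward.hyps by blast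
  then show ?case using backward.IH glue_trans by blast
qed

text \<open>The invariant of the gluing. It detects points, as the identity is a label, and it detects
  domains of partial isometries.\<close>

lemma glue_label: "glue g p h q \<Longrightarrow> \<theta> \<in> \<Theta> \<Longrightarrow> fst (g \<theta>) p = fst (h \<theta>) q"
proof (induction rule: glue.induct)
  case refl then show ?case by simp
next
  case (forward g p h q j r)
  have "h \<theta> \<in> \<Theta>" using glue_sites[OF forward.hyps(1)] forward.prems unfolding perms_def by (simp add: permutes_in_image)
  then show ?case using forward perm_label by simp
next
  case (backward g p j h r q)
  have "h \<theta> \<in> \<Theta>" using backward unfolding perms_def by (simp add: permutes_in_image)
  then show ?case using backward perm_label by simp
qed

text \<open>Evaluate the invariant at the label that \<open>g\<close> takes to the identity of \<open>Y\<close>.\<close>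

lemma glue_unique:
  assumes "glue g p g q" shows "p = q"
proof -
  have g: "g permutes \<Theta>" and pq: "p \<in> points Y" "q \<in> points Y"
    using glue_sites[OF assms] unfolding perms_def by auto
  let ?\<theta> = "inv g (Some |` points Y, 0)"
  have "(Some |` points Y, 0) \<in> \<Theta>" using zero partial_isometries_id[OF convex_set_points] by blast
  then have "?\<theta> \<in> \<Theta>" using permutes_in_image[OF permutes_inv[OF g]] by blast
  from glue_label[OF assms this] have "(Some |` points Y) p = (Some |` points Y) q"
    using permutes_inverses(1)[OF g] by simp
  then show ?thesis using pq by simp
qed

lemma glue_transfer: "cell_transfer Y (\<lambda>p q. glue g p h q)"
proof -
  have "\<exists>d f. d \<in> cells Y \<and> cdim Y d = cdim Y c \<and> face_map (cdim Y c) (cdim Y c) f \<and> q = chart Y d (f u) \<and>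
      (\<forall>w\<in>cube (cdim Y c). glue g (chart Y c w) h (chart Y d (f w)))"
    if "glue g p h q" "c \<in> cells Y" "u \<in> open_cube (cdim Y c)" "p = chart Y c u" for g p h q c u
    using that
  proof (induction rule: glue.induct)
    case (refl g p)
    then show ?case
      by (intro exI[of _ c] exI[of _ "\<lambda>u. u"]) (simp add: face_map_id chart_points glue.refl)
  next
    case (forward g p h q j r)
    obtain d f where d: "d \<in> cells Y" "cdim Y d = cdim Y c" "face_map (cdim Y c) (cdim Y c) f" "q = chart Y d (f u)"
      "\<forall>w\<in>cube (cdim Y c). glue g (chart Y c w) h (chart Y d (f w))" using forward.IH forward.prems by blast
    have "f u \<in> open_cube (cdim Y d)" using face_map_self_open[OF d(3) forward.prems(2)] d(2) by simp
    from cell_transferE[OF cell_transfer_partial_isometry[OF iso[OF forward.hyps(2)]] d(1) this forward.hyps(3)[unfolded d(4)]]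
    obtain e k where e: "e \<in> cells Y" "cdim Y e = cdim Y d" "face_map (cdim Y d) (cdim Y d) k" "r = chart Y e (k (f u))"
      "\<And>w. w \<in> cube (cdim Y d) \<Longrightarrow> j (chart Y d w) = Some (chart Y e (k w))" by blast
    have k: "face_map (cdim Y c) (cdim Y c) k" using e(3) d(2) by simp
    have "glue g (chart Y c w) (\<gamma> j \<circ> h) (chart Y e (k (f w)))" if "w \<in> cube (cdim Y c)" for w
      using glue.forward[OF bspec[OF d(5) that] forward.hyps(2) e(5)] face_map_cube[OF d(3) that] d(2) by simp
    note gl = this
    have e2: "cdim Y e = cdim Y c" using e(2) d(2) by simp
    show ?case
      by (intro exI[of _ e] exI[of _ "\<lambda>w. k (f w)"] conjI ballI e(1) e2 face_map_comp[OF d(3) k] e(4) gl)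
  next
    case (backward g p j h r q)
    obtain d f where d: "d \<in> cells Y" "cdim Y d = cdim Y c" "face_map (cdim Y c) (cdim Y c) f" "r = chart Y d (f u)"
      "\<forall>w\<in>cube (cdim Y c). glue g (chart Y c w) (\<gamma> j \<circ> h) (chart Y d (f w))" using backward.IH backward.prems by blast
    obtain j' where j': "j' \<in> partial_isometries Y" "inverse_pair j j'" using inverse[OF backward.hyps(3)] by blast
    have jj: "j p = Some q \<longleftrightarrow> j' q = Some p" for p q using j'(2) unfolding inverse_pair_def by blast
    have "f u \<in> open_cube (cdim Y d)" using face_map_self_open[OF d(3) backward.prems(2)] d(2) by simp
    moreover have "j' (chart Y d (f u)) = Some q" using backward.hyps(4) jj d(4) by simp
    ultimately obtain e k where e: "e \<in> cells Y" "cdim Y e = cdim Y d" "face_map (cdim Y d) (cdim Y d) k" "q = chart Y e (k (f u))"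
      "\<And>w. w \<in> cube (cdim Y d) \<Longrightarrow> j' (chart Y d w) = Some (chart Y e (k w))"
      using cell_transferE[OF cell_transfer_partial_isometry[OF j'(1)] d(1), of "f u" q] by blast
    have k: "face_map (cdim Y c) (cdim Y c) k" using e(3) d(2) by simp
    have "glue g (chart Y c w) h (chart Y e (k (f w)))" if w: "w \<in> cube (cdim Y c)" for w
    proof (rule glue.backward[OF bspec[OF d(5) w] backward.hyps(2,3)])
      show "j (chart Y e (k (f w))) = Some (chart Y d (f w))"
        unfolding jj using e(5)[of "f w"] face_map_cube[OF d(3) w] d(2) by simp
    qed
    note gl = this
    have e2: "cdim Y e = cdim Y c" using e(2) d(2) by simp
    show ?case
      by (intro exI[of _ e] exI[of _ "\<lambda>w. k (f w)"] conjI ballI e(1) e2 face_map_comp[OF d(3) k] e(4) gl)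
  qed
  then show ?thesis by (intro cell_transferI) blast
qed

lemma glue_right:
  assumes "glue g p h q" and k: "k \<in> perms" shows "glue (g \<circ> k) p (h \<circ> k) q"
  using assms(1)
proof (induction rule: glue.induct)
  case refl then show ?case using glue.refl perms_comp k by blast
next
  case (forward g p h q j r)
  then show ?case using glue.forward[OF forward.IH] by (simp only: comp_assoc)
next
  case (backward g p j h r q)
  show ?case by (rule glue.backward[OF backward.IH[unfolded comp_assoc] perms_comp[OF backward.hyps(2) k] backward.hyps(3,4)])
qed

lemma glue_right_iff:
  assumes "k \<in> perms" shows "glue (g \<circ> k) p (h \<circ> k) q \<longleftrightarrow> glue g p h q"
  using glue_right[OF _ assms] glue_right[of "g \<circ> k" p "h \<circ> k" q "inv k"] perms_inv[OF assms]
  by (auto simp: comp_assoc)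

section \<open>Making the gluing exact\<close>

text \<open>The edge from \<open>r\<close> to \<open>\<gamma> j \<circ> r\<close> is glued along the domain of \<open>j\<close>. This domain, seen from \<open>r\<close>, is
  the domain of the label \<open>g \<theta>\<close> at \<open>g = r\<close>, if \<open>\<theta>\<close> is the label that \<open>r\<close> takes to the identity of
  \<open>dom j\<close>. The domain of \<open>g \<theta>\<close> makes sense in every copy \<open>g\<close> and is invariant under gluing: the edge
  is marked at the points of this domain. At the other end \<open>\<gamma> j \<circ> r\<close> it is the range of \<open>j\<close>
  (\<open>marks_target\<close>). Thus an edge marked at a point can be crossed by this point as soon as one of its ends
  is reached.\<close>

definition marks where
  "marks g p = {(r, j). r \<in> perms \<and> j \<in> I \<and> p \<in> dom (fst (g (inv r (Some |` dom j, 0))))}"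

abbreviation tgt where "tgt \<equiv> \<lambda>(r, j). \<gamma> j \<circ> r"

lemma root_label: "j \<in> I \<Longrightarrow> r \<in> perms \<Longrightarrow> inv r (Some |` dom j, 0) \<in> \<Theta>"
  using zero[OF partial_isometries_id[OF partial_isometriesD(1)[OF iso]]] perms_inv(1)[of r]
  unfolding perms_def by (simp add: permutes_in_image)

lemma marks_glue:
  assumes "glue g p h q" shows "marks g p = marks h q"
proof -
  have "fst (g (inv r (Some |` dom j, 0))) p = fst (h (inv r (Some |` dom j, 0))) q"
    if "r \<in> perms" "j \<in> I" for r j
    by (rule glue_label[OF assms root_label[OF that(2,1)]])
  then show ?thesis unfolding marks_def domIff by (simp cong: conj_cong)
qed

lemma marks_source: "r \<in> perms \<Longrightarrow> j \<in> I \<Longrightarrow> (r, j) \<in> marks r p \<longleftrightarrow> p \<in> dom j"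
  unfolding marks_def perms_def by (auto simp: permutes_inverses)

text \<open>This is where it matters that \<open>\<gamma> j\<close> takes the identity of \<open>dom j\<close> to the inverse of \<open>j\<close>.\<close>

lemma marks_target:
  assumes "r \<in> perms" "j \<in> I" "inverse_pair j j'"
  shows "(r, j) \<in> marks (\<gamma> j \<circ> r) p \<longleftrightarrow> p \<in> dom j'"
proof -
  obtain k where k: "inverse_pair j k" "\<gamma> j (Some |` dom j, 0) = (k, 0)" using inverse[OF assms(2)] by blast
  have "k q = j' q" for q
    using k(1) assms(3) unfolding inverse_pair_def by (cases "k q"; cases "j' q") (metis option.distinct(1) option.inject)+
  then have "k = j'" by blast
  then show ?thesis using assms(1,2) k(2) unfolding marks_def perms_def by (auto simp: permutes_inverses)
qed

lemma marks_convex: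
  assumes "g \<in> perms" "e \<in> perms \<times> I" shows "convex_set Y {p. e \<in> marks g p}"
proof -
  obtain r j where e: "e = (r, j)" "r \<in> perms" "j \<in> I" using assms(2) by blast
  have "{p. e \<in> marks g p} = dom (fst (g (inv r (Some |` dom j, 0))))" using e unfolding marks_def by auto
  moreover have "g (inv r (Some |` dom j, 0)) \<in> \<Theta>"
    using root_label[OF e(3,2)] assms(1) unfolding perms_def by (simp add: permutes_in_image)
  ultimately show ?thesis using partial_isometriesD(1)[OF label] by simp
qed

lemma marks_shift:
  assumes "k \<in> perms" "g \<in> perms" shows "(r \<circ> k, j) \<in> marks (g \<circ> k) p \<longleftrightarrow> (r, j) \<in> marks g p"
proof -
  have "r \<circ> k \<in> perms \<longleftrightarrow> r \<in> perms"
    using perms_comp[OF _ assms(1), of r] perms_comp[OF _ perms_inv(1)[OF assms(1)], of "r \<circ> k"] perms_inv[OF assms(1)]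
    by (auto simp: comp_assoc)
  moreover have "(g \<circ> k) (inv (r \<circ> k) x) = g (inv r x)" if "r \<in> perms" for x
  proof -
    have "bij r" "bij k" using that assms(1) unfolding perms_def by (auto dest: permutes_bij)
    then have "inv (r \<circ> k) = inv k \<circ> inv r" by (rule o_inv_distrib)
    then show ?thesis using permutes_inverses(1)[of k \<Theta>] assms(1) unfolding perms_def by simp
  qed
  ultimately show ?thesis unfolding marks_def by auto
qed

lemma finite_edges: "A \<subseteq> perms \<times> I \<Longrightarrow> finite A"
  using finite_subset[of A "perms \<times> I"] finite_permutations[OF fin] finite_I unfolding perms_def by auto

text \<open>The vertices of a finite covering of the graph with vertex set \<open>perms\<close>: \<open>A\<close> is the set of edges which a
  path from the identity to \<open>g\<close> uses an odd number of times, forgetting that it should come from a path.\<close>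

definition sites where
  "sites = {(A, g). A \<subseteq> perms \<times> I \<and> g \<in> perms \<and> boundary fst tgt A = sym_diff {id} {g}}"

definition step where "step j v = (sym_diff (fst v) {(snd v, j)}, \<gamma> j \<circ> snd v)"

text \<open>The path to the shifted site goes first along the edge \<open>j\<close> and then along the shifted path.\<close>

definition shift where
  "shift j v = (sym_diff {(id, j)} ((\<lambda>(r, i). (r \<circ> \<gamma> j, i)) ` fst v), snd v \<circ> \<gamma> j)"

text \<open>Two lifts of copies share the point \<open>p\<close> only if they are connected through edges marked at \<open>p\<close>.\<close>

definition exact_glue where
  "exact_glue v p w q \<longleftrightarrow> v \<in> sites \<and> w \<in> sites \<and> glue (snd v) p (snd w) q \<and>
     sym_diff (fst v) (fst w) \<subseteq> marks (snd v) p"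

lemma id_perms: "id \<in> perms" unfolding perms_def by (simp add: permutes_id)

lemma step_sites:
  assumes "j \<in> I" "v \<in> sites" shows "step j v \<in> sites"
proof -
  obtain A g where v: "v = (A, g)" "A \<subseteq> perms \<times> I" "g \<in> perms" "boundary fst tgt A = sym_diff {id} {g}"
    using assms(2) unfolding sites_def by blast
  have "boundary fst tgt (sym_diff A {(g, j)}) = sym_diff (sym_diff {id} {g}) (sym_diff {g} {\<gamma> j \<circ> g})"
    using boundary_sym_diff[OF finite_edges[OF v(2)], of "{(g, j)}" fst tgt] boundary_singleton[of fst tgt "(g, j)"] v(4) by simp
  also have "\<dots> = sym_diff {id} {\<gamma> j \<circ> g}" by blast
  finally show ?thesis unfolding sites_def step_def v(1) using v assms(1) perms_comp[OF perms_\<gamma>] by auto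
qed

lemma inj_shift_edge: "k \<in> perms \<Longrightarrow> inj (\<lambda>(r, i). (r \<circ> k, i))"
proof (rule injI)
  fix x y assume k: "k \<in> perms" and "(\<lambda>(r, i). (r \<circ> k, i)) x = (\<lambda>(r, i). (r \<circ> k, i)) y"
  then have *: "fst x \<circ> k = fst y \<circ> k" "snd x = snd y" by (auto simp: case_prod_beta)
  from *(1) have "fst x \<circ> k \<circ> inv k = fst y \<circ> k \<circ> inv k" by simp
  then show "x = y" using perms_inv(3)[OF k] *(2) by (simp add: comp_assoc prod_eq_iff)
qed

lemma shift_sites:
  assumes "j \<in> I" "v \<in> sites" shows "shift j v \<in> sites"
proof -
  obtain A g where v: "v = (A, g)" "A \<subseteq> perms \<times> I" "g \<in> perms" "boundary fst tgt A = sym_diff {id} {g}"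
    using assms(2) unfolding sites_def by blast
  note k = perms_\<gamma>[OF assms(1)]
  let ?h = "\<lambda>(r, i). (r \<circ> \<gamma> j, i)"
  have inj: "inj (\<lambda>r. r \<circ> \<gamma> j)"
  proof (rule injI)
    fix x y assume "x \<circ> \<gamma> j = y \<circ> \<gamma> j"
    then have "?h (x, j) = ?h (y, j)" by simp
    from injD[OF inj_shift_edge[OF k] this] show "x = y" by simp
  qed
  have im: "?h ` A \<subseteq> perms \<times> I" using v(2) perms_comp[OF _ k] by auto
  have "boundary fst tgt (?h ` A) = (\<lambda>r. r \<circ> \<gamma> j) ` boundary fst tgt A"
    by (rule boundary_image[where C = UNIV, OF finite_edges[OF v(2)] inj_on_subset[OF inj_shift_edge[OF k]] inj]) (auto simp: comp_assoc)
  also have "\<dots> = sym_diff {\<gamma> j} {g \<circ> \<gamma> j}"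
    unfolding v(4) using image_sym_diff_inj_on[OF inj, of "{id}" "{g}"] by simp
  finally have "boundary fst tgt (sym_diff {(id, j)} (?h ` A)) = sym_diff (sym_diff {id} {\<gamma> j}) (sym_diff {\<gamma> j} {g \<circ> \<gamma> j})"
    using boundary_sym_diff[OF _ finite_edges[OF im], of "{(id, j)}" fst tgt] boundary_singleton[of fst tgt "(id, j)"] by simp
  also have "\<dots> = sym_diff {id} {g \<circ> \<gamma> j}" by blast
  finally have bd: "boundary fst tgt (sym_diff {(id, j)} (?h ` A)) = sym_diff {id} {g \<circ> \<gamma> j}" .
  have "sym_diff {(id, j)} (?h ` A) \<subseteq> perms \<times> I" using im id_perms assms(1) by blast
  then show ?thesis
    unfolding sites_def shift_def v(1) fst_conv snd_conv mem_Collect_eq prod.case using bd perms_comp[OF v(3) k] by blast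
qed

lemma inj_on_shift:
  assumes "j \<in> I" shows "inj_on (shift j) sites"
proof (rule inj_onI)
  fix v w assume vw: "v \<in> sites" "w \<in> sites" "shift j v = shift j w"
  let ?h = "\<lambda>(r, i). (r \<circ> \<gamma> j, i)"
  note k = perms_\<gamma>[OF assms(1)]
  have 1: "sym_diff {(id, j)} (?h ` fst v) = sym_diff {(id, j)} (?h ` fst w)" and 2: "snd v \<circ> \<gamma> j = snd w \<circ> \<gamma> j"
    using vw(3) unfolding shift_def by auto
  from 1 have "?h ` fst v = ?h ` fst w" by blast
  then have "fst v = fst w" using inj_image_eq_iff[OF inj_shift_edge[OF k]] by blast
  moreover have "?h (snd v, j) = ?h (snd w, j)" using 2 by simp
  from injD[OF inj_shift_edge[OF k] this] have "snd v = snd w" by simp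
  ultimately show "v = w" by (simp add: prod_eq_iff)
qed

lemma finite_sites: "finite sites"
proof -
  have "sites \<subseteq> Pow (perms \<times> I) \<times> perms" unfolding sites_def by auto
  moreover have "finite perms" using finite_permutations[OF fin] unfolding perms_def .
  ultimately show ?thesis using finite_I by (meson finite_Pow_iff finite_SigmaI finite_subset)
qed

lemma sym_diff_edges:
  assumes "v \<in> sites" "w \<in> sites" shows "sym_diff (fst v) (fst w) \<subseteq> perms \<times> I"
  using assms unfolding sites_def by auto

lemma exact_glue_transfer: "cell_transfer Y (\<lambda>p q. exact_glue v p w q)"
proof (rule cell_transferI)
  fix c u q assume c: "c \<in> cells Y" "u \<in> open_cube (cdim Y c)" and g: "exact_glue v (chart Y c u) w q"
  have vw: "v \<in> sites" "w \<in> sites" and gl: "glue (snd v) (chart Y c u) (snd w) q"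
    and sd: "sym_diff (fst v) (fst w) \<subseteq> marks (snd v) (chart Y c u)"
    using g unfolding exact_glue_def by auto
  have "sym_diff (fst v) (fst w) \<subseteq> marks (snd v) (chart Y c x)" if x: "x \<in> cube (cdim Y c)" for x
  proof
    fix e assume e: "e \<in> sym_diff (fst v) (fst w)"
    then have "e \<in> perms \<times> I" using sym_diff_edges[OF vw] by blast
    from convex_setD(2)[OF marks_convex[OF _ this] c _ x] glue_sites[OF gl] sd e
    show "e \<in> marks (snd v) (chart Y c x)" by blast
  qed
  then show "\<exists>d g. d \<in> cells Y \<and> cdim Y d = cdim Y c \<and> face_map (cdim Y c) (cdim Y c) g \<and> q = chart Y d (g u) \<and>
      (\<forall>x\<in>cube (cdim Y c). exact_glue v (chart Y c x) w (chart Y d (g x)))"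
    using cell_transferE[OF glue_transfer c gl] vw unfolding exact_glue_def by metis
qed

text \<open>Let \<open>U\<close> be the set of edges in which the two sites differ. Each edge in \<open>U\<close> is marked at the half points
  of all edges at the corner, so by local convexity it is marked at \<open>p\<close>. Therefore the set \<open>N\<close> of
  copies glued to \<open>p\<close> contains both ends of an edge in \<open>U\<close> or none. The boundary of \<open>U\<close> consists of the
  two copies, and an even number of them lies in \<open>N\<close>.\<close>

lemma exact_glue_exact:
  assumes \<sigma>: "\<sigma> \<in> corners Y" and vw: "v \<in> sites" "w \<in> sites"
    and edges: "\<And>a. a \<in> corner_edges Y \<sigma> \<Longrightarrow> \<exists>b. exact_glue v a w b" and x: "x \<in> cube (cdim Y (fst \<sigma>))"
  shows "\<exists>y. exact_glue v (chart Y (fst \<sigma>) x) w y"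
proof -
  let ?p = "chart Y (fst \<sigma>) x" and ?U = "sym_diff (fst v) (fst w)" and ?g = "snd v"
  have g: "?g \<in> perms" "snd w \<in> perms" using vw unfolding sites_def by auto
  have U: "?U \<subseteq> marks ?g ?p"
  proof
    fix e assume e: "e \<in> ?U"
    then have "e \<in> perms \<times> I" using sym_diff_edges[OF vw] by blast
    then have cv: "convex_set Y {p. e \<in> marks ?g p}" using marks_convex g by blast
    have "corner_edges Y (fst \<sigma>, snd \<sigma>) \<subseteq> {p. e \<in> marks ?g p}" using edges e unfolding exact_glue_def by auto
    from convex_setD(3)[OF cv _ this x] \<sigma> show "e \<in> marks ?g ?p" by simp
  qed
  have p: "?p \<in> points Y" using chart_points[OF half_point_open(1)[OF \<sigma>] x] .
  define N where "N = {r. \<exists>q. glue ?g ?p r q}"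
  have "fst e \<in> N \<longleftrightarrow> tgt e \<in> N" if e: "e \<in> ?U" for e
  proof -
    obtain r j where rj: "e = (r, j)" "r \<in> perms" "j \<in> I" using e sym_diff_edges[OF vw] by blast
    obtain j' where j': "j' \<in> partial_isometries Y" "inverse_pair j j'" using inverse[OF rj(3)] by blast
    have em: "(r, j) \<in> marks ?g ?p" using U e rj(1) by blast
    show ?thesis
    proof
      assume "fst e \<in> N"
      then obtain q where q: "glue ?g ?p r q" unfolding N_def rj by auto
      then have "(r, j) \<in> marks r q" using em marks_glue by blast
      then obtain q' where "j q = Some q'" using marks_source[OF rj(2,3)] by blast
      then show "tgt e \<in> N" using glue.forward[OF q rj(3)] unfolding N_def rj by auto
    next
      assume "tgt e \<in> N"
      then obtain q where q: "glue ?g ?p (\<gamma> j \<circ> r) q" unfolding N_def rj by auto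
      then have "(r, j) \<in> marks (\<gamma> j \<circ> r) q" using em marks_glue by blast
      then obtain q' where "j' q = Some q'" using marks_target[OF rj(2,3) j'(2)] by blast
      then have "j q' = Some q" using j'(2) unfolding inverse_pair_def by blast
      then show "fst e \<in> N" using glue.backward[OF q rj(2,3)] unfolding N_def rj by auto
    qed
  qed
  then have even: "even (card (boundary fst tgt ?U \<inter> N))"
    by (rule even_boundary_Int[OF finite_edges[OF sym_diff_edges[OF vw]]])
  have "boundary fst tgt ?U = sym_diff (sym_diff {id} {?g}) (sym_diff {id} {snd w})"
    using vw boundary_sym_diff[of "fst v" "fst w" fst tgt] finite_edges unfolding sites_def by auto
  also have "\<dots> = sym_diff {?g} {snd w}" by blast
  finally have bd: "boundary fst tgt ?U = sym_diff {?g} {snd w}" .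
  have "?g \<in> N" unfolding N_def using glue.refl[OF g(1) p] by blast
  have "snd w \<in> N"
  proof (rule ccontr)
    assume "snd w \<notin> N"
    then have "boundary fst tgt ?U \<inter> N = {?g}" 
      unfolding bd using sym_diff_pair_Int[OF \<open>?g \<in> N\<close>] by blast
    then show False using even by simp
  qed
  then show ?thesis unfolding exact_glue_def N_def using vw U by blast
qed

lemma exact_glue_sym:
  assumes "exact_glue v p w q" shows "exact_glue w q v p"
  using assms glue_sym marks_glue unfolding exact_glue_def by blast

lemma exact_glue_trans:
  assumes "exact_glue u p v q" "exact_glue v q w r" shows "exact_glue u p w r"
  using assms glue_trans[of "snd u" p "snd v" q "snd w" r] marks_glue[of "snd u" p "snd v" q] unfolding exact_glue_def by blast

lemma exact_glue_shift:
  assumes "j \<in> I" "v \<in> sites" "w \<in> sites"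
  shows "exact_glue (shift j v) p (shift j w) q \<longleftrightarrow> exact_glue v p w q"
proof -
  let ?h = "\<lambda>(r, i). (r \<circ> \<gamma> j, i)"
  note k = perms_\<gamma>[OF assms(1)]
  have g: "snd v \<in> perms" using assms(2) unfolding sites_def by auto
  have "sym_diff (fst (shift j v)) (fst (shift j w)) = sym_diff (?h ` fst v) (?h ` fst w)"
    unfolding shift_def fst_conv by blast
  also have "\<dots> = ?h ` sym_diff (fst v) (fst w)"
    by (rule image_sym_diff_inj_on[OF inj_shift_edge[OF k], symmetric]) auto
  finally have "sym_diff (fst (shift j v)) (fst (shift j w)) \<subseteq> marks (snd (shift j v)) p \<longleftrightarrow>
      (\<forall>e\<in>sym_diff (fst v) (fst w). ?h e \<in> marks (snd v \<circ> \<gamma> j) p)"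
    by (simp only: image_subset_iff) (simp add: shift_def)
  also have "\<dots> \<longleftrightarrow> sym_diff (fst v) (fst w) \<subseteq> marks (snd v) p"
  proof -
    have "?h e \<in> marks (snd v \<circ> \<gamma> j) p \<longleftrightarrow> e \<in> marks (snd v) p" for e
      using marks_shift[OF k g, of "fst e" "snd e" p] by (simp add: case_prod_beta)
    then show ?thesis by (simp only: subset_iff Ball_def)
  qed
  finally show ?thesis
    unfolding exact_glue_def using shift_sites[OF assms(1)] assms glue_right_iff[OF k, of "snd v" p "snd w" q]
    by (simp add: shift_def)
qed

theorem exact_system: "exact_system Y I sites ({}, id) step shift exact_glue"
proof
  show "cube_complex Y" "finite I" "finite sites" by (rule cube_complex finite_I finite_sites)+
  show "j \<in> partial_isometries Y" if "j \<in> I" for j using iso that .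
  show "({}, id) \<in> sites" unfolding sites_def using id_perms by simp
  show "step j v \<in> sites" if "j \<in> I" "v \<in> sites" for j v using step_sites that .
  show "bij_betw (shift j) sites sites" if "j \<in> I" for j
    unfolding bij_betw_def using inj_on_shift[OF that] shift_sites[OF that] finite_sites
    by (simp add: endo_inj_surj image_subsetI)
  show "shift j (step i v) = step i (shift j v)" if "i \<in> I" "j \<in> I" "v \<in> sites" for i j v
  proof -
    have "(\<lambda>(r, i). (r \<circ> \<gamma> j, i)) ` sym_diff (fst v) {(snd v, i)} =
        sym_diff ((\<lambda>(r, i). (r \<circ> \<gamma> j, i)) ` fst v) {(snd v \<circ> \<gamma> j, i)}"
      using image_sym_diff_inj_on[OF inj_shift_edge[OF perms_\<gamma>[OF that(2)]], of "fst v" "{(snd v, i)}"] by simp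
    then show ?thesis unfolding shift_def step_def fst_conv snd_conv comp_assoc prod.inject by blast
  qed
  show "shift j ({}, id) = step j ({}, id)" if "j \<in> I" for j unfolding shift_def step_def by simp
  show "exact_glue (shift j v) p (shift j w) q \<longleftrightarrow> exact_glue v p w q" if "j \<in> I" "v \<in> sites" "w \<in> sites" for j v w p q
    using exact_glue_shift that .
  show "v \<in> sites \<and> p \<in> points Y" if "exact_glue v p w q" for v p w q
    using that glue_sites unfolding exact_glue_def by blast
  show "exact_glue v p v p" if "v \<in> sites" "p \<in> points Y" for v p
    using that glue.refl unfolding exact_glue_def sites_def by auto
  show "exact_glue w q v p" if "exact_glue v p w q" for v p w q using exact_glue_sym that .
  show "exact_glue u p w r" if "exact_glue u p v q" "exact_glue v q w r" for u p v q w r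
    using exact_glue_trans that .
  show "p = q" if "exact_glue v p v q" for v p q using that glue_unique unfolding exact_glue_def by blast
  show "cell_transfer Y (\<lambda>p q. exact_glue v p w q)" for v w by (rule exact_glue_transfer)
  show "exact_glue v p (step j v) q" if j: "j \<in> I" "v \<in> sites" "j p = Some q" for j v p q
  proof -
    have g: "snd v \<in> perms" using j(2) unfolding sites_def by auto
    have "glue (snd v) p (\<gamma> j \<circ> snd v) q" using glue.forward[OF glue.refl[OF g] j(1,3)] ran_points j by blast
    moreover have "(snd v, j) \<in> marks (snd v) p" using marks_source[OF g j(1)] j(3) by blast
    ultimately show ?thesis unfolding exact_glue_def using j step_sites unfolding step_def by auto
  qed
  show "\<exists>y. exact_glue v (chart Y (fst \<sigma>) x) w y"
    if "\<sigma> \<in> corners Y" "v \<in> sites" "w \<in> sites" "\<And>a. a \<in> corner_edges Y \<sigma> \<Longrightarrow> \<exists>b. exact_glue v a w b"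
      "x \<in> cube (cdim Y (fst \<sigma>))" for \<sigma> v w x
    using exact_glue_exact[OF that] .
qed

end

section \<open>Flag gluings\<close>

abbreviation corner_point :: "('c, 'p) cube_complex \<Rightarrow> 'c corner \<Rightarrow> 'p" where
  "corner_point Y \<sigma> \<equiv> chart Y (fst \<sigma>) (snd \<sigma>)"

text \<open>Partial copies of \<open>Y\<close> indexed by \<open>W\<close>: only the points in \<open>P w\<close> are present in the copy \<open>w\<close>, and \<open>E\<close>
  identifies points of copies. The last two assumptions say that the glued complex has simplicial and
  flag links, with its corners and edges represented in copies. An element of \<open>K\<close> represents an edge
  at the common vertex, given by a copy and a one-dimensional corner.\<close>

locale flag_gluing =
  fixes Y :: "('c, 'p) cube_complex" and W :: "'w set" and P :: "'w \<Rightarrow> 'p set"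
    and E :: "'w \<Rightarrow> 'p \<Rightarrow> 'w \<Rightarrow> 'p \<Rightarrow> bool"
  assumes Y: "cube_complex Y" and simplicial: "edge_simplicial Y"
    and finite_cells: "finite (cells Y)" and finite_copies: "finite W"
    and P_points: "P w \<subseteq> points Y"
    and P_closed: "w \<in> W \<Longrightarrow> c \<in> cells Y \<Longrightarrow> u \<in> open_cube (cdim Y c) \<Longrightarrow> chart Y c u \<in> P w \<Longrightarrow>
      x \<in> cube (cdim Y c) \<Longrightarrow> chart Y c x \<in> P w"
    and E_site: "E w p w' p' \<Longrightarrow> w \<in> W \<and> p \<in> P w"
    and E_refl: "w \<in> W \<Longrightarrow> p \<in> P w \<Longrightarrow> E w p w p"
    and E_sym: "E w p w' p' \<Longrightarrow> E w' p' w p"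
    and E_trans: "E w p w' p' \<Longrightarrow> E w' p' w'' p'' \<Longrightarrow> E w p w'' p''"
    and E_unique: "E w p w q \<Longrightarrow> p = q"
    and E_transfer: "cell_transfer Y (\<lambda>p q. E w p w' q)"
    and E_simplicial: "\<sigma> \<in> corners Y \<Longrightarrow> \<tau> \<in> corners Y \<Longrightarrow> w \<in> W \<Longrightarrow> w' \<in> W \<Longrightarrow> half_point Y \<sigma> \<in> P w \<Longrightarrow>
      half_point Y \<tau> \<in> P w' \<Longrightarrow> E w (corner_point Y \<sigma>) w' (corner_point Y \<tau>) \<Longrightarrow>
      (\<And>a. a \<in> corner_edges Y \<sigma> \<Longrightarrow> \<exists>b\<in>corner_edges Y \<tau>. E w a w' b) \<Longrightarrow>
      (\<And>b. b \<in> corner_edges Y \<tau> \<Longrightarrow> \<exists>a\<in>corner_edges Y \<sigma>. E w a w' b) \<Longrightarrow>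
      E w (half_point Y \<sigma>) w' (half_point Y \<tau>)"
    and E_flag: "finite K \<Longrightarrow> K \<noteq> {} \<Longrightarrow>
      (\<And>\<kappa>. \<kappa> \<in> K \<Longrightarrow> fst \<kappa> \<in> W \<and> snd \<kappa> \<in> corners Y \<and> cdim Y (fst (snd \<kappa>)) = 1 \<and> half_point Y (snd \<kappa>) \<in> P (fst \<kappa>)) \<Longrightarrow>
      (\<And>\<kappa> \<mu>. \<kappa> \<in> K \<Longrightarrow> \<mu> \<in> K \<Longrightarrow> E (fst \<kappa>) (corner_point Y (snd \<kappa>)) (fst \<mu>) (corner_point Y (snd \<mu>))) \<Longrightarrow>
      (\<And>\<kappa> \<mu>. \<kappa> \<in> K \<Longrightarrow> \<mu> \<in> K \<Longrightarrow> E (fst \<kappa>) (half_point Y (snd \<kappa>)) (fst \<mu>) (half_point Y (snd \<mu>)) \<or>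
        (\<exists>w \<tau> a b. w \<in> W \<and> \<tau> \<in> corners Y \<and> half_point Y \<tau> \<in> P w \<and> corner_edges Y \<tau> = {a, b} \<and>
          E (fst \<kappa>) (corner_point Y (snd \<kappa>)) w (corner_point Y \<tau>) \<and>
          E (fst \<kappa>) (half_point Y (snd \<kappa>)) w a \<and> E (fst \<mu>) (half_point Y (snd \<mu>)) w b)) \<Longrightarrow>
      \<exists>w \<rho>. w \<in> W \<and> \<rho> \<in> corners Y \<and> half_point Y \<rho> \<in> P w \<and>
        (\<forall>\<kappa>\<in>K. E (fst \<kappa>) (corner_point Y (snd \<kappa>)) w (corner_point Y \<rho>)) \<and>
        (\<forall>\<kappa>\<in>K. \<exists>b\<in>corner_edges Y \<rho>. E (fst \<kappa>) (half_point Y (snd \<kappa>)) w b) \<and>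
        (\<forall>b\<in>corner_edges Y \<rho>. \<exists>\<kappa>\<in>K. E (fst \<kappa>) (half_point Y (snd \<kappa>)) w b)"

section \<open>From exact systems to flag gluings\<close>

context exact_system
begin

abbreviation tgt where "tgt \<equiv> \<lambda>(r, j). step j r"

text \<open>The copies that contain the point \<open>p\<close> of the copy \<open>v\<close>.\<close>

definition nearby where "nearby v p = {r. \<exists>q. rel v p r q}"

text \<open>The edges that \<open>p\<close> can cross from a nearby copy. Both ends of such an edge are nearby
  (\<open>crossing_ends\<close>).\<close>

definition crossing where "crossing v p = {(r, j). j \<in> I \<and> (\<exists>q. rel v p r q \<and> q \<in> dom j)}"

text \<open>A nonempty set of copies attached to the decoration \<open>A\<close>, see \<open>anchor_nonempty\<close>. For the
  empty decoration it is the base copy alone, so that all points of the base copy are present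
  (\<open>present_base\<close>).\<close>

definition anchor where "anchor A = sym_diff {v0} (boundary fst tgt A)"

definition copies where "copies = {(A, v). A \<subseteq> V \<times> I \<and> v \<in> V}"

definition present where "present w = {p \<in> points Y. anchor (fst w) \<subseteq> nearby (snd w) p}"

definition same where
  "same w p w' p' \<longleftrightarrow> w \<in> copies \<and> w' \<in> copies \<and> rel (snd w) p (snd w') p' \<and> p \<in> present w \<and>
     sym_diff (fst w) (fst w') \<subseteq> crossing (snd w) p"

text \<open>The edge from the base copy is added for two reasons: it compensates the change of \<open>v0\<close> in \<open>anchor\<close>
  (\<open>anchor_move\<close>), and among the points of the base copy it is crossed exactly by those of \<open>dom j\<close>.\<close>

definition move where
  "move j w = (sym_diff {(v0, j)} ((\<lambda>(r, i). (shift j r, i)) ` fst w), shift j (snd w))"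

lemma rel_target: "rel v p w q \<Longrightarrow> w \<in> V \<and> q \<in> points Y"
  using rel_sym rel_site by blast

lemma rel_det: "rel v p w q \<Longrightarrow> rel v p w q' \<Longrightarrow> q = q'"
  using rel_sym rel_trans rel_unique by blast

lemma rel_right_unique: "right_unique (\<lambda>p q. rel v p w q)"
  unfolding right_unique_def using rel_det by blast

lemma nearby_rel: "rel v p w q \<Longrightarrow> nearby v p = nearby w q"
  unfolding nearby_def using rel_sym rel_trans by blast

lemma crossing_rel: "rel v p w q \<Longrightarrow> crossing v p = crossing w q"
  unfolding crossing_def using rel_sym rel_trans by blast

lemma crossing_ends:
  assumes "e \<in> crossing v p" shows "fst e \<in> nearby v p" "tgt e \<in> nearby v p"
proof -
  obtain r j q q' where e: "e = (r, j)" "j \<in> I" "rel v p r q" "j q = Some q'"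
    using assms unfolding crossing_def by blast
  have "rel r q (step j r) q'" using rel_step[OF e(2) _ e(4)] rel_target[OF e(3)] by blast
  then show "fst e \<in> nearby v p" "tgt e \<in> nearby v p"
    using e rel_trans[OF e(3)] unfolding nearby_def by auto
qed

lemma finite_edges: "A \<subseteq> V \<times> I \<Longrightarrow> finite A"
  using finite_subset finite_cartesian_product[OF finite_sites finite_isometries] by blast

lemma anchor_sites: "A \<subseteq> V \<times> I \<Longrightarrow> anchor A \<subseteq> V"
  using boundary_subset[of fst tgt A] base_site step_site unfolding anchor_def by fastforce

lemma anchor_nonempty:
  assumes "A \<subseteq> V \<times> I" shows "anchor A \<noteq> {}"
proof -
  have "even (card (boundary fst tgt A \<inter> UNIV))"
    by (rule even_boundary_Int[OF finite_edges[OF assms]]) simp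
  moreover have "finite (boundary fst tgt A)"
    using boundary_subset[of fst tgt A] finite_edges[OF assms] by (meson finite_UnI finite_imageI finite_subset)
  ultimately have "odd (card (anchor A))"
    using odd_card_sym_diff[of "{v0}" "boundary fst tgt A"] unfolding anchor_def by simp
  then show ?thesis by auto
qed

text \<open>Decorations that differ by edges crossing \<open>p\<close> have anchors that differ by copies near \<open>p\<close>; so presence
  of a point does not depend on the copy that represents it.\<close>

lemma anchor_nearby:
  assumes AB: "A \<subseteq> V \<times> I" "B \<subseteq> V \<times> I" and sd: "sym_diff A B \<subseteq> crossing v p" and A: "anchor A \<subseteq> nearby v p"
  shows "anchor B \<subseteq> nearby v p"
proof -
  have "sym_diff (boundary fst tgt A) (boundary fst tgt B) \<subseteq> nearby v p"
    by (rule boundary_subset_sym_diff[OF AB[THEN finite_edges]]) (use crossing_ends sd in blast)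
  then show ?thesis using A unfolding anchor_def by blast
qed

lemma nearby_cell:
  assumes "c \<in> cells Y" "u \<in> open_cube (cdim Y c)" "x \<in> cube (cdim Y c)"
  shows "nearby v (chart Y c u) \<subseteq> nearby v (chart Y c x)"
proof
  fix r assume "r \<in> nearby v (chart Y c u)"
  then obtain q where q: "rel v (chart Y c u) r q" unfolding nearby_def by blast
  obtain d g where "\<And>w. w \<in> cube (cdim Y c) \<Longrightarrow> rel v (chart Y c w) r (chart Y d (g w))"
    by (rule cell_transferE[OF rel_transfer assms(1,2) q]) blast
  then show "r \<in> nearby v (chart Y c x)" using assms(3) unfolding nearby_def by blast
qed

lemma crossing_cell:
  assumes c: "c \<in> cells Y" "u \<in> open_cube (cdim Y c)" and x: "x \<in> cube (cdim Y c)"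
  shows "crossing v (chart Y c u) \<subseteq> crossing v (chart Y c x)"
proof
  fix e assume "e \<in> crossing v (chart Y c u)"
  then obtain r j q where e: "e = (r, j)" "j \<in> I" and q: "rel v (chart Y c u) r q" "q \<in> dom j"
    unfolding crossing_def by blast
  obtain d g where d: "d \<in> cells Y" "cdim Y d = cdim Y c" "face_map (cdim Y c) (cdim Y c) g" "q = chart Y d (g u)"
      "\<And>w. w \<in> cube (cdim Y c) \<Longrightarrow> rel v (chart Y c w) r (chart Y d (g w))"
    by (rule cell_transferE[OF rel_transfer c q(1)]) blast
  have "g u \<in> open_cube (cdim Y d)" "g x \<in> cube (cdim Y d)"
    using face_map_self_open[OF d(3) c(2)] face_map_cube[OF d(3) x] d(2) by auto
  then have "chart Y d (g x) \<in> dom j"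
    using convex_setD(2)[OF partial_isometriesD(1)[OF isometries[OF e(2)]] d(1)] q(2) d(4) by blast
  then show "e \<in> crossing v (chart Y c x)" using e d(5)[OF x] unfolding crossing_def by blast
qed

lemma same_sym:
  assumes "same w p w' p'" shows "same w' p' w p"
proof -
  have r: "rel (snd w) p (snd w') p'" using assms unfolding same_def by blast
  have "anchor (fst w') \<subseteq> nearby (snd w) p"
    by (rule anchor_nearby[of "fst w"]) (use assms in \<open>auto simp: same_def copies_def present_def\<close>)
  then have "p' \<in> present w'" using nearby_rel[OF r] rel_target[OF r] unfolding present_def by blast
  then show ?thesis using assms crossing_rel[OF r] rel_sym[OF r] unfolding same_def by blast
qed

lemma same_trans:
  assumes "same w p w' p'" "same w' p' w'' p''" shows "same w p w'' p''"
  using assms rel_trans[of "snd w" p "snd w'" p' "snd w''" p''] crossing_rel[of "snd w" p "snd w'" p']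
  unfolding same_def by blast

lemma same_refl: "w \<in> copies \<Longrightarrow> p \<in> present w \<Longrightarrow> same w p w p"
  using rel_refl unfolding same_def copies_def present_def by auto

lemma same_det: "same w p w' q \<Longrightarrow> same w p w' q' \<Longrightarrow> q = q'"
  unfolding same_def using rel_det by blast

lemma same_right_unique: "right_unique (\<lambda>p q. same w p w' q)"
  unfolding right_unique_def using same_det by blast

lemma same_rel: "same w p w' q \<Longrightarrow> rel (snd w) p (snd w') q"
  unfolding same_def by blast

lemma same_crossing: "same w p w' q \<Longrightarrow> sym_diff (fst w) (fst w') \<subseteq> crossing (snd w) p"
  unfolding same_def by blast

lemma present_closed:
  assumes "c \<in> cells Y" "u \<in> open_cube (cdim Y c)" "chart Y c u \<in> present w" "x \<in> cube (cdim Y c)"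
  shows "chart Y c x \<in> present w"
  using assms(3) nearby_cell[OF assms(1,2,4)] chart_points[OF assms(1,4)] unfolding present_def by blast

lemma same_transfer: "cell_transfer Y (\<lambda>p q. same w p w' q)"
proof (rule cell_transferI)
  fix c u q assume c: "c \<in> cells Y" "u \<in> open_cube (cdim Y c)" and s: "same w (chart Y c u) w' q"
  obtain d g where d: "d \<in> cells Y" "cdim Y d = cdim Y c" "face_map (cdim Y c) (cdim Y c) g" "q = chart Y d (g u)"
      "\<And>x. x \<in> cube (cdim Y c) \<Longrightarrow> rel (snd w) (chart Y c x) (snd w') (chart Y d (g x))"
    by (rule cell_transferE[OF rel_transfer c same_rel[OF s]]) blast
  have "same w (chart Y c x) w' (chart Y d (g x))" if x: "x \<in> cube (cdim Y c)" for x
    using s d(5)[OF x] present_closed[OF c _ x] crossing_cell[OF c x] unfolding same_def by blast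
  then show "\<exists>d g. d \<in> cells Y \<and> cdim Y d = cdim Y c \<and> face_map (cdim Y c) (cdim Y c) g \<and> q = chart Y d (g u) \<and>
      (\<forall>x\<in>cube (cdim Y c). same w (chart Y c x) w' (chart Y d (g x)))" using d(1-4) by blast
qed

lemma half_point_chart: "\<sigma> \<in> corners Y \<Longrightarrow> half (cdim Y (fst \<sigma>)) (snd \<sigma>) \<in> cube (cdim Y (fst \<sigma>))"
  using half_point_open(2) open_cube_sub by blast

lemma half_point_points: "\<sigma> \<in> corners Y \<Longrightarrow> half_point Y \<sigma> \<in> points Y"
  unfolding half_point_def using chart_points[OF half_point_open(1) half_point_chart] by blast

lemma exact_half:
  assumes "\<sigma> \<in> corners Y" "v \<in> V" "w \<in> V" "\<And>a. a \<in> corner_edges Y \<sigma> \<Longrightarrow> \<exists>b. rel v a w b"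
  obtains q where "rel v (half_point Y \<sigma>) w q"
  using exact[OF assms half_point_chart[OF assms(1)]] unfolding half_point_def by blast

text \<open>Corners with the same edges share their whole cube by exactness, and since \<open>Y\<close> is simplicial the second
  corner is the image of the first. It remains to see that an edge crossing all half points at a corner
  crosses the cube: the cube is carried by exactness to the copy \<open>r\<close>, where \<open>dom j\<close> is locally convex.\<close>

lemma same_simplicial:
  assumes simp: "edge_simplicial Y" and \<sigma>: "\<sigma> \<in> corners Y" and \<tau>: "\<tau> \<in> corners Y" and w: "w \<in> copies" "w' \<in> copies"
    and half: "half_point Y \<sigma> \<in> present w" and vert: "same w (corner_point Y \<sigma>) w' (corner_point Y \<tau>)"
    and e1: "\<And>a. a \<in> corner_edges Y \<sigma> \<Longrightarrow> \<exists>b\<in>corner_edges Y \<tau>. same w a w' b"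
    and e2: "\<And>b. b \<in> corner_edges Y \<tau> \<Longrightarrow> \<exists>a\<in>corner_edges Y \<sigma>. same w a w' b"
  shows "same w (half_point Y \<sigma>) w' (half_point Y \<tau>)"
proof -
  have v: "snd w \<in> V" "snd w' \<in> V" using w unfolding copies_def by auto
  obtain q where q: "rel (snd w) (half_point Y \<sigma>) (snd w') q"
    by (rule exact_half[OF \<sigma> v]) (use e1 same_rel in blast)+
  obtain \<upsilon> where \<upsilon>: "\<upsilon> \<in> corners Y" and "cdim Y (fst \<upsilon>) = cdim Y (fst \<sigma>)" and \<upsilon>2: "half_point Y \<upsilon> = q"
      "rel (snd w) (corner_point Y \<sigma>) (snd w') (corner_point Y \<upsilon>)"
      "\<forall>a\<in>corner_edges Y \<sigma>. \<exists>b\<in>corner_edges Y \<upsilon>. rel (snd w) a (snd w') b"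
      "\<forall>b\<in>corner_edges Y \<upsilon>. \<exists>a\<in>corner_edges Y \<sigma>. rel (snd w) a (snd w') b"
    using corner_transfer[OF rel_transfer rel_right_unique \<sigma> q] by blast
  note \<upsilon> = \<upsilon> \<upsilon>2
  have "corner_edges Y \<upsilon> = corner_edges Y \<tau>"
  proof (intro equalityI subsetI)
    fix b assume "b \<in> corner_edges Y \<upsilon>"
    then obtain a where a: "a \<in> corner_edges Y \<sigma>" "rel (snd w) a (snd w') b" using \<upsilon>(5) by blast
    then show "b \<in> corner_edges Y \<tau>" using e1[OF a(1)] same_rel rel_det by blast
  next
    fix b assume "b \<in> corner_edges Y \<tau>"
    then obtain a where a: "a \<in> corner_edges Y \<sigma>" "rel (snd w) a (snd w') b" using e2 same_rel by blast
    then show "b \<in> corner_edges Y \<upsilon>" using bspec[OF \<upsilon>(4) a(1)] rel_det by blast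
  qed
  moreover have "corner_point Y \<upsilon> = corner_point Y \<tau>" using \<upsilon>(3) same_rel[OF vert] rel_det by blast
  ultimately have "\<upsilon> = \<tau>" using simp \<upsilon>(1) \<tau> unfolding edge_simplicial_def by blast
  then have rel: "rel (snd w) (half_point Y \<sigma>) (snd w') (half_point Y \<tau>)" using q \<upsilon>(2) by simp
  have "sym_diff (fst w) (fst w') \<subseteq> crossing (snd w) (half_point Y \<sigma>)"
  proof
    fix e assume e: "e \<in> sym_diff (fst w) (fst w')"
    obtain r j where rj: "e = (r, j)" "r \<in> V" "j \<in> I" using e w unfolding copies_def by auto
    have cr: "\<exists>b. rel (snd w) a r b \<and> b \<in> dom j" if "a \<in> corner_edges Y \<sigma>" for a
      using e1[OF that] same_crossing e rj(1) unfolding crossing_def by blast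
    obtain p where p: "rel (snd w) (half_point Y \<sigma>) r p"
      by (rule exact_half[OF \<sigma> v(1) rj(2)]) (use cr in blast)+
    obtain \<rho> where \<rho>1: "\<rho> \<in> corners Y" and "cdim Y (fst \<rho>) = cdim Y (fst \<sigma>)" and \<rho>2: "half_point Y \<rho> = p"
        and "rel (snd w) (corner_point Y \<sigma>) r (corner_point Y \<rho>)"
        and "\<forall>a\<in>corner_edges Y \<sigma>. \<exists>b\<in>corner_edges Y \<rho>. rel (snd w) a r b"
        and \<rho>3: "\<forall>b\<in>corner_edges Y \<rho>. \<exists>a\<in>corner_edges Y \<sigma>. rel (snd w) a r b"
      using corner_transfer[OF rel_transfer rel_right_unique \<sigma> p] by blast
    note \<rho> = \<rho>1 \<rho>2 \<rho>3
    have "corner_edges Y \<rho> \<subseteq> dom j"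
    proof
      fix b assume "b \<in> corner_edges Y \<rho>"
      then obtain a where a: "a \<in> corner_edges Y \<sigma>" "rel (snd w) a r b" using \<rho>(3) by blast
      obtain b' where "rel (snd w) a r b'" "b' \<in> dom j" using cr[OF a(1)] by blast
      then show "b \<in> dom j" using rel_det[OF a(2)] by blast
    qed
    then have "half_point Y \<rho> \<in> dom j"
      using convex_setD(3)[OF partial_isometriesD(1)[OF isometries[OF rj(3)]], of "fst \<rho>" "snd \<rho>",
          OF _ _ half_point_chart[OF \<rho>(1)]] \<rho>(1)
      unfolding half_point_def prod.collapse by blast
    then show "e \<in> crossing (snd w) (half_point Y \<sigma>)" using p \<rho>(2) rj unfolding crossing_def by blast
  qed
  then show ?thesis using rel half w unfolding same_def by blast
qed

text \<open>The edges are represented by half points \<open>a \<kappa>\<close> in copies \<open>(A \<kappa>, v \<kappa>)\<close>. If \<open>\<kappa>\<close> and \<open>\<mu>\<close> span a square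
  in some third copy, then the decoration of this copy agrees with \<open>A \<kappa>\<close> and with \<open>A \<mu>\<close> outside \<open>G \<kappa>\<close> and
  \<open>G \<mu>\<close>. So the decorations \<open>A \<kappa>\<close> can be merged into a decoration \<open>B\<close> that differs from each of them only
  by edges crossing \<open>a \<kappa>\<close>. Any \<open>h\<close> in the anchor of \<open>B\<close> contains all \<open>a \<kappa>\<close>, and by exactness also the
  squares. Flagness of \<open>Y\<close> gives a corner \<open>\<rho>\<close> in the copy \<open>h\<close>, and the copy \<open>(B, h)\<close> contains it: each
  member of the anchor of \<open>B\<close> contains all edges of \<open>\<rho>\<close>, hence, again by exactness, the cube of \<open>\<rho>\<close>.\<close>

lemma same_flag:
  assumes flag: "edge_flag Y" and K: "finite K" "K \<noteq> {}"
    and sites: "\<And>\<kappa>. \<kappa> \<in> K \<Longrightarrow> fst \<kappa> \<in> copies \<and> snd \<kappa> \<in> corners Y \<and> cdim Y (fst (snd \<kappa>)) = 1 \<and> half_point Y (snd \<kappa>) \<in> present (fst \<kappa>)"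
    and verts: "\<And>\<kappa> \<mu>. \<kappa> \<in> K \<Longrightarrow> \<mu> \<in> K \<Longrightarrow> same (fst \<kappa>) (corner_point Y (snd \<kappa>)) (fst \<mu>) (corner_point Y (snd \<mu>))"
    and squares: "\<And>\<kappa> \<mu>. \<kappa> \<in> K \<Longrightarrow> \<mu> \<in> K \<Longrightarrow> same (fst \<kappa>) (half_point Y (snd \<kappa>)) (fst \<mu>) (half_point Y (snd \<mu>)) \<or>
        (\<exists>w \<tau> a b. w \<in> copies \<and> \<tau> \<in> corners Y \<and> half_point Y \<tau> \<in> present w \<and> corner_edges Y \<tau> = {a, b} \<and>
          same (fst \<kappa>) (corner_point Y (snd \<kappa>)) w (corner_point Y \<tau>) \<and>
          same (fst \<kappa>) (half_point Y (snd \<kappa>)) w a \<and> same (fst \<mu>) (half_point Y (snd \<mu>)) w b)"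
  shows "\<exists>w \<rho>. w \<in> copies \<and> \<rho> \<in> corners Y \<and> half_point Y \<rho> \<in> present w \<and>
        (\<forall>\<kappa>\<in>K. same (fst \<kappa>) (corner_point Y (snd \<kappa>)) w (corner_point Y \<rho>)) \<and>
        (\<forall>\<kappa>\<in>K. \<exists>b\<in>corner_edges Y \<rho>. same (fst \<kappa>) (half_point Y (snd \<kappa>)) w b) \<and>
        (\<forall>b\<in>corner_edges Y \<rho>. \<exists>\<kappa>\<in>K. same (fst \<kappa>) (half_point Y (snd \<kappa>)) w b)"
proof -
  define A where "A \<kappa> = fst (fst \<kappa>)" for \<kappa> :: "(('v \<times> ('p \<rightharpoonup> 'p)) set \<times> 'v) \<times> 'c corner"
  define v where "v \<kappa> = snd (fst \<kappa>)" for \<kappa> :: "(('v \<times> ('p \<rightharpoonup> 'p)) set \<times> 'v) \<times> 'c corner"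
  define a where "a \<kappa> = half_point Y (snd \<kappa>)" for \<kappa> :: "(('v \<times> ('p \<rightharpoonup> 'p)) set \<times> 'v) \<times> 'c corner"
  define G where "G \<kappa> = crossing (v \<kappa>) (a \<kappa>)" for \<kappa>
  have AV: "A \<kappa> \<subseteq> V \<times> I" "v \<kappa> \<in> V" if "\<kappa> \<in> K" for \<kappa>
    using sites[OF that] unfolding A_def v_def copies_def by auto
  have agree: "e \<in> A \<kappa> \<longleftrightarrow> e \<in> A \<mu>" if "\<kappa> \<in> K" "\<mu> \<in> K" "e \<notin> G \<kappa>" "e \<notin> G \<mu>" for e \<kappa> \<mu>
  proof -
    from squares[OF that(1,2)] show ?thesis
    proof
      assume "same (fst \<kappa>) (half_point Y (snd \<kappa>)) (fst \<mu>) (half_point Y (snd \<mu>))"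
      from same_crossing[OF this] show ?thesis using that(3) unfolding G_def A_def v_def a_def by blast
    next
      assume "\<exists>w \<tau> x y. w \<in> copies \<and> \<tau> \<in> corners Y \<and> half_point Y \<tau> \<in> present w \<and> corner_edges Y \<tau> = {x, y} \<and>
          same (fst \<kappa>) (corner_point Y (snd \<kappa>)) w (corner_point Y \<tau>) \<and>
          same (fst \<kappa>) (half_point Y (snd \<kappa>)) w x \<and> same (fst \<mu>) (half_point Y (snd \<mu>)) w y"
      then obtain w x y where "same (fst \<kappa>) (half_point Y (snd \<kappa>)) w x" "same (fst \<mu>) (half_point Y (snd \<mu>)) w y"
        by blast
      from same_crossing[OF this(1)] same_crossing[OF this(2)]
      show ?thesis using that(3,4) unfolding G_def A_def v_def a_def by blast
    qed
  qed
  \<comment> \<open>Edges lying in all \<open>G \<kappa>\<close> may be in \<open>B\<close> or not; membership of the others is forced by \<open>agree\<close>.\<close>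
  define B where "B = {e. \<exists>\<kappa>\<in>K. e \<in> A \<kappa> \<and> e \<notin> G \<kappa>}"
  have B: "B \<subseteq> V \<times> I" unfolding B_def using AV by blast
  have BA: "sym_diff (A \<kappa>) B \<subseteq> G \<kappa>" if "\<kappa> \<in> K" for \<kappa>
    using agree[OF that] that unfolding B_def by blast
  have anchorB: "anchor B \<subseteq> nearby (v \<kappa>) (a \<kappa>)" if "\<kappa> \<in> K" for \<kappa>
  proof (rule anchor_nearby[OF AV(1)[OF that] B BA[OF that, unfolded G_def]])
    show "anchor (A \<kappa>) \<subseteq> nearby (v \<kappa>) (a \<kappa>)" using sites[OF that] unfolding present_def A_def v_def a_def by blast
  qed
  \<comment> \<open>Here it matters that anchors are sets of odd size.\<close>
  obtain h where h: "h \<in> anchor B" using anchor_nonempty[OF B] by blast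
  have hV: "h \<in> V" using h anchor_sites[OF B] by blast
  have "\<exists>\<upsilon>. \<upsilon> \<in> corners Y \<and> cdim Y (fst \<upsilon>) = 1 \<and> rel (v \<kappa>) (a \<kappa>) h (half_point Y \<upsilon>) \<and>
      rel (v \<kappa>) (corner_point Y (snd \<kappa>)) h (corner_point Y \<upsilon>)" if \<kappa>: "\<kappa> \<in> K" for \<kappa>
  proof -
    obtain q where q: "rel (v \<kappa>) (half_point Y (snd \<kappa>)) h q"
      using h anchorB[OF \<kappa>] unfolding nearby_def a_def by blast
    have c: "snd \<kappa> \<in> corners Y" "cdim Y (fst (snd \<kappa>)) = 1" using sites[OF \<kappa>] by auto
    obtain \<upsilon> where "\<upsilon> \<in> corners Y" "cdim Y (fst \<upsilon>) = cdim Y (fst (snd \<kappa>))" "half_point Y \<upsilon> = q"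
        "rel (v \<kappa>) (corner_point Y (snd \<kappa>)) h (corner_point Y \<upsilon>)"
        "\<forall>a\<in>corner_edges Y (snd \<kappa>). \<exists>b\<in>corner_edges Y \<upsilon>. rel (v \<kappa>) a h b"
        "\<forall>b\<in>corner_edges Y \<upsilon>. \<exists>a\<in>corner_edges Y (snd \<kappa>). rel (v \<kappa>) a h b"
      using corner_transfer[OF rel_transfer rel_right_unique c(1) q] by blast
    then show ?thesis using q c(2) unfolding a_def by (intro exI[of _ \<upsilon>]) simp
  qed
  then obtain s where s: "\<And>\<kappa>. \<kappa> \<in> K \<Longrightarrow> s \<kappa> \<in> corners Y" "\<And>\<kappa>. \<kappa> \<in> K \<Longrightarrow> cdim Y (fst (s \<kappa>)) = 1"
      "\<And>\<kappa>. \<kappa> \<in> K \<Longrightarrow> rel (v \<kappa>) (a \<kappa>) h (half_point Y (s \<kappa>))"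
      "\<And>\<kappa>. \<kappa> \<in> K \<Longrightarrow> rel (v \<kappa>) (corner_point Y (snd \<kappa>)) h (corner_point Y (s \<kappa>))" by metis
  obtain \<kappa>0 where \<kappa>0: "\<kappa>0 \<in> K" using K(2) by blast
  define z where "z = corner_point Y (s \<kappa>0)"
  have z: "corner_point Y (s \<kappa>) = z" if "\<kappa> \<in> K" for \<kappa>
  proof -
    have "rel (v \<kappa>) (corner_point Y (snd \<kappa>)) (v \<kappa>0) (corner_point Y (snd \<kappa>0))"
      using same_rel[OF verts[OF that \<kappa>0]] unfolding v_def .
    from rel_det[OF s(4)[OF that] rel_trans[OF this s(4)[OF \<kappa>0]]] show ?thesis unfolding z_def .
  qed
  let ?C = "(\<lambda>\<kappa>. half_point Y (s \<kappa>)) ` K"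
  have link: "s \<kappa> \<in> link Y z" if "\<kappa> \<in> K" for \<kappa> 
    unfolding link_corners using s(1)[OF that] z[OF that] by (rule conjI)
  have sq: "\<exists>\<tau>\<in>link Y z. corner_edges Y \<tau> = {x, y}" if xy: "x \<in> ?C" "y \<in> ?C" "x \<noteq> y" for x y
  proof -
    obtain \<kappa> where \<kappa>: "\<kappa> \<in> K" "x = half_point Y (s \<kappa>)" using xy(1) by (rule imageE)
    obtain \<mu> where \<mu>: "\<mu> \<in> K" "y = half_point Y (s \<mu>)" using xy(2) by (rule imageE)
    have "\<not> same (fst \<kappa>) (half_point Y (snd \<kappa>)) (fst \<mu>) (half_point Y (snd \<mu>))"
    proof
      assume "same (fst \<kappa>) (half_point Y (snd \<kappa>)) (fst \<mu>) (half_point Y (snd \<mu>))"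
      then have "rel (v \<kappa>) (a \<kappa>) (v \<mu>) (a \<mu>)" unfolding v_def a_def by (rule same_rel)
      from rel_det[OF s(3)[OF \<kappa>(1)] rel_trans[OF this s(3)[OF \<mu>(1)]]] have "x = y" unfolding \<kappa>(2) \<mu>(2) .
      then show False using xy(3) by blast
    qed
    then obtain w \<tau> a' b' where w: "w \<in> copies" "\<tau> \<in> corners Y" "corner_edges Y \<tau> = {a', b'}"
        "same (fst \<kappa>) (corner_point Y (snd \<kappa>)) w (corner_point Y \<tau>)"
        "same (fst \<kappa>) (half_point Y (snd \<kappa>)) w a'" "same (fst \<mu>) (half_point Y (snd \<mu>)) w b'"
      using squares[OF \<kappa>(1) \<mu>(1)] by blast
    have ra: "rel (snd w) a' h x" using rel_trans[OF rel_sym[OF same_rel[OF w(5)]]] s(3)[OF \<kappa>(1)] \<kappa>(2) unfolding v_def a_def by blast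
    have rb: "rel (snd w) b' h y" using rel_trans[OF rel_sym[OF same_rel[OF w(6)]]] s(3)[OF \<mu>(1)] \<mu>(2) unfolding v_def a_def by blast
    have wV: "snd w \<in> V" using w(1) unfolding copies_def by auto
    have "\<exists>b. rel (snd w) e h b" if "e \<in> corner_edges Y \<tau>" for e
    proof -
      have "e = a' \<or> e = b'" using that unfolding w(3) by blast
      then show ?thesis using ra rb by blast
    qed
    then obtain q where q: "rel (snd w) (half_point Y \<tau>) h q" using exact_half[OF w(2) wV hV] by blast
    obtain \<upsilon> where \<upsilon>1: "\<upsilon> \<in> corners Y" and "cdim Y (fst \<upsilon>) = cdim Y (fst \<tau>)" and "half_point Y \<upsilon> = q"
        and \<upsilon>2: "rel (snd w) (corner_point Y \<tau>) h (corner_point Y \<upsilon>)"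
        "\<forall>a\<in>corner_edges Y \<tau>. \<exists>b\<in>corner_edges Y \<upsilon>. rel (snd w) a h b"
        "\<forall>b\<in>corner_edges Y \<upsilon>. \<exists>a\<in>corner_edges Y \<tau>. rel (snd w) a h b"
      using corner_transfer[OF rel_transfer rel_right_unique w(2) q] by blast
    note \<upsilon> = \<upsilon>1 \<upsilon>2
    have "corner_edges Y \<upsilon> = {x, y}"
    proof (intro equalityI subsetI)
      fix b assume "b \<in> corner_edges Y \<upsilon>"
      then obtain e where e: "e = a' \<or> e = b'" "rel (snd w) e h b" using \<upsilon>(4) w(3) by blast
      then show "b \<in> {x, y}" using rel_det[OF e(2)] ra rb by blast
    next
      fix b assume b: "b \<in> {x, y}"
      have "x \<in> corner_edges Y \<upsilon>" using bspec[OF \<upsilon>(3), of a'] rel_det[OF ra] w(3) by blast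
      moreover have "y \<in> corner_edges Y \<upsilon>" using bspec[OF \<upsilon>(3), of b'] rel_det[OF rb] w(3) by blast
      ultimately show "b \<in> corner_edges Y \<upsilon>" using b by blast
    qed
    moreover have "corner_point Y \<upsilon> = z"
    proof -
      have "rel (v \<kappa>) (corner_point Y (snd \<kappa>)) h (corner_point Y \<upsilon>)"
        using rel_trans[OF same_rel[OF w(4)] \<upsilon>(2)] unfolding v_def .
      from rel_det[OF this s(4)[OF \<kappa>(1)]] show ?thesis unfolding z[OF \<kappa>(1)] .
    qed
    moreover have "\<upsilon> \<in> link Y z" unfolding link_corners using \<upsilon>(1) calculation(2) by (rule conjI)
    ultimately show ?thesis by blast
  qed
  have dim: "\<exists>\<sigma>\<in>link Y z. cdim Y (fst \<sigma>) = 1 \<and> half_point Y \<sigma> = x" if x: "x \<in> ?C" for x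
  proof -
    obtain \<kappa> where \<kappa>: "\<kappa> \<in> K" "x = half_point Y (s \<kappa>)" using x by (rule imageE)
    then show ?thesis using link[OF \<kappa>(1)] s(2)[OF \<kappa>(1)] by blast
  qed
  have "\<exists>\<rho>\<in>link Y z. corner_edges Y \<rho> = ?C"
    by (rule mp[OF spec[OF spec[OF flag[unfolded edge_flag_def], of z], of ?C]])
       (intro conjI ballI impI sq dim finite_imageI K; simp add: K)
  then obtain \<rho> where \<rho>: "\<rho> \<in> link Y z" "corner_edges Y \<rho> = ?C" by (rule bexE)
  have \<rho>c: "\<rho> \<in> corners Y" "corner_point Y \<rho> = z" using \<rho>(1) unfolding link_corners by simp_all
  let ?w = "(B, h)"
  have w: "?w \<in> copies" unfolding copies_def using B hV by simp
  have present: "half_point Y \<rho> \<in> present ?w"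
  proof -
    have "r \<in> nearby h (half_point Y \<rho>)" if r: "r \<in> anchor B" for r
    proof -
      have "\<exists>c. rel h b r c" if b: "b \<in> corner_edges Y \<rho>" for b
      proof -
        obtain \<kappa> where \<kappa>: "\<kappa> \<in> K" "b = half_point Y (s \<kappa>)" using b \<rho>(2) by blast
        then show ?thesis using anchorB[OF \<kappa>(1)] r nearby_rel[OF s(3)[OF \<kappa>(1)]] unfolding nearby_def by blast
      qed
      moreover have "r \<in> V" using r anchor_sites[OF B] by blast
      ultimately obtain q where "rel h (half_point Y \<rho>) r q" using exact_half[OF \<rho>c(1) hV] by blast
      then show ?thesis unfolding nearby_def by blast
    qed
    then show ?thesis unfolding present_def using half_point_points[OF \<rho>c(1)] by auto
  qed
  have edge: "same (fst \<kappa>) (half_point Y (snd \<kappa>)) ?w (half_point Y (s \<kappa>))" if "\<kappa> \<in> K" for \<kappa>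
    unfolding same_def using sites[OF that] w s(3)[OF that] BA[OF that] unfolding A_def v_def a_def G_def by simp
  have vert: "same (fst \<kappa>) (corner_point Y (snd \<kappa>)) ?w (corner_point Y \<rho>)" if \<kappa>: "\<kappa> \<in> K" for \<kappa>
  proof -
    have c: "snd \<kappa> \<in> corners Y" using sites[OF \<kappa>] by auto
    obtain \<upsilon> where \<upsilon>1: "\<upsilon> \<in> corners Y" and "cdim Y (fst \<upsilon>) = cdim Y (fst (snd \<kappa>))"
        and \<upsilon>2: "half_point Y \<upsilon> = half_point Y (s \<kappa>)"
        and \<upsilon>3: "same (fst \<kappa>) (corner_point Y (snd \<kappa>)) ?w (corner_point Y \<upsilon>)"
        and "\<forall>a\<in>corner_edges Y (snd \<kappa>). \<exists>b\<in>corner_edges Y \<upsilon>. same (fst \<kappa>) a ?w b"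
        and "\<forall>b\<in>corner_edges Y \<upsilon>. \<exists>a\<in>corner_edges Y (snd \<kappa>). same (fst \<kappa>) a ?w b"
      using corner_transfer[OF same_transfer same_right_unique c edge[OF \<kappa>]] by blast
    note \<upsilon> = \<upsilon>1 \<upsilon>2 \<upsilon>3
    have "\<upsilon> = s \<kappa>" by (rule half_point_inj[OF cube_complex \<upsilon>(1) s(1)[OF \<kappa>] \<upsilon>(2)])
    then show ?thesis using \<upsilon>(3) z[OF \<kappa>] \<rho>c(2) by simp
  qed
  show ?thesis
  proof (intro exI[of _ ?w] exI[of _ \<rho>] conjI ballI w \<rho>c(1) present vert)
    fix \<kappa> assume \<kappa>: "\<kappa> \<in> K"
    then have "half_point Y (s \<kappa>) \<in> corner_edges Y \<rho>" unfolding \<rho>(2) by (rule imageI)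
    then show "\<exists>b\<in>corner_edges Y \<rho>. same (fst \<kappa>) (half_point Y (snd \<kappa>)) ?w b" using edge[OF \<kappa>] by (rule bexI[rotated])
  next
    fix b assume "b \<in> corner_edges Y \<rho>"
    then obtain \<kappa> where \<kappa>: "b = half_point Y (s \<kappa>)" "\<kappa> \<in> K" unfolding \<rho>(2) by (rule imageE)
    show "\<exists>\<kappa>\<in>K. same (fst \<kappa>) (half_point Y (snd \<kappa>)) ?w b" unfolding \<kappa>(1) using edge[OF \<kappa>(2)] \<kappa>(2) by (rule bexI)
  qed
qed

lemma finite_copies: "finite copies"
proof -
  have "copies \<subseteq> Pow (V \<times> I) \<times> V" unfolding copies_def by auto
  then show ?thesis using finite_sites finite_isometries by (meson finite_Pow_iff finite_SigmaI finite_subset)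
qed

theorem flag_gluing:
  assumes "npc Y" "finite (cells Y)"
  shows "flag_gluing Y copies present same"
proof
  have npc: "edge_simplicial Y" "edge_flag Y" using assms(1) npc_iff by blast+
  show "cube_complex Y" "edge_simplicial Y" "finite (cells Y)" "finite copies"
    using cube_complex npc assms finite_copies by blast+
  show "present w \<subseteq> points Y" for w unfolding present_def by blast
  show "chart Y c x \<in> present w" if "w \<in> copies" "c \<in> cells Y" "u \<in> open_cube (cdim Y c)" "chart Y c u \<in> present w"
      "x \<in> cube (cdim Y c)" for w c u x using present_closed[OF that(2-5)] .
  show "w \<in> copies \<and> p \<in> present w" if "same w p w' p'" for w p w' p' using that unfolding same_def by blast
  show "same w p w p" if "w \<in> copies" "p \<in> present w" for w p using same_refl[OF that] .
  show "same w' p' w p" if "same w p w' p'" for w p w' p' using same_sym[OF that] .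
  show "same w p w'' p''" if "same w p w' p'" "same w' p' w'' p''" for w p w' p' w'' p'' using same_trans[OF that] .
  show "p = q" if "same w p w q" for w p q using same_rel[OF that] rel_unique by blast
  show "cell_transfer Y (\<lambda>p q. same w p w' q)" for w w' by (rule same_transfer)
next
  fix \<sigma> \<tau> w w'
  assume "\<sigma> \<in> corners Y" "\<tau> \<in> corners Y" "w \<in> copies" "w' \<in> copies" "half_point Y \<sigma> \<in> present w"
    "half_point Y \<tau> \<in> present w'" "same w (corner_point Y \<sigma>) w' (corner_point Y \<tau>)"
    "\<And>a. a \<in> corner_edges Y \<sigma> \<Longrightarrow> \<exists>b\<in>corner_edges Y \<tau>. same w a w' b"
    "\<And>b. b \<in> corner_edges Y \<tau> \<Longrightarrow> \<exists>a\<in>corner_edges Y \<sigma>. same w a w' b"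
  then show "same w (half_point Y \<sigma>) w' (half_point Y \<tau>)"
    using assms(1) npc_iff by (intro same_simplicial) blast+
next
  fix K
  assume K: "finite K" "K \<noteq> {}" "\<And>\<kappa>. \<kappa> \<in> K \<Longrightarrow> fst \<kappa> \<in> copies \<and> snd \<kappa> \<in> corners Y \<and> cdim Y (fst (snd \<kappa>)) = 1 \<and>
      half_point Y (snd \<kappa>) \<in> present (fst \<kappa>)"
    "\<And>\<kappa> \<mu>. \<kappa> \<in> K \<Longrightarrow> \<mu> \<in> K \<Longrightarrow> same (fst \<kappa>) (corner_point Y (snd \<kappa>)) (fst \<mu>) (corner_point Y (snd \<mu>))"
    "\<And>\<kappa> \<mu>. \<kappa> \<in> K \<Longrightarrow> \<mu> \<in> K \<Longrightarrow> same (fst \<kappa>) (half_point Y (snd \<kappa>)) (fst \<mu>) (half_point Y (snd \<mu>)) \<or>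
        (\<exists>w \<tau> a b. w \<in> copies \<and> \<tau> \<in> corners Y \<and> half_point Y \<tau> \<in> present w \<and> corner_edges Y \<tau> = {a, b} \<and>
          same (fst \<kappa>) (corner_point Y (snd \<kappa>)) w (corner_point Y \<tau>) \<and>
          same (fst \<kappa>) (half_point Y (snd \<kappa>)) w a \<and> same (fst \<mu>) (half_point Y (snd \<mu>)) w b)"
  have "edge_flag Y" using assms(1) npc_iff by blast
  from same_flag[OF this K]
  show "\<exists>w \<rho>. w \<in> copies \<and> \<rho> \<in> corners Y \<and> half_point Y \<rho> \<in> present w \<and>
        (\<forall>\<kappa>\<in>K. same (fst \<kappa>) (corner_point Y (snd \<kappa>)) w (corner_point Y \<rho>)) \<and>
        (\<forall>\<kappa>\<in>K. \<exists>b\<in>corner_edges Y \<rho>. same (fst \<kappa>) (half_point Y (snd \<kappa>)) w b) \<and>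
        (\<forall>b\<in>corner_edges Y \<rho>. \<exists>\<kappa>\<in>K. same (fst \<kappa>) (half_point Y (snd \<kappa>)) w b)" .
qed

section \<open>Moving the base copy\<close>

definition base where "base = ({} :: ('v \<times> ('p \<rightharpoonup> 'p)) set, v0)"

lemma base_copy: "base \<in> copies" unfolding base_def copies_def using base_site by simp

lemma present_base: "present base = points Y"
  unfolding present_def base_def anchor_def nearby_def using rel_refl[OF base_site] by auto

lemma inj_on_shift: "j \<in> I \<Longrightarrow> inj_on (shift j) V" and shift_site: "j \<in> I \<Longrightarrow> v \<in> V \<Longrightarrow> shift j v \<in> V"
  using shift_bij bij_betw_imp_inj_on bij_betw_apply by metis+

lemma inj_on_shift_edge: "j \<in> I \<Longrightarrow> inj_on (\<lambda>(r, i). (shift j r, i)) (V \<times> I)"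
  using inj_on_shift[of j] unfolding inj_on_def by auto

lemma move_copy:
  assumes "j \<in> I" "w \<in> copies" shows "move j w \<in> copies"
  using assms shift_site[OF assms(1)] base_site unfolding move_def copies_def by auto

lemma anchor_move:
  assumes "j \<in> I" "w \<in> copies" shows "anchor (fst (move j w)) = shift j ` anchor (fst w)"
proof -
  have A: "fst w \<subseteq> V \<times> I" using assms(2) unfolding copies_def by auto
  let ?h = "\<lambda>(r, i). (shift j r, i)"
  have im: "?h ` fst w \<subseteq> V \<times> I" using A shift_site[OF assms(1)] by auto
  have ends: "fst ` fst w \<union> tgt ` fst w \<subseteq> V" using A step_site by (intro Un_least image_subsetI) auto
  have bV: "boundary fst tgt (fst w) \<subseteq> V" by (rule subset_trans[OF boundary_subset ends])
  have b: "boundary fst tgt (?h ` fst w) = shift j ` boundary fst tgt (fst w)"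
    by (rule boundary_image[OF finite_edges[OF A] inj_on_subset[OF inj_on_shift_edge[OF assms(1)] A] inj_on_shift[OF assms(1)] ends])
       (use A shift_step assms(1) in fastforce)
  have "boundary fst tgt (fst (move j w)) = sym_diff (sym_diff {v0} {step j v0}) (shift j ` boundary fst tgt (fst w))"
    using boundary_sym_diff[OF _ finite_edges[OF im], of "{(v0, j)}" fst tgt] boundary_singleton[of fst tgt "(v0, j)"]
    unfolding move_def b by simp
  then have "anchor (fst (move j w)) = sym_diff {shift j v0} (shift j ` boundary fst tgt (fst w))"
    unfolding anchor_def shift_base[OF assms(1)] by blast
  also have "\<dots> = shift j ` anchor (fst w)"
    unfolding anchor_def using image_sym_diff_inj_on[OF inj_on_shift[OF assms(1)], of "{v0}" "boundary fst tgt (fst w)"] bV base_site by simp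
  finally show ?thesis .
qed

lemma nearby_shift:
  assumes "j \<in> I" "v \<in> V" "r \<in> V"
  shows "shift j r \<in> nearby (shift j v) p \<longleftrightarrow> r \<in> nearby v p"
  unfolding nearby_def mem_Collect_eq shift_rel[OF assms] ..

lemma crossing_shift:
  assumes "j \<in> I" "v \<in> V" "r \<in> V" shows "(shift j r, i) \<in> crossing (shift j v) p \<longleftrightarrow> (r, i) \<in> crossing v p"
  unfolding crossing_def mem_Collect_eq prod.case shift_rel[OF assms] ..

lemma present_move:
  assumes "j \<in> I" "w \<in> copies" shows "present (move j w) = present w"
proof -
  have A: "anchor (fst w) \<subseteq> V" "snd w \<in> V" using assms(2) anchor_sites[of "fst w"] unfolding copies_def by auto
  have "anchor (fst (move j w)) \<subseteq> nearby (shift j (snd w)) p \<longleftrightarrow> anchor (fst w) \<subseteq> nearby (snd w) p" for p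
    unfolding anchor_move[OF assms] image_subset_iff using nearby_shift[OF assms(1) A(2)] A(1) by blast
  then show ?thesis unfolding present_def by (simp add: move_def)
qed

lemma same_move:
  assumes j: "j \<in> I" and w: "w \<in> copies" "w' \<in> copies"
  shows "same (move j w) p (move j w') p' \<longleftrightarrow> same w p w' p'"
proof -
  let ?h = "\<lambda>(r, i). (shift j r, i)"
  have A: "fst w \<subseteq> V \<times> I" "fst w' \<subseteq> V \<times> I" "snd w \<in> V" "snd w' \<in> V" using w unfolding copies_def by auto
  have "sym_diff (fst (move j w)) (fst (move j w')) = sym_diff (?h ` fst w) (?h ` fst w')"
    unfolding move_def fst_conv by blast
  also have "\<dots> = ?h ` sym_diff (fst w) (fst w')"
    by (rule image_sym_diff_inj_on[OF inj_on_shift_edge[OF j] A(1,2), symmetric])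
  finally have "sym_diff (fst (move j w)) (fst (move j w')) \<subseteq> crossing (snd (move j w)) p \<longleftrightarrow>
      (\<forall>e\<in>sym_diff (fst w) (fst w'). ?h e \<in> crossing (shift j (snd w)) p)"
    by (simp only: image_subset_iff) (simp add: move_def)
  also have "\<dots> \<longleftrightarrow> sym_diff (fst w) (fst w') \<subseteq> crossing (snd w) p"
  proof -
    have "?h e \<in> crossing (shift j (snd w)) p \<longleftrightarrow> e \<in> crossing (snd w) p" if "e \<in> V \<times> I" for e
      using crossing_shift[OF j A(3), of "fst e" "snd e" p] that by (auto simp: case_prod_beta)
    then show ?thesis using A(1,2) by blast
  qed
  finally show ?thesis
    unfolding same_def present_move[OF j w(1)] using move_copy[OF j] w shift_rel[OF j A(3,4), of p p']
    by (simp add: move_def)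
qed

lemma move_bij:
  assumes j: "j \<in> I" shows "bij_betw (move j) copies copies"
proof -
  have "inj_on (move j) copies"
  proof (rule inj_onI)
    fix w w' assume w: "w \<in> copies" "w' \<in> copies" "move j w = move j w'"
    let ?h = "\<lambda>(r, i). (shift j r, i)"
    have A: "fst w \<subseteq> V \<times> I" "fst w' \<subseteq> V \<times> I" "snd w \<in> V" "snd w' \<in> V" using w unfolding copies_def by auto
    have 1: "sym_diff {(v0, j)} (?h ` fst w) = sym_diff {(v0, j)} (?h ` fst w')" and 2: "shift j (snd w) = shift j (snd w')"
      using w(3) unfolding move_def by auto
    from 1 have "?h ` fst w = ?h ` fst w'" by blast
    then have "fst w = fst w'" using inj_on_image_eq_iff[OF inj_on_shift_edge[OF j] A(1,2)] by blast
    moreover have "snd w = snd w'" using inj_onD[OF inj_on_shift[OF j] 2 A(3,4)] .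
    ultimately show "w = w'" by (simp add: prod_eq_iff)
  qed
  then show ?thesis
    unfolding bij_betw_def using finite_copies move_copy[OF j] by (simp add: endo_inj_surj image_subsetI)
qed

text \<open>The only edge in which the two decorations differ starts at the base copy and belongs to \<open>j\<close>, so it is
  crossed by \<open>p\<close>.\<close>

lemma same_base_move:
  assumes j: "j \<in> I" and pq: "j p = Some q"
  shows "same base p (move j base) q"
proof -
  have p: "p \<in> points Y" using partial_isometry_dom[OF isometries[OF j]] pq by blast
  have "rel v0 p (step j v0) q" using rel_step[OF j base_site pq] .
  moreover have "(v0, j) \<in> crossing v0 p" unfolding crossing_def using j rel_refl[OF base_site p] pq by blast
  moreover have "move j base = ({(v0, j)}, step j v0)" unfolding move_def base_def using shift_base[OF j] by simp
  ultimately show ?thesis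
    unfolding same_def using base_copy move_copy[OF j base_copy] p present_base unfolding base_def by auto
qed

end

section \<open>The glued complex\<close>

context flag_gluing
begin

definition index :: "'w \<times> 'c \<Rightarrow> nat" where
  "index = (SOME f. inj_on f (W \<times> cells Y))"

definition centre :: "'c \<Rightarrow> 'p" where "centre c = chart Y c (bary (cdim Y c))"

text \<open>A class of points is named by a representative, given by a copy, a cell and coordinates in the open
  cube; the copy and the cell are then encoded by a number. This realizes the points of the glued
  complex in the type \<open>nat \<times> (nat \<Rightarrow> real)\<close>.\<close>

definition name :: "'w \<Rightarrow> 'p \<Rightarrow> ('w \<times> 'c) \<times> (nat \<Rightarrow> real)" where
  "name w p = (SOME ku. fst ku \<in> W \<times> cells Y \<and> snd ku \<in> open_cube (cdim Y (snd (fst ku))) \<and>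
     E w p (fst (fst ku)) (chart Y (snd (fst ku)) (snd ku)))"

definition pt :: "'w \<Rightarrow> 'p \<Rightarrow> nat \<times> (nat \<Rightarrow> real)" where
  "pt w p = (index (fst (name w p)), snd (name w p))"

text \<open>A representative of a class of cells. Cells are identified if their centres are.\<close>

definition canonical :: "'w \<Rightarrow> 'c \<Rightarrow> 'w \<times> 'c" where
  "canonical w c = (SOME k. k \<in> W \<times> cells Y \<and> E w (centre c) (fst k) (centre (snd k)))"

text \<open>The inverse of \<open>index\<close> decodes the number of a cell into a copy and a cell of \<open>Y\<close>.\<close>

definition glued :: "(nat, nat \<times> (nat \<Rightarrow> real)) cube_complex" where
  "glued = (let k = inv_into (W \<times> cells Y) index in
     \<lparr>cells = {index (canonical w c) | w c. w \<in> W \<and> c \<in> cells Y \<and> centre c \<in> P w},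
      cdim = (\<lambda>n. cdim Y (snd (k n))),
      chart = (\<lambda>n u. pt (fst (k n)) (chart Y (snd (k n)) u))\<rparr>)"

lemma inj_index: "inj_on index (W \<times> cells Y)"
proof -
  have "finite (W \<times> cells Y)" using finite_copies finite_cells by simp
  then have "\<exists>f::'w \<times> 'c \<Rightarrow> nat. inj_on f (W \<times> cells Y)" using finite_imp_inj_to_nat_seg by blast
  then show ?thesis unfolding index_def by (rule someI_ex)
qed

lemma E_site': "E w p w' p' \<Longrightarrow> w' \<in> W \<and> p' \<in> P w'"
  using E_sym E_site by blast

lemma name_in_class:
  assumes w: "w \<in> W" and p: "p \<in> P w"
  shows "fst (name w p) \<in> W \<times> cells Y"
    "E w p (fst (fst (name w p))) (chart Y (snd (fst (name w p))) (snd (name w p)))"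
proof -
  obtain c u where c: "c \<in> cells Y" "u \<in> open_cube (cdim Y c)" "p = chart Y c u"
    using points_open[OF Y] P_points p by (metis subsetD)
  have "E w p w (chart Y c u)" using E_refl[OF w p] c(3) by simp
  then have "\<exists>ku. fst ku \<in> W \<times> cells Y \<and> snd ku \<in> open_cube (cdim Y (snd (fst ku))) \<and>
     E w p (fst (fst ku)) (chart Y (snd (fst ku)) (snd ku))"
    using c w by (intro exI[of _ "((w, c), u)"]) simp
  from someI_ex[OF this]
  show "fst (name w p) \<in> W \<times> cells Y"
    "E w p (fst (fst (name w p))) (chart Y (snd (fst (name w p))) (snd (name w p)))"
    unfolding name_def by blast+
qed

lemma pt_eq:
  assumes w: "w \<in> W" "p \<in> P w" and w': "w' \<in> W" "p' \<in> P w'"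
  shows "pt w p = pt w' p' \<longleftrightarrow> E w p w' p'"
proof
  assume "pt w p = pt w' p'"
  then have 1: "index (fst (name w p)) = index (fst (name w' p'))" and 2: "snd (name w p) = snd (name w' p')"
    unfolding pt_def by auto
  from inj_onD[OF inj_index 1 name_in_class(1)[OF w] name_in_class(1)[OF w']] have "name w' p' = name w p" using 2 by (simp add: prod_eq_iff)
  from name_in_class(2)[OF w', unfolded this] show "E w p w' p'" using E_trans[OF name_in_class(2)[OF w] E_sym] by blast
next
  assume E: "E w p w' p'"
  have "E w p v q \<longleftrightarrow> E w' p' v q" for v q using E E_sym[OF E] E_trans by blast
  then show "pt w p = pt w' p'" unfolding pt_def name_def by simp
qed

lemma centre_P: "w \<in> W \<Longrightarrow> c \<in> cells Y \<Longrightarrow> centre c \<in> P w \<Longrightarrow> u \<in> cube (cdim Y c) \<Longrightarrow> chart Y c u \<in> P w"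
  unfolding centre_def using P_closed[OF _ _ bary_open] .

lemma P_centre: "w \<in> W \<Longrightarrow> c \<in> cells Y \<Longrightarrow> u \<in> open_cube (cdim Y c) \<Longrightarrow> chart Y c u \<in> P w \<Longrightarrow> centre c \<in> P w"
  unfolding centre_def using P_closed[OF _ _ _ _ open_cube_sub[OF bary_open]] .

lemma E_cell:
  assumes "c \<in> cells Y" "u \<in> open_cube (cdim Y c)" "E w (chart Y c u) w' q"
  obtains d g where "d \<in> cells Y" "cdim Y d = cdim Y c" "face_map (cdim Y c) (cdim Y c) g" "q = chart Y d (g u)"
    "E w (centre c) w' (centre d)" "\<forall>x\<in>cube (cdim Y c). E w (chart Y c x) w' (chart Y d (g x))"
proof -
  obtain d g where d: "d \<in> cells Y" "cdim Y d = cdim Y c" "face_map (cdim Y c) (cdim Y c) g" "q = chart Y d (g u)"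
    "\<And>x. x \<in> cube (cdim Y c) \<Longrightarrow> E w (chart Y c x) w' (chart Y d (g x))"
    by (rule cell_transferE[OF E_transfer assms]) blast
  have "E w (centre c) w' (centre d)"
    using d(5)[OF open_cube_sub[OF bary_open]] face_map_self_bary[OF d(3)] d(2) unfolding centre_def by simp
  with d show ?thesis by (intro that[of d g]) simp_all
qed

lemma canonical_in_class:
  assumes "w \<in> W" "c \<in> cells Y" "centre c \<in> P w"
  shows "canonical w c \<in> W \<times> cells Y" "E w (centre c) (fst (canonical w c)) (centre (snd (canonical w c)))"
proof -
  have "\<exists>k. k \<in> W \<times> cells Y \<and> E w (centre c) (fst k) (centre (snd k))"
    using assms E_refl by (intro exI[of _ "(w, c)"]) simp
  from someI_ex[OF this]
  show "canonical w c \<in> W \<times> cells Y" "E w (centre c) (fst (canonical w c)) (centre (snd (canonical w c)))"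
    unfolding canonical_def by blast+
qed

lemma canonical_eq:
  assumes "E w (centre c) w' (centre c')" shows "canonical w c = canonical w' c'"
proof -
  have "E w (centre c) v q \<longleftrightarrow> E w' (centre c') v q" for v q using assms E_sym[OF assms] E_trans by blast
  then show ?thesis unfolding canonical_def by simp
qed

lemma glued_canonical:
  assumes "w \<in> W" "c \<in> cells Y" "centre c \<in> P w"
  shows "index (canonical w c) \<in> cells glued"
    "cdim glued (index (canonical w c)) = cdim Y (snd (canonical w c))"
    "chart glued (index (canonical w c)) u = pt (fst (canonical w c)) (chart Y (snd (canonical w c)) u)"
  using assms inv_into_f_f[OF inj_index canonical_in_class(1)[OF assms]] unfolding glued_def by (auto simp: Let_def)

lemma glued_cellE:
  assumes "n \<in> cells glued"
  obtains w c where "w \<in> W" "c \<in> cells Y" "centre c \<in> P w" "cdim glued n = cdim Y c"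
    "chart glued n = (\<lambda>u. pt w (chart Y c u))" "n = index (canonical w c)"
proof -
  obtain w c where wc: "n = index (canonical w c)" "w \<in> W" "c \<in> cells Y" "centre c \<in> P w"
    using assms unfolding glued_def by (auto simp: Let_def)
  note k = canonical_in_class[OF wc(2-4)]
  show ?thesis
  proof (rule that[of "fst (canonical w c)" "snd (canonical w c)"])
    show "n = index (canonical (fst (canonical w c)) (snd (canonical w c)))"
      unfolding wc(1) using canonical_eq[OF k(2)] by simp
    show "centre (snd (canonical w c)) \<in> P (fst (canonical w c))" using E_site'[OF k(2)] by blast
    show "cdim glued n = cdim Y (snd (canonical w c))" unfolding wc(1) by (rule glued_canonical(2)[OF wc(2-4)])
    show "chart glued n = (\<lambda>u. pt (fst (canonical w c)) (chart Y (snd (canonical w c)) u))"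
      unfolding wc(1) by (intro ext glued_canonical(3)[OF wc(2-4)])
  qed (use k(1) in auto)
qed

text \<open>A cell of a copy is a cell of the glued complex, up to the symmetry of the cube that relates it to the
  canonical representative.\<close>

lemma pt_cell:
  assumes wc: "w \<in> W" "c \<in> cells Y" "centre c \<in> P w"
  shows "\<exists>n g. cell_to_cell (pt w) Y c glued n g"
proof -
  let ?w = "fst (canonical w c)" and ?c = "snd (canonical w c)" and ?n = "index (canonical w c)"
  note k = canonical_in_class[OF wc]
  obtain d g where d: "d \<in> cells Y" "cdim Y d = cdim Y c" "face_map (cdim Y c) (cdim Y c) g"
      "centre ?c = chart Y d (g (bary (cdim Y c)))" "\<forall>x\<in>cube (cdim Y c). E w (chart Y c x) ?w (chart Y d (g x))"
    using E_cell[OF wc(2) bary_open k(2)[unfolded centre_def[of c]]] by metis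
  have "?c = d"
  proof (rule bary_inj[OF Y])
    show "?c \<in> cells Y" using k(1) by auto
    show "g (bary (cdim Y c)) \<in> open_cube (cdim Y d)" using face_map_self_open[OF d(3) bary_open] d(2) by simp
    show "chart Y ?c (bary (cdim Y ?c)) = chart Y d (g (bary (cdim Y c)))" using d(4) unfolding centre_def .
  qed (rule d(1))
  have "pt w (chart Y c x) = chart glued ?n (g x)" if x: "x \<in> cube (cdim Y c)" for x
  proof -
    have E: "E w (chart Y c x) ?w (chart Y d (g x))" using d(5) x by blast
    from pt_eq E_site[OF E] E_site'[OF E] E have "pt w (chart Y c x) = pt ?w (chart Y d (g x))" by blast
    then show ?thesis unfolding glued_canonical(3)[OF wc] \<open>?c = d\<close> .
  qed
  then show ?thesis
    unfolding cell_to_cell_def using glued_canonical(1,2)[OF wc] d(2,3) \<open>?c = d\<close> by auto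
qed

lemma open_cells_glued:
  assumes n: "n \<in> cells glued" "n' \<in> cells glued"
    and u: "u \<in> open_cube (cdim glued n)" "u' \<in> open_cube (cdim glued n')" and eq: "chart glued n u = chart glued n' u'"
  shows "n = n'"
proof -
  obtain w c where wc: "w \<in> W" "c \<in> cells Y" "centre c \<in> P w" "cdim glued n = cdim Y c"
    "chart glued n = (\<lambda>u. pt w (chart Y c u))" "n = index (canonical w c)" by (rule glued_cellE[OF n(1)])
  obtain w' c' where wc': "w' \<in> W" "c' \<in> cells Y" "centre c' \<in> P w'" "cdim glued n' = cdim Y c'"
    "chart glued n' = (\<lambda>u. pt w' (chart Y c' u))" "n' = index (canonical w' c')" by (rule glued_cellE[OF n(2)])
  have o: "u \<in> open_cube (cdim Y c)" "u' \<in> open_cube (cdim Y c')" using u wc(4) wc'(4) by auto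
  have "pt w (chart Y c u) = pt w' (chart Y c' u')" using eq wc(5) wc'(5) by simp
  then have "E w (chart Y c u) w' (chart Y c' u')"
    using pt_eq[OF wc(1) centre_P[OF wc(1-3) open_cube_sub[OF o(1)]] wc'(1) centre_P[OF wc'(1-3) open_cube_sub[OF o(2)]]] by simp
  then obtain d g where d: "d \<in> cells Y" "cdim Y d = cdim Y c" "face_map (cdim Y c) (cdim Y c) g"
      "chart Y c' u' = chart Y d (g u)" "E w (centre c) w' (centre d)"
    using E_cell[OF wc(2) o(1)] by metis
  have "g u \<in> open_cube (cdim Y d)" using face_map_self_open[OF d(3) o(1)] d(2) by simp
  from open_inj(1)[OF Y wc'(2) d(1) o(2) this d(4)] have "c' = d" .
  then show ?thesis using canonical_eq[OF d(5)] wc(6) wc'(6) by simp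
qed

lemma cube_complex_glued: "cube_complex glued"
proof (rule cube_complexI)
  fix n assume "n \<in> cells glued"
  then obtain w c where wc: "w \<in> W" "c \<in> cells Y" "centre c \<in> P w" "cdim glued n = cdim Y c"
    "chart glued n = (\<lambda>u. pt w (chart Y c u))" "n = index (canonical w c)" by (rule glued_cellE)
  show "inj_on (chart glued n) (open_cube (cdim glued n))"
  proof (rule inj_onI)
    fix u u' assume "u \<in> open_cube (cdim glued n)" "u' \<in> open_cube (cdim glued n)" "chart glued n u = chart glued n u'"
    then have u: "u \<in> open_cube (cdim Y c)" "u' \<in> open_cube (cdim Y c)" "pt w (chart Y c u) = pt w (chart Y c u')"
      using wc(4,5) by auto
    then have "E w (chart Y c u) w (chart Y c u')"
      using pt_eq[OF wc(1) centre_P[OF wc(1-3) open_cube_sub[OF u(1)]] wc(1) centre_P[OF wc(1-3) open_cube_sub[OF u(2)]]] by simp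
    then have "chart Y c u = chart Y c u'" by (rule E_unique)
    then show "u = u'" by (rule open_inj(2)[OF Y wc(2,2) u(1,2)])
  qed
  fix F assume F: "F \<in> cube_faces (cdim glued n)"
  obtain d g where d: "d \<in> cells Y" "face_map (cdim Y d) (cdim Y c) g" "g ` cube (cdim Y d) = F"
      "\<And>u. u \<in> cube (cdim Y d) \<Longrightarrow> chart Y c (g u) = chart Y d u"
    by (rule face_cell[OF Y wc(2) F[unfolded wc(4)]]) blast
  have "centre d \<in> P w"
    using centre_P[OF wc(1-3) face_map_cube[OF d(2) open_cube_sub[OF bary_open]]] d(4)[OF open_cube_sub[OF bary_open]]
    unfolding centre_def by simp
  from pt_cell[OF wc(1) d(1) this] obtain m h where h: "m \<in> cells glued" "cdim glued m = cdim Y d"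
      "face_map (cdim Y d) (cdim Y d) h" "\<forall>u\<in>cube (cdim Y d). pt w (chart Y d u) = chart glued m (h u)"
    unfolding cell_to_cell_def by blast
  obtain k where k: "face_map (cdim Y d) (cdim Y d) k" "\<And>u. u \<in> cube (cdim Y d) \<Longrightarrow> k (h u) = u"
      "\<And>u. u \<in> cube (cdim Y d) \<Longrightarrow> h (k u) = u"
    by (rule face_map_inverse[OF h(3)]) blast
  show "\<exists>m\<in>cells glued. \<exists>g. face_map (cdim glued m) (cdim glued n) g \<and> g ` cube (cdim glued m) = F \<and>
      (\<forall>u\<in>cube (cdim glued m). chart glued n (g u) = chart glued m u)"
  proof (intro bexI[OF _ h(1)] exI[of _ "\<lambda>u. g (k u)"] conjI ballI)
    show "face_map (cdim glued m) (cdim glued n) (\<lambda>u. g (k u))"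
      unfolding h(2) wc(4) by (rule face_map_comp[OF k(1) d(2)])
    show "(\<lambda>u. g (k u)) ` cube (cdim glued m) = F"
      unfolding h(2) image_image[symmetric, of g k] face_map_image_self[OF k(1)] by (rule d(3))
    fix u assume "u \<in> cube (cdim glued m)"
    then have u: "u \<in> cube (cdim Y d)" unfolding h(2) .
    have ku: "k u \<in> cube (cdim Y d)" by (rule face_map_cube[OF k(1) u])
    show "chart glued n (g (k u)) = chart glued m u"
      unfolding wc(5) d(4)[OF ku] using bspec[OF h(4) ku] k(3)[OF u] by simp
  qed
qed (rule open_cells_glued)

lemma glued_compact: "compact_space (cc_topology glued)"
proof (rule compact_space_finite_cells)
  have "cells glued \<subseteq> index ` (W \<times> cells Y)"
    unfolding glued_def using canonical_in_class(1) by (auto simp: Let_def simp del: mem_Sigma_iff)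
  moreover have "finite (index ` (W \<times> cells Y))" using finite_copies finite_cells by simp
  ultimately show "finite (cells glued)" by (rule finite_subset)
qed

lemma glued_points: "x \<in> points glued \<longleftrightarrow> (\<exists>w p. w \<in> W \<and> p \<in> P w \<and> x = pt w p)"
proof
  assume "x \<in> points glued"
  then obtain n u where n: "n \<in> cells glued" "u \<in> cube (cdim glued n)" "x = chart glued n u" unfolding points_def by blast
  obtain w c where wc: "w \<in> W" "c \<in> cells Y" "centre c \<in> P w" "cdim glued n = cdim Y c"
    "chart glued n = (\<lambda>u. pt w (chart Y c u))" "n = index (canonical w c)" by (rule glued_cellE[OF n(1)])
  then show "\<exists>w p. w \<in> W \<and> p \<in> P w \<and> x = pt w p" using n(2,3) centre_P[OF wc(1-3)] by auto
next
  assume "\<exists>w p. w \<in> W \<and> p \<in> P w \<and> x = pt w p"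
  then obtain w p where w: "w \<in> W" "p \<in> P w" "x = pt w p" by blast
  have "p \<in> points Y" using P_points w(2) by blast
  then obtain c u where c: "c \<in> cells Y" "u \<in> open_cube (cdim Y c)" "p = chart Y c u" by (rule points_open[OF Y])
  have "centre c \<in> P w" using P_centre[OF w(1) c(1,2)] w(2) c(3) by simp
  from pt_cell[OF w(1) c(1) this] obtain n g where n: "n \<in> cells glued" "cdim glued n = cdim Y c"
      "face_map (cdim Y c) (cdim Y c) g" "\<forall>u\<in>cube (cdim Y c). pt w (chart Y c u) = chart glued n (g u)"
    unfolding cell_to_cell_def by blast
  have "x = chart glued n (g u)" unfolding w(3) c(3) using bspec[OF n(4) open_cube_sub[OF c(2)]] .
  moreover have "g u \<in> cube (cdim glued n)" unfolding n(2) by (rule face_map_cube[OF n(3) open_cube_sub[OF c(2)]])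
  ultimately show "x \<in> points glued" using chart_points[OF n(1)] by simp
qed

text \<open>Corners of the glued complex are corners of copies; with \<open>corner_glued_exists\<close> this translates links
  of the glued complex into the terms of the locale.\<close>

lemma corner_glued:
  assumes "\<tau> \<in> corners glued"
  obtains w \<sigma> where "w \<in> W" "\<sigma> \<in> corners Y" "half_point Y \<sigma> \<in> P w" "corner_point Y \<sigma> \<in> P w" "corner_edges Y \<sigma> \<subseteq> P w"
    "cdim glued (fst \<tau>) = cdim Y (fst \<sigma>)" "half_point glued \<tau> = pt w (half_point Y \<sigma>)"
    "corner_point glued \<tau> = pt w (corner_point Y \<sigma>)" "corner_edges glued \<tau> = pt w ` corner_edges Y \<sigma>"
proof -
  obtain n v where nv: "\<tau> = (n, v)" "n \<in> cells glued" "1 \<le> cdim glued n" "v \<in> cube_vertices (cdim glued n)"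
    using assms unfolding corners_def by blast
  obtain w c where wc: "w \<in> W" "c \<in> cells Y" "centre c \<in> P w" "cdim glued n = cdim Y c"
    "chart glued n = (\<lambda>u. pt w (chart Y c u))" "n = index (canonical w c)" by (rule glued_cellE[OF nv(2)])
  have \<sigma>: "(c, v) \<in> corners Y" using wc nv unfolding corners_def by auto
  show ?thesis
  proof (rule that[OF wc(1) \<sigma>])
    show "half_point Y (c, v) \<in> P w"
      unfolding half_point_def using centre_P[OF wc(1-3) open_cube_sub] half_point_open(2)[OF \<sigma>] by simp
    show "corner_point Y (c, v) \<in> P w"
      using centre_P[OF wc(1-3) vertex_in_cube] half_point_open(3)[OF \<sigma>] by simp
    show "corner_edges Y (c, v) \<subseteq> P w"
    proof
      fix a assume "a \<in> corner_edges Y (c, v)"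
      then obtain u where "u \<in> cube (cdim Y c)" "a = chart Y c u" using corner_edges_points[OF \<sigma>] by auto
      then show "a \<in> P w" using centre_P[OF wc(1-3)] by blast
    qed
    show "corner_edges glued \<tau> = pt w ` corner_edges Y (c, v)"
      unfolding nv(1) corner_edges_image wc(4) image_image wc(5) ..
  qed (simp_all add: nv(1) wc(4,5) half_point_def)
qed

lemma corner_glued_exists:
  assumes w: "w \<in> W" and \<sigma>: "\<sigma> \<in> corners Y" and h: "half_point Y \<sigma> \<in> P w"
  obtains \<tau> where "\<tau> \<in> corners glued" "corner_point glued \<tau> = pt w (corner_point Y \<sigma>)"
    "corner_edges glued \<tau> = pt w ` corner_edges Y \<sigma>"
proof -
  obtain c v where cv: "\<sigma> = (c, v)" by (cases \<sigma>)
  have c: "c \<in> cells Y" "half (cdim Y c) v \<in> open_cube (cdim Y c)" "v \<in> cube_vertices (cdim Y c)"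
    using half_point_open[OF \<sigma>] unfolding cv by auto
  have "centre c \<in> P w" using P_centre[OF w c(1,2)] h unfolding cv half_point_def by simp
  from pt_cell[OF w c(1) this] obtain n g where n: "n \<in> cells glued" "cdim glued n = cdim Y c"
      "face_map (cdim Y c) (cdim Y c) g" "\<forall>u\<in>cube (cdim Y c). pt w (chart Y c u) = chart glued n (g u)"
    unfolding cell_to_cell_def by blast
  show ?thesis
  proof (rule that[of "(n, g v)"])
    show "(n, g v) \<in> corners glued" by (rule corner_map[OF \<sigma>[unfolded cv] n(2,3,1)])
    show "corner_point glued (n, g v) = pt w (corner_point Y \<sigma>)"
      unfolding cv using bspec[OF n(4) vertex_in_cube[OF c(3)]] by simp
    show "corner_edges glued (n, g v) = pt w ` corner_edges Y \<sigma>"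
      unfolding cv by (rule corner_edges_cell_map[OF n(2,3) c(3) bspec[OF n(4)]])
  qed
qed

lemma edge_simplicial_glued: "edge_simplicial glued"
  unfolding edge_simplicial_def
proof (intro conjI ballI impI)
  fix \<tau> assume "\<tau> \<in> corners glued"
  then obtain w \<sigma> where \<sigma>: "w \<in> W" "\<sigma> \<in> corners Y" "half_point Y \<sigma> \<in> P w" "corner_point Y \<sigma> \<in> P w" "corner_edges Y \<sigma> \<subseteq> P w"
    "cdim glued (fst \<tau>) = cdim Y (fst \<sigma>)" "half_point glued \<tau> = pt w (half_point Y \<sigma>)"
    "corner_point glued \<tau> = pt w (corner_point Y \<sigma>)" "corner_edges glued \<tau> = pt w ` corner_edges Y \<sigma>"
    by (rule corner_glued)
  have "inj_on (pt w) (corner_edges Y \<sigma>)"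
  proof (rule inj_onI)
    fix a b assume ab: "a \<in> corner_edges Y \<sigma>" "b \<in> corner_edges Y \<sigma>" "pt w a = pt w b"
    then have "E w a w b" using pt_eq[OF \<sigma>(1) subsetD[OF \<sigma>(5) ab(1)] \<sigma>(1) subsetD[OF \<sigma>(5) ab(2)]] by simp
    then show "a = b" by (rule E_unique)
  qed
  then have "card (corner_edges glued \<tau>) = card (corner_edges Y \<sigma>)" unfolding \<sigma>(9) by (rule card_image)
  then show "card (corner_edges glued \<tau>) = cdim glued (fst \<tau>)"
    using simplicial \<sigma>(2,6) unfolding edge_simplicial_def by simp
next
  fix \<tau> \<tau>' assume \<tau>: "\<tau> \<in> corners glued" "\<tau>' \<in> corners glued"
    and eq: "corner_point glued \<tau> = corner_point glued \<tau>' \<and> corner_edges glued \<tau> = corner_edges glued \<tau>'"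
  obtain w \<sigma> where \<sigma>: "w \<in> W" "\<sigma> \<in> corners Y" "half_point Y \<sigma> \<in> P w" "corner_point Y \<sigma> \<in> P w" "corner_edges Y \<sigma> \<subseteq> P w"
    "cdim glued (fst \<tau>) = cdim Y (fst \<sigma>)" "half_point glued \<tau> = pt w (half_point Y \<sigma>)"
    "corner_point glued \<tau> = pt w (corner_point Y \<sigma>)" "corner_edges glued \<tau> = pt w ` corner_edges Y \<sigma>"
    by (rule corner_glued[OF \<tau>(1)])
  obtain w' \<sigma>' where \<sigma>': "w' \<in> W" "\<sigma>' \<in> corners Y" "half_point Y \<sigma>' \<in> P w'" "corner_point Y \<sigma>' \<in> P w'" "corner_edges Y \<sigma>' \<subseteq> P w'"
    "cdim glued (fst \<tau>') = cdim Y (fst \<sigma>')" "half_point glued \<tau>' = pt w' (half_point Y \<sigma>')"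
    "corner_point glued \<tau>' = pt w' (corner_point Y \<sigma>')" "corner_edges glued \<tau>' = pt w' ` corner_edges Y \<sigma>'"
    by (rule corner_glued[OF \<tau>(2)])
  have im: "pt w ` corner_edges Y \<sigma> = pt w' ` corner_edges Y \<sigma>'" using eq \<sigma>(9) \<sigma>'(9) by simp
  have "E w (half_point Y \<sigma>) w' (half_point Y \<sigma>')"
  proof (rule E_simplicial[OF \<sigma>(2) \<sigma>'(2) \<sigma>(1) \<sigma>'(1) \<sigma>(3) \<sigma>'(3)])
    show "E w (corner_point Y \<sigma>) w' (corner_point Y \<sigma>')"
      using pt_eq[OF \<sigma>(1,4) \<sigma>'(1,4)] eq \<sigma>(8) \<sigma>'(8) by simp
  next
    fix a assume a: "a \<in> corner_edges Y \<sigma>"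
    then have "pt w a \<in> pt w' ` corner_edges Y \<sigma>'" using im by blast
    then obtain b where b: "pt w a = pt w' b" "b \<in> corner_edges Y \<sigma>'" by (rule imageE)
    then have "E w a w' b" using pt_eq[OF \<sigma>(1) subsetD[OF \<sigma>(5) a] \<sigma>'(1) subsetD[OF \<sigma>'(5) b(2)]] by simp
    then show "\<exists>b\<in>corner_edges Y \<sigma>'. E w a w' b" using b(2) by blast
  next
    fix b assume b: "b \<in> corner_edges Y \<sigma>'"
    then have "pt w' b \<in> pt w ` corner_edges Y \<sigma>" using im by blast
    then obtain a where a: "pt w' b = pt w a" "a \<in> corner_edges Y \<sigma>" by (rule imageE)
    then have "E w a w' b" using pt_eq[OF \<sigma>(1) subsetD[OF \<sigma>(5) a(2)] \<sigma>'(1) subsetD[OF \<sigma>'(5) b]] by simp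
    then show "\<exists>a\<in>corner_edges Y \<sigma>. E w a w' b" using a(2) by blast
  qed
  then have "half_point glued \<tau> = half_point glued \<tau>'"
    unfolding \<sigma>(7) \<sigma>'(7) using pt_eq[OF \<sigma>(1,3) \<sigma>'(1,3)] by simp
  then show "\<tau> = \<tau>'" by (rule half_point_inj[OF cube_complex_glued \<tau>])
qed

lemma edge_flag_glued: "edge_flag glued"
  unfolding edge_flag_def
proof (intro allI impI, elim conjE)
  fix x A assume A: "A \<noteq> {}" "finite A"
    and edges: "\<forall>a\<in>A. \<exists>\<sigma>\<in>link glued x. cdim glued (fst \<sigma>) = 1 \<and> half_point glued \<sigma> = a"
    and squares: "\<forall>a\<in>A. \<forall>b\<in>A. a \<noteq> b \<longrightarrow> (\<exists>\<sigma>\<in>link glued x. corner_edges glued \<sigma> = {a, b})"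
  have "\<exists>\<kappa>. fst \<kappa> \<in> W \<and> snd \<kappa> \<in> corners Y \<and> cdim Y (fst (snd \<kappa>)) = 1 \<and>
      half_point Y (snd \<kappa>) \<in> P (fst \<kappa>) \<and> corner_point Y (snd \<kappa>) \<in> P (fst \<kappa>) \<and>
      pt (fst \<kappa>) (half_point Y (snd \<kappa>)) = a \<and> pt (fst \<kappa>) (corner_point Y (snd \<kappa>)) = x" if a: "a \<in> A" for a
  proof -
    obtain \<tau> where \<tau>: "\<tau> \<in> link glued x" "cdim glued (fst \<tau>) = 1" "half_point glued \<tau> = a" using edges a by blast
    have t: "\<tau> \<in> corners glued" "corner_point glued \<tau> = x" using \<tau>(1) unfolding link_corners by simp_all
    obtain w \<sigma> where \<sigma>: "w \<in> W" "\<sigma> \<in> corners Y" "half_point Y \<sigma> \<in> P w" "corner_point Y \<sigma> \<in> P w" "corner_edges Y \<sigma> \<subseteq> P w"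
      "cdim glued (fst \<tau>) = cdim Y (fst \<sigma>)" "half_point glued \<tau> = pt w (half_point Y \<sigma>)"
      "corner_point glued \<tau> = pt w (corner_point Y \<sigma>)" "corner_edges glued \<tau> = pt w ` corner_edges Y \<sigma>"
      by (rule corner_glued[OF t(1)])
    show ?thesis
      by (intro exI[of _ "(w, \<sigma>)"] conjI; unfold fst_conv snd_conv) (use \<sigma>(1-4) \<tau>(2,3) \<sigma>(6-8) t(2) in simp_all)
  qed
  from bchoice[OF ballI[OF this]] obtain k where k: "\<forall>a\<in>A. fst (k a) \<in> W \<and> snd (k a) \<in> corners Y \<and>
      cdim Y (fst (snd (k a))) = 1 \<and> half_point Y (snd (k a)) \<in> P (fst (k a)) \<and> corner_point Y (snd (k a)) \<in> P (fst (k a)) \<and>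
      pt (fst (k a)) (half_point Y (snd (k a))) = a \<and> pt (fst (k a)) (corner_point Y (snd (k a))) = x" by (rule exE)
  define f s where "f a = fst (k a)" and "s a = snd (k a)" for a
  have fs: "f a \<in> W" "s a \<in> corners Y" "cdim Y (fst (s a)) = 1" "half_point Y (s a) \<in> P (f a)" "corner_point Y (s a) \<in> P (f a)"
      "pt (f a) (half_point Y (s a)) = a" "pt (f a) (corner_point Y (s a)) = x" if "a \<in> A" for a
    using bspec[OF k that] unfolding f_def s_def by simp_all
  let ?K = "(\<lambda>a. (f a, s a)) ` A"
  have "\<exists>w \<rho>. w \<in> W \<and> \<rho> \<in> corners Y \<and> half_point Y \<rho> \<in> P w \<and>
        (\<forall>\<kappa>\<in>?K. E (fst \<kappa>) (corner_point Y (snd \<kappa>)) w (corner_point Y \<rho>)) \<and>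
        (\<forall>\<kappa>\<in>?K. \<exists>b\<in>corner_edges Y \<rho>. E (fst \<kappa>) (half_point Y (snd \<kappa>)) w b) \<and>
        (\<forall>b\<in>corner_edges Y \<rho>. \<exists>\<kappa>\<in>?K. E (fst \<kappa>) (half_point Y (snd \<kappa>)) w b)"
  proof (rule E_flag)
    show "finite ?K" "?K \<noteq> {}" using A by auto
  next
    fix \<kappa> assume "\<kappa> \<in> ?K"
    then obtain a where a: "\<kappa> = (f a, s a)" "a \<in> A" by (rule imageE)
    show "fst \<kappa> \<in> W \<and> snd \<kappa> \<in> corners Y \<and> cdim Y (fst (snd \<kappa>)) = 1 \<and> half_point Y (snd \<kappa>) \<in> P (fst \<kappa>)"
      unfolding a(1) fst_conv snd_conv by (intro conjI fs a(2))
    fix \<mu> assume "\<mu> \<in> ?K"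
    then obtain b where b: "\<mu> = (f b, s b)" "b \<in> A" by (rule imageE)
    show "E (fst \<kappa>) (corner_point Y (snd \<kappa>)) (fst \<mu>) (corner_point Y (snd \<mu>))"
      unfolding a(1) b(1) fst_conv snd_conv pt_eq[OF fs(1,5)[OF a(2)] fs(1,5)[OF b(2)], symmetric]
      using fs(7)[OF a(2)] fs(7)[OF b(2)] by simp
    show "E (fst \<kappa>) (half_point Y (snd \<kappa>)) (fst \<mu>) (half_point Y (snd \<mu>)) \<or>
        (\<exists>w \<tau> a b. w \<in> W \<and> \<tau> \<in> corners Y \<and> half_point Y \<tau> \<in> P w \<and> corner_edges Y \<tau> = {a, b} \<and>
          E (fst \<kappa>) (corner_point Y (snd \<kappa>)) w (corner_point Y \<tau>) \<and>
          E (fst \<kappa>) (half_point Y (snd \<kappa>)) w a \<and> E (fst \<mu>) (half_point Y (snd \<mu>)) w b)"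
    proof (cases "a = b")
      case True
      then show ?thesis unfolding a(1) b(1) fst_conv snd_conv using E_refl[OF fs(1,4)[OF b(2)]] by simp
    next
      case False
      then obtain \<tau> where \<tau>: "\<tau> \<in> link glued x" "corner_edges glued \<tau> = {a, b}" using squares a(2) b(2) by blast
      have t: "\<tau> \<in> corners glued" "corner_point glued \<tau> = x" using \<tau>(1) unfolding link_corners by simp_all
      obtain w \<sigma> where \<sigma>: "w \<in> W" "\<sigma> \<in> corners Y" "half_point Y \<sigma> \<in> P w" "corner_point Y \<sigma> \<in> P w" "corner_edges Y \<sigma> \<subseteq> P w"
        "cdim glued (fst \<tau>) = cdim Y (fst \<sigma>)" "half_point glued \<tau> = pt w (half_point Y \<sigma>)"
        "corner_point glued \<tau> = pt w (corner_point Y \<sigma>)" "corner_edges glued \<tau> = pt w ` corner_edges Y \<sigma>"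
        by (rule corner_glued[OF t(1)])
      have im: "pt w ` corner_edges Y \<sigma> = {a, b}" using \<tau>(2) \<sigma>(9) by simp
      have "a \<in> pt w ` corner_edges Y \<sigma>" "b \<in> pt w ` corner_edges Y \<sigma>" unfolding im by simp_all
      then obtain a' b' where a': "a = pt w a'" "a' \<in> corner_edges Y \<sigma>" and b': "b = pt w b'" "b' \<in> corner_edges Y \<sigma>"
        by (elim imageE)
      have ce: "corner_edges Y \<sigma> = {a', b'}"
      proof (intro equalityI subsetI)
        fix y assume y: "y \<in> corner_edges Y \<sigma>"
        then have "pt w y \<in> {a, b}" unfolding im[symmetric] by (rule imageI)
        then have "pt w y = pt w a' \<or> pt w y = pt w b'" using a'(1) b'(1) by blast
        then have "E w y w a' \<or> E w y w b'"
          unfolding pt_eq[OF \<sigma>(1) subsetD[OF \<sigma>(5) y] \<sigma>(1) subsetD[OF \<sigma>(5) a'(2)]]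
            pt_eq[OF \<sigma>(1) subsetD[OF \<sigma>(5) y] \<sigma>(1) subsetD[OF \<sigma>(5) b'(2)]] .
        then show "y \<in> {a', b'}" by (elim disjE) (drule E_unique, simp)+
      qed (use a'(2) b'(2) in blast)
      have "E (f a) (corner_point Y (s a)) w (corner_point Y \<sigma>)"
        unfolding pt_eq[OF fs(1,5)[OF a(2)] \<sigma>(1,4), symmetric] using fs(7)[OF a(2)] t(2) \<sigma>(8) by simp
      moreover have "E (f a) (half_point Y (s a)) w a'"
        unfolding pt_eq[OF fs(1,4)[OF a(2)] \<sigma>(1) subsetD[OF \<sigma>(5) a'(2)], symmetric] using fs(6)[OF a(2)] a'(1) by simp
      moreover have "E (f b) (half_point Y (s b)) w b'"
        unfolding pt_eq[OF fs(1,4)[OF b(2)] \<sigma>(1) subsetD[OF \<sigma>(5) b'(2)], symmetric] using fs(6)[OF b(2)] b'(1) by simp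
      ultimately show ?thesis
        unfolding a(1) b(1) fst_conv snd_conv using \<sigma>(1-3) ce by (intro disjI2 exI[of _ w] exI[of _ \<sigma>] exI[of _ a'] exI[of _ b'] conjI)
    qed
  qed
  then obtain w \<rho> where \<rho>: "w \<in> W" "\<rho> \<in> corners Y" "half_point Y \<rho> \<in> P w"
      "\<forall>\<kappa>\<in>?K. E (fst \<kappa>) (corner_point Y (snd \<kappa>)) w (corner_point Y \<rho>)"
      "\<forall>\<kappa>\<in>?K. \<exists>b\<in>corner_edges Y \<rho>. E (fst \<kappa>) (half_point Y (snd \<kappa>)) w b"
      "\<forall>b\<in>corner_edges Y \<rho>. \<exists>\<kappa>\<in>?K. E (fst \<kappa>) (half_point Y (snd \<kappa>)) w b" by (elim exE conjE)
  obtain \<tau> where \<tau>: "\<tau> \<in> corners glued" "corner_point glued \<tau> = pt w (corner_point Y \<rho>)"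
      "corner_edges glued \<tau> = pt w ` corner_edges Y \<rho>"
    by (rule corner_glued_exists[OF \<rho>(1-3)])
  have pt_E: "pt v p = pt v' p'" if "E v p v' p'" for v p v' p'
    using pt_eq E_site[OF that] E_site'[OF that] that by blast
  have "corner_point glued \<tau> = x"
  proof -
    obtain a where a: "a \<in> A" using A(1) by blast
    have "E (f a) (corner_point Y (s a)) w (corner_point Y \<rho>)" using bspec[OF \<rho>(4) imageI[OF a]] by simp
    from pt_E[OF this] show ?thesis using \<tau>(2) fs(7)[OF a] by simp
  qed
  moreover have "corner_edges glued \<tau> = A"
  proof (intro equalityI subsetI)
    fix y assume "y \<in> corner_edges glued \<tau>"
    then obtain b where b: "y = pt w b" "b \<in> corner_edges Y \<rho>" unfolding \<tau>(3) by (rule imageE)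
    obtain \<kappa> where "\<kappa> \<in> ?K" and \<kappa>: "E (fst \<kappa>) (half_point Y (snd \<kappa>)) w b" using \<rho>(6) b(2) by blast
    then obtain a where a: "\<kappa> = (f a, s a)" "a \<in> A" by (elim imageE)
    from pt_E[OF \<kappa>] have "y = a" unfolding b(1) a(1) using fs(6)[OF a(2)] by simp
    then show "y \<in> A" using a(2) by simp
  next
    fix a assume a: "a \<in> A"
    obtain b where b: "b \<in> corner_edges Y \<rho>" "E (f a) (half_point Y (s a)) w b" using bspec[OF \<rho>(5) imageI[OF a]] by auto
    from pt_E[OF b(2)] have "a = pt w b" using fs(6)[OF a] by simp
    then show "a \<in> corner_edges glued \<tau>" unfolding \<tau>(3) using b(1) by (rule image_eqI)
  qed
  moreover have "\<tau> \<in> link glued x" unfolding link_corners using \<tau>(1) calculation(1) by (rule conjI)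
  ultimately show "\<exists>\<sigma>\<in>link glued x. corner_edges glued \<sigma> = A" by blast
qed

lemma npc_glued: "npc glued"
  unfolding npc_iff by (intro conjI cube_complex_glued edge_simplicial_glued edge_flag_glued)

section \<open>The embedded copy and the automorphisms\<close>

text \<open>The cells of the subcomplex are those whose centre lies in the copy; such a cell lies in the copy
  completely, since identifications carry cells to cells.\<close>

lemma embeds:
  assumes b: "b \<in> W" and Pb: "P b = points Y"
  shows "embeds_as_subcomplex (pt b) Y glued"
proof -
  define S where "S = {n \<in> cells glued. chart glued n (bary (cdim glued n)) \<in> pt b ` points Y}"
  let ?Z = "subcomplex_on glued S"
  have [simp]: "cells ?Z = S" "cdim ?Z = cdim glued" "chart ?Z = chart glued" unfolding subcomplex_on_def by auto
  have SX: "S \<subseteq> cells glued" unfolding S_def by blast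
  have cell: "\<exists>d g. d \<in> cells Y \<and> cdim Y d = cdim glued n \<and> face_map (cdim glued n) (cdim glued n) g \<and>
      (\<forall>u\<in>cube (cdim glued n). chart glued n u = pt b (chart Y d (g u)))" if n: "n \<in> S" for n
  proof -
    obtain p where p: "p \<in> points Y" "chart glued n (bary (cdim glued n)) = pt b p" "n \<in> cells glued"
      using n unfolding S_def by blast
    obtain w c where wc: "w \<in> W" "c \<in> cells Y" "centre c \<in> P w" "cdim glued n = cdim Y c"
      "chart glued n = (\<lambda>u. pt w (chart Y c u))" "n = index (canonical w c)" by (rule glued_cellE[OF p(3)])
    have "pt w (centre c) = pt b p" using p(2) wc(4,5) unfolding centre_def by simp
    then have "E w (chart Y c (bary (cdim Y c))) b p"
      using pt_eq[OF wc(1,3) b, of p] p(1) Pb unfolding centre_def by simp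
    then obtain d g where d: "d \<in> cells Y" "cdim Y d = cdim Y c" "face_map (cdim Y c) (cdim Y c) g"
        "\<forall>x\<in>cube (cdim Y c). E w (chart Y c x) b (chart Y d (g x))"
      using E_cell[OF wc(2) bary_open] by metis
    have "chart glued n u = pt b (chart Y d (g u))" if u: "u \<in> cube (cdim glued n)" for u
    proof -
      have E: "E w (chart Y c u) b (chart Y d (g u))" using d(4) u wc(4) by simp
      then show ?thesis unfolding wc(5) using pt_eq E_site[OF E] E_site'[OF E] by blast
    qed
    then show ?thesis using d(1-3) wc(4) by auto
  qed
  have inS: "n \<in> S" if n: "cell_to_cell (pt b) Y c glued n g" and c: "c \<in> cells Y" for n g c
  proof -
    have n: "n \<in> cells glued" "cdim glued n = cdim Y c" "face_map (cdim Y c) (cdim Y c) g"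
      "\<forall>u\<in>cube (cdim Y c). pt b (chart Y c u) = chart glued n (g u)"
      using n unfolding cell_to_cell_def by auto
    have "chart glued n (bary (cdim glued n)) = pt b (centre c)"
      using bspec[OF n(4) open_cube_sub[OF bary_open]] face_map_self_bary[OF n(3)] n(2) unfolding centre_def by simp
    moreover have "centre c \<in> points Y" unfolding centre_def by (rule chart_points[OF c open_cube_sub[OF bary_open]])
    ultimately show ?thesis unfolding S_def using n(1) by blast
  qed
  have image: "chart glued n u \<in> pt b ` points Y" if n: "n \<in> S" and u: "u \<in> cube (cdim glued n)" for n u
  proof -
    obtain d g where d: "d \<in> cells Y" "cdim Y d = cdim glued n" "face_map (cdim glued n) (cdim glued n) g"
      "\<forall>u\<in>cube (cdim glued n). chart glued n u = pt b (chart Y d (g u))" using cell[OF n] by blast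
    have "chart Y d (g u) \<in> points Y" by (rule chart_points[OF d(1)]) (use face_map_cube[OF d(3) u] d(2) in simp)
    then show ?thesis using bspec[OF d(4) u] by blast
  qed
  have sub: "is_subcomplex glued S"
    unfolding is_subcomplex_def
  proof (intro conjI SX cube_complexI; simp only: \<open>cells ?Z = S\<close> \<open>cdim ?Z = cdim glued\<close> \<open>chart ?Z = chart glued\<close>)
    fix n assume n: "n \<in> S"
    then have n': "n \<in> cells glued" using SX by blast
    show "inj_on (chart glued n) (open_cube (cdim glued n))"
      using cube_complex_glued n' unfolding cube_complex_def by blast
    fix F assume F: "F \<in> cube_faces (cdim glued n)"
    obtain d g where d: "d \<in> cells glued" "face_map (cdim glued d) (cdim glued n) g" "g ` cube (cdim glued d) = F"
        "\<And>u. u \<in> cube (cdim glued d) \<Longrightarrow> chart glued n (g u) = chart glued d u"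
      by (rule face_cell[OF cube_complex_glued n' F]) blast
    have "chart glued d (bary (cdim glued d)) \<in> pt b ` points Y"
      using image[OF n face_map_cube[OF d(2) open_cube_sub[OF bary_open]]] d(4)[OF open_cube_sub[OF bary_open]] by simp
    then have "d \<in> S" unfolding S_def using d(1) by blast
    then show "\<exists>d\<in>S. \<exists>g. face_map (cdim glued d) (cdim glued n) g \<and> g ` cube (cdim glued d) = F \<and>
        (\<forall>u\<in>cube (cdim glued d). chart glued n (g u) = chart glued d u)" using d(2-4) by blast
  next
    fix c d u w assume "c \<in> S" "d \<in> S" "u \<in> open_cube (cdim glued c)" "w \<in> open_cube (cdim glued d)" "chart glued c u = chart glued d w"
    then show "c = d" using open_cells_glued SX by blast
  qed
  have inj: "inj_on (pt b) (points Y)"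
  proof (rule inj_onI)
    fix p q assume "p \<in> points Y" "q \<in> points Y" "pt b p = pt b q"
    then have "E b p b q" using pt_eq[OF b _ b, of p q] Pb by simp
    then show "p = q" by (rule E_unique)
  qed
  have fwd: "\<exists>n g. n \<in> S \<and> cell_to_cell (pt b) Y c glued n g" if c: "c \<in> cells Y" for c
  proof -
    have "centre c \<in> P b" unfolding Pb centre_def by (rule chart_points[OF c open_cube_sub[OF bary_open]])
    then show ?thesis using pt_cell[OF b c] inS[OF _ c] by blast
  qed
  have pts: "pt b ` points Y = points ?Z"
  proof (intro equalityI subsetI)
    fix x assume "x \<in> pt b ` points Y"
    then obtain p where p: "p \<in> points Y" "x = pt b p" by blast
    obtain c u where c: "c \<in> cells Y" "u \<in> open_cube (cdim Y c)" "p = chart Y c u" by (rule points_open[OF Y p(1)])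
    obtain n g where n: "n \<in> S" "cell_to_cell (pt b) Y c glued n g" using fwd[OF c(1)] by blast
    then have g: "cdim glued n = cdim Y c" "face_map (cdim Y c) (cdim Y c) g" "\<forall>u\<in>cube (cdim Y c). pt b (chart Y c u) = chart glued n (g u)"
      unfolding cell_to_cell_def by auto
    have "x = chart glued n (g u)" unfolding p(2) c(3) using bspec[OF g(3) open_cube_sub[OF c(2)]] .
    moreover have "g u \<in> cube (cdim glued n)" unfolding g(1) by (rule face_map_cube[OF g(2) open_cube_sub[OF c(2)]])
    ultimately show "x \<in> points ?Z" using chart_points[of n ?Z "g u"] n(1) by simp
  next
    fix x assume "x \<in> points ?Z"
    then show "x \<in> pt b ` points Y" unfolding points_def[of ?Z] using image by auto
  qed
  have "cellular (pt b) Y ?Z"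
    unfolding cellular_def
  proof
    fix c assume "c \<in> cells Y"
    then obtain n g where "n \<in> S" "cell_to_cell (pt b) Y c glued n g" using fwd by blast
    then have "cell_to_cell (pt b) Y c ?Z n g" unfolding cell_to_cell_def by simp
    then show "\<exists>d g. cell_to_cell (pt b) Y c ?Z d g" by blast
  qed
  moreover have "cellular (inv_into (points Y) (pt b)) ?Z Y"
    unfolding cellular_def
  proof
    fix n assume "n \<in> cells ?Z"
    then have "n \<in> S" by simp
    then obtain d g where d: "d \<in> cells Y" "cdim Y d = cdim glued n" "face_map (cdim glued n) (cdim glued n) g"
      "\<forall>u\<in>cube (cdim glued n). chart glued n u = pt b (chart Y d (g u))" using cell by blast
    have "inv_into (points Y) (pt b) (chart glued n u) = chart Y d (g u)" if u: "u \<in> cube (cdim glued n)" for u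
    proof -
      have "chart Y d (g u) \<in> points Y" by (rule chart_points[OF d(1)]) (use face_map_cube[OF d(3) u] d(2) in simp)
      then show ?thesis using bspec[OF d(4) u] inv_into_f_f[OF inj] by simp
    qed
    then have "cell_to_cell (inv_into (points Y) (pt b)) ?Z n Y d g" unfolding cell_to_cell_def using d(1-3) by simp
    then show "\<exists>d g. cell_to_cell (inv_into (points Y) (pt b)) ?Z n Y d g" by blast
  qed
  ultimately have "cc_isomorphism (pt b) Y ?Z"
    unfolding cc_isomorphism_def bij_betw_def by (intro conjI inj pts cellular_imp_combinatorial)
  then show ?thesis unfolding embeds_as_subcomplex_def using sub by blast
qed

lemma cellular_glued:
  assumes T: "\<And>w. w \<in> W \<Longrightarrow> T w \<in> W" "\<And>w. w \<in> W \<Longrightarrow> P (T w) = P w"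
    and f: "\<And>w p. w \<in> W \<Longrightarrow> p \<in> P w \<Longrightarrow> f (pt w p) = pt (T w) p"
  shows "cellular f glued glued"
  unfolding cellular_def
proof
  fix n assume "n \<in> cells glued"
  then obtain w c where wc: "w \<in> W" "c \<in> cells Y" "centre c \<in> P w" "cdim glued n = cdim Y c"
    "chart glued n = (\<lambda>u. pt w (chart Y c u))" "n = index (canonical w c)" by (rule glued_cellE)
  have "centre c \<in> P (T w)" using wc(3) T(2)[OF wc(1)] by simp
  from pt_cell[OF T(1)[OF wc(1)] wc(2) this] obtain m g where m: "m \<in> cells glued" "cdim glued m = cdim Y c"
      "face_map (cdim Y c) (cdim Y c) g" "\<forall>u\<in>cube (cdim Y c). pt (T w) (chart Y c u) = chart glued m (g u)"
    unfolding cell_to_cell_def by blast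
  have "f (chart glued n u) = chart glued m (g u)" if u: "u \<in> cube (cdim Y c)" for u
    unfolding wc(5) f[OF wc(1) centre_P[OF wc(1-3) u]] using bspec[OF m(4) u] .
  then show "\<exists>d g. cell_to_cell f glued n glued d g"
    unfolding cell_to_cell_def wc(4) using m(1-3) by blast
qed

lemma automorphism:
  assumes bij: "bij_betw T W W" and PT: "\<And>w. w \<in> W \<Longrightarrow> P (T w) = P w"
    and ET: "\<And>w w' p q. w \<in> W \<Longrightarrow> w' \<in> W \<Longrightarrow> E (T w) p (T w') q \<longleftrightarrow> E w p w' q"
  shows "\<exists>\<Phi>\<in>Aut glued. \<forall>w\<in>W. \<forall>p\<in>P w. \<Phi> (pt w p) = pt (T w) p"
proof -
  have TW: "T w \<in> W" if "w \<in> W" for w using bij that by (rule bij_betw_apply)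
  define f where "f x = (let wp = (SOME wp. fst wp \<in> W \<and> snd wp \<in> P (fst wp) \<and> pt (fst wp) (snd wp) = x) in
     pt (T (fst wp)) (snd wp))" for x
  have f: "f (pt w p) = pt (T w) p" if w: "w \<in> W" "p \<in> P w" for w p
  proof -
    let ?Q = "\<lambda>wp. fst wp \<in> W \<and> snd wp \<in> P (fst wp) \<and> pt (fst wp) (snd wp) = pt w p"
    have "?Q (w, p)" using w by simp
    then have Q: "?Q (SOME wp. ?Q wp)" by (rule someI)
    obtain w' p' where wp: "(SOME wp. ?Q wp) = (w', p')" by (cases "SOME wp. ?Q wp")
    have w': "w' \<in> W" "p' \<in> P w'" "pt w' p' = pt w p" using Q unfolding wp by simp_all
    have "E w' p' w p" using pt_eq[OF w'(1,2) w] w'(3) by simp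
    then have "E (T w') p' (T w) p" using ET[OF w'(1) w(1)] by simp
    then have "pt (T w') p' = pt (T w) p"
      using pt_eq[OF TW[OF w'(1)] _ TW[OF w(1)]] PT[OF w'(1)] PT[OF w(1)] w w' by simp
    then show ?thesis unfolding f_def Let_def wp by simp
  qed
  define T' where "T' = inv_into W T"
  have T': "T' w \<in> W" "T (T' w) = w" if "w \<in> W" for w
    using that bij unfolding T'_def bij_betw_def by (auto simp: inv_into_into f_inv_into_f)
  have PT': "P (T' w) = P w" if "w \<in> W" for w using PT[OF T'(1)[OF that]] T'(2)[OF that] by simp
  have inj: "inj_on f (points glued)"
  proof (rule inj_onI)
    fix x y assume "x \<in> points glued" "y \<in> points glued" "f x = f y"
    then obtain w p w' p' where w: "w \<in> W" "p \<in> P w" "x = pt w p" and w': "w' \<in> W" "p' \<in> P w'" "y = pt w' p'"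
      and eq: "f x = f y" unfolding glued_points by blast
    have "pt (T w) p = pt (T w') p'" using eq unfolding w(3) w'(3) f[OF w(1,2)] f[OF w'(1,2)] .
    then have "E (T w) p (T w') p'"
      using pt_eq[OF TW[OF w(1)] _ TW[OF w'(1)]] PT[OF w'(1)] PT[OF w(1)] w w' by simp
    then show "x = y" unfolding w(3) w'(3) pt_eq[OF w(1,2) w'(1,2)] using ET[OF w(1) w'(1)] by simp
  qed
  have ff: "f (pt (T' w) p) = pt w p" if "w \<in> W" "p \<in> P w" for w p
    using f[OF T'(1)[OF that(1)], of p] PT'[OF that(1)] T'(2)[OF that(1)] that(2) by simp
  have in_points: "pt w p \<in> points glued" if "w \<in> W" "p \<in> P w" for w p
    using that unfolding glued_points by blast
  have surj: "f ` points glued = points glued"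
  proof (intro equalityI subsetI)
    fix y assume "y \<in> f ` points glued"
    then obtain w p where w: "w \<in> W" "p \<in> P w" "y = f (pt w p)" unfolding glued_points by (auto simp: glued_points)
    show "y \<in> points glued" unfolding w(3) f[OF w(1,2)] by (rule in_points[OF TW[OF w(1)]]) (simp add: PT[OF w(1)] w(2))
  next
    fix y assume "y \<in> points glued"
    then obtain w p where w: "w \<in> W" "p \<in> P w" "y = pt w p" unfolding glued_points by blast
    have "pt (T' w) p \<in> points glued" by (rule in_points[OF T'(1)[OF w(1)]]) (simp add: PT'[OF w(1)] w(2))
    then show "y \<in> f ` points glued" unfolding w(3) ff[OF w(1,2), symmetric] by (rule imageI)
  qed
  have inv: "inv_into (points glued) f (pt w p) = pt (T' w) p" if w: "w \<in> W" "p \<in> P w" for w p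
  proof -
    have "pt (T' w) p \<in> points glued" by (rule in_points[OF T'(1)[OF w(1)]]) (simp add: PT'[OF w(1)] w(2))
    from inv_into_f_f[OF inj this] show ?thesis unfolding ff[OF w] .
  qed
  have "cc_isomorphism f glued glued"
    unfolding cc_isomorphism_def bij_betw_def
    using inj surj cellular_imp_combinatorial[OF cellular_glued[of T f, OF TW PT f]]
      cellular_imp_combinatorial[OF cellular_glued[of T' "inv_into (points glued) f", OF T'(1) PT' inv]] by blast
  then show ?thesis unfolding Aut_def using f by blast
qed

end

section \<open>Extending partial local isometries\<close>

theorem theorem1p2:
  fixes Y :: "('c, 'p) cube_complex"
  assumes "compact_space (cc_topology Y)" and "npc Y"
  shows "\<exists>(R :: (nat, nat \<times> (nat \<Rightarrow> real)) cube_complex) e.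
           compact_space (cc_topology R) \<and> npc R \<and> embeds_as_subcomplex e Y R \<and>
           (\<forall>(S, \<phi>) \<in> injective_connected_partial_isometries Y.
              \<exists>\<Phi>\<in>Aut R. \<forall>p\<in>points (subcomplex_on Y S). \<Phi> (e p) = e (\<phi> p))"
proof -
  have Y: "cube_complex Y" using assms(2) npc_iff by blast
  have finY: "finite (cells Y)" by (rule compact_space_imp_finite_cells[OF Y assms(1)])
  define \<Omega> where "\<Omega> = partial_isometries Y"
  define I where "I = {j \<in> \<Omega>. \<exists>j'\<in>\<Omega>. inverse_pair j j'}"
  have fin\<Omega>: "finite \<Omega>" unfolding \<Omega>_def by (rule finite_partial_isometries[OF Y finY])
  have comp: "f \<circ>\<^sub>m h \<in> \<Omega>" if "f \<in> \<Omega>" "h \<in> \<Omega>" for f h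
    using that unfolding \<Omega>_def by (rule partial_isometries_comp)
  obtain \<Theta> :: "(('p \<rightharpoonup> 'p) \<times> nat) set" where \<Theta>: "finite \<Theta>" "\<And>f. f \<in> \<Omega> \<Longrightarrow> (f, 0) \<in> \<Theta>" "\<And>\<theta>. \<theta> \<in> \<Theta> \<Longrightarrow> fst \<theta> \<in> \<Omega>"
    and ext: "\<And>j j'. j \<in> \<Omega> \<Longrightarrow> j' \<in> \<Omega> \<Longrightarrow> inverse_pair j j' \<Longrightarrow>
      \<exists>\<gamma>. \<gamma> permutes \<Theta> \<and> (\<forall>\<theta>\<in>\<Theta>. \<forall>p q. j p = Some q \<longrightarrow> fst (\<gamma> \<theta>) q = fst \<theta> p) \<and>
         \<gamma> (Some |` dom j, 0) = (j', 0)"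
    by (rule permutation_extension[OF fin\<Omega> comp]) blast+
  have "\<exists>\<gamma>. \<gamma> permutes \<Theta> \<and> (\<forall>\<theta>\<in>\<Theta>. \<forall>p q. j p = Some q \<longrightarrow> fst (\<gamma> \<theta>) q = fst \<theta> p) \<and>
      (\<exists>j'\<in>\<Omega>. inverse_pair j j' \<and> \<gamma> (Some |` dom j, 0) = (j', 0))" if j: "j \<in> I" for j
  proof -
    obtain j' where j': "j \<in> \<Omega>" "j' \<in> \<Omega>" "inverse_pair j j'" using j unfolding I_def by blast
    from ext[OF j'] j'(2,3) show ?thesis by blast
  qed
  from bchoice[OF ballI[OF this]] obtain \<gamma> where \<gamma>: "\<forall>j\<in>I. \<gamma> j permutes \<Theta> \<and>
      (\<forall>\<theta>\<in>\<Theta>. \<forall>p q. j p = Some q \<longrightarrow> fst (\<gamma> j \<theta>) q = fst \<theta> p) \<and>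
      (\<exists>j'\<in>\<Omega>. inverse_pair j j' \<and> \<gamma> j (Some |` dom j, 0) = (j', 0))" by (rule exE)
  interpret ext: extended_isometries Y I \<Theta> \<gamma>
  proof
    show "cube_complex Y" "finite I" "finite \<Theta>" using Y fin\<Omega> \<Theta>(1) unfolding I_def by auto
    show "j \<in> partial_isometries Y" if "j \<in> I" for j using that unfolding I_def \<Omega>_def by simp
    show "(f, 0) \<in> \<Theta>" if "f \<in> partial_isometries Y" for f using \<Theta>(2) that unfolding \<Omega>_def .
    show "fst \<theta> \<in> partial_isometries Y" if "\<theta> \<in> \<Theta>" for \<theta> using \<Theta>(3)[OF that] unfolding \<Omega>_def .
    fix j assume j: "j \<in> I"
    note g = bspec[OF \<gamma> j]
    show "\<gamma> j permutes \<Theta>" using g by (elim conjE)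
    show "\<exists>j'\<in>partial_isometries Y. inverse_pair j j' \<and> \<gamma> j (Some |` dom j, 0) = (j', 0)"
      using g unfolding \<Omega>_def by (elim conjE)
    show "fst (\<gamma> j \<theta>) q = fst \<theta> p" if "\<theta> \<in> \<Theta>" "j p = Some q" for \<theta> p q using g that by blast
  qed
  interpret sys: exact_system Y I ext.sites "({}, id)" ext.step ext.shift ext.exact_glue
    by (rule ext.exact_system)
  interpret glu: flag_gluing Y sys.copies sys.present sys.same
    by (rule sys.flag_gluing[OF assms(2) finY])
  let ?e = "glu.pt sys.base"
  have auts: "\<exists>\<Phi>\<in>Aut glu.glued. \<forall>p\<in>points (subcomplex_on Y S). \<Phi> (?e p) = ?e (\<phi> p)"
    if S: "(S, \<phi>) \<in> injective_connected_partial_isometries Y" for S \<phi>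
  proof -
    have "partial_local_isometry Y S \<phi>" "inj_on \<phi> (points (subcomplex_on Y S))"
      using S unfolding injective_connected_partial_isometries_def by auto
    then obtain j j' where j: "j \<in> \<Omega>" "j' \<in> \<Omega>" "\<And>p q. j p = Some q \<longleftrightarrow> j' q = Some p"
        "\<And>p. p \<in> points (subcomplex_on Y S) \<Longrightarrow> j p = Some (\<phi> p)"
      unfolding \<Omega>_def by (rule partial_local_isometry_maps[OF Y]) blast
    have jI: "j \<in> I" unfolding I_def inverse_pair_def using j by blast
    \<comment> \<open>The map \<open>sys.move j\<close> takes the base copy to a copy whose point \<open>j p\<close> is the point \<open>p\<close> of the base
      copy; so the automorphism induced by its inverse takes \<open>p\<close> to \<open>j p\<close>.\<close>
    define T where "T = inv_into sys.copies (sys.move j)"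
    have mv: "bij_betw (sys.move j) sys.copies sys.copies" by (rule sys.move_bij[OF jI])
    have T: "T w \<in> sys.copies" "sys.move j (T w) = w" if "w \<in> sys.copies" for w
      using mv that unfolding T_def bij_betw_def by (auto simp: inv_into_into f_inv_into_f)
    have bijT: "bij_betw T sys.copies sys.copies" unfolding T_def by (rule bij_betw_inv_into[OF mv])
    have PT: "sys.present (T w) = sys.present w" if "w \<in> sys.copies" for w
      using sys.present_move[OF jI T(1)[OF that]] T(2)[OF that] by simp
    have ET: "sys.same (T w) p (T w') q \<longleftrightarrow> sys.same w p w' q" if "w \<in> sys.copies" "w' \<in> sys.copies" for w w' p q
      using sys.same_move[OF jI T(1)[OF that(1)] T(1)[OF that(2)], of p q] T(2)[OF that(1)] T(2)[OF that(2)] by simp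
    obtain \<Phi> where \<Phi>: "\<Phi> \<in> Aut glu.glued"
        "\<forall>w\<in>sys.copies. \<forall>p\<in>sys.present w. \<Phi> (glu.pt w p) = glu.pt (T w) p"
      using glu.automorphism[OF bijT PT ET] by blast
    have "\<Phi> (?e p) = ?e (\<phi> p)" if p: "p \<in> points (subcomplex_on Y S)" for p
    proof -
      note b = sys.base_copy
      have "sys.same sys.base p (sys.move j sys.base) (\<phi> p)" by (rule sys.same_base_move[OF jI j(4)[OF p]])
      then have E: "sys.same (T sys.base) p sys.base (\<phi> p)"
        using sys.same_move[OF jI T(1)[OF b] b, of p "\<phi> p"] T(2)[OF b] by simp
      have "\<Phi> (?e p) = glu.pt (T sys.base) p"
        using \<Phi>(2) b glu.E_site[OF E] PT[OF b] by simp
      also have "\<dots> = ?e (\<phi> p)"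
        using glu.pt_eq glu.E_site[OF E] glu.E_site'[OF E] E by blast
      finally show ?thesis .
    qed
    then show ?thesis using \<Phi>(1) by blast
  qed
  show ?thesis
  proof (intro exI[of _ glu.glued] exI[of _ ?e] conjI)
    show "compact_space (cc_topology glu.glued)" "npc glu.glued" by (rule glu.glued_compact glu.npc_glued)+
    show "embeds_as_subcomplex ?e Y glu.glued" by (rule glu.embeds[OF sys.base_copy sys.present_base])
    show "\<forall>(S, \<phi>)\<in>injective_connected_partial_isometries Y.
        \<exists>\<Phi>\<in>Aut glu.glued. \<forall>p\<in>points (subcomplex_on Y S). \<Phi> (?e p) = ?e (\<phi> p)"
      using auts by blast
  qed
qed

end
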